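(* Let $\Gamma_\alpha$ be a finite two-person zero-sum limiting average stochastic game with all data, namely the rewards $r(s,a,b)$ and the transition probabilities $p(s'|s,a,b)$, lying in the ordered field $\mathbb{F}$ of real algebraic numbers. Then the entries $v_s$ of the value vector $\mathbf{v}=(v_1,\dots,v_N)$ of $\Gamma_\alpha$ are also algebraic numbers, for each $s=1,2,\dots,N$.
   Context: $\mathbb{F}$ denotes the ordered field of real algebraic numbers. Stochastic game: there are finitely many states $s=1,\dots,N$. In state $s$ player I chooses an action $a\in\{1,\dots,m_s\}$ and player II chooses an action $b\in\{1,\dots,n_s\}$ ($m_s,n_s\ge 1$ finite). Player II then pays player I the real amount $r(s,a,b)$, and the game moves to state $s'$ at the next stage with probability $p(s'|s,a,b)$, where $p(s'|s,a,b)\ge 0$ and $\sum_{s'=1}^N p(s'|s,a,b)=1$. A (general, history-dependent) strategy of a player prescribes, at each stage, a probability distribution on the player's actions in the current state as a function of the complete past history of states and actions. It is stationary if this distribution depends only on the current state. An initial state $s$ and a pair of strategies $(\mu,\nu)$ for players I and II determine a probability distribution over sequences of states and actions. Let $R_t$ be the payoff to player I at stage $t=0,1,2,\dots$ and $E_{\mu\nu s}(R_t)$ its expectation. The limiting average (Cesàro average) game $\Gamma_\alpha$ has payoff $$v(\mu,\nu,s)=\liminf_{\tau\to\infty}\frac{1}{\tau+1}\sum_{t=0}^{\tau}E_{\mu\nu s}(R_t).$$ Its value from state $s$ is $v_s=\sup_\mu\inf_\nu v(\mu,\nu,s)=\inf_\nu\sup_\mu v(\mu,\nu,s)$, with $\mu,\nu$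 ranging over history-dependent strategies. This value exists by a theorem of Mertens and Neyman, who also showed that $v_s=\lim_{\beta\to1^-}v_s(\beta)$. Here, for $\beta\in(0,1)$, $v_s(\beta)=\sup_\mu\inf_\nu v_\beta(\mu,\nu,s)=\inf_\nu\sup_\mu v_\beta(\mu,\nu,s)$ is the value from state $s$ of the $\beta$-discounted game with payoff $v_\beta(\mu,\nu,s)=\sum_{t=0}^\infty\beta^{t}(1-\beta)E_{\mu\nu s}(R_t)$, with $\mu,\nu$ ranging over stationary strategies (it exists by a theorem of Shapley). Equivalently, $(v_1(\beta),\dots,v_N(\beta))$ is the unique $\mathbf{u}\in\mathbb{R}^N$ such that, for every $s$, $u_s$ equals the value of the matrix game with entries $(1-\beta)r(s,a,b)+\beta\sum_{s'=1}^N p(s'|s,a,b)u_{s'}$, $1\le a\le m_s$, $1\le b\le n_s$. Here the value of an $m\times n$ real matrix game $A$ is $\max_x\min_y x^TAy=\min_y\max_x x^TAy$ over probability vectors $x\in\mathbb{R}^m$, $y\in\mathbb{R}^n$. *)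

theory Defs
  imports "HOL-Probability.Probability" "HOL-Computational_Algebra.Computational_Algebra"
begin

text \<open>
  The states are \<open>{1..nstates G}\<close>; in state \<open>s\<close> the actions of players I and II are
  \<open>{1..acts1 G s}\<close> and \<open>{1..acts2 G s}\<close>. The number \<open>p(s'|s,a,b)\<close> is
  \<open>pmf (transition G s a b) s'\<close>. Values of the fields outside these index ranges are irrelevant.
\<close>

record stochastic_game =
  nstates :: nat
  acts1 :: "nat \<Rightarrow> nat"
  acts2 :: "nat \<Rightarrow> nat"
  reward :: "nat \<Rightarrow> nat \<Rightarrow> nat \<Rightarrow> real"
  transition :: "nat \<Rightarrow> nat \<Rightarrow> nat \<Rightarrow> nat pmf"

definition states :: "stochastic_game \<Rightarrow> nat set" where
  "states G = {1..nstates G}"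

definition actions1 :: "stochastic_game \<Rightarrow> nat \<Rightarrow> nat set" where
  "actions1 G s = {1..acts1 G s}"

definition actions2 :: "stochastic_game \<Rightarrow> nat \<Rightarrow> nat set" where
  "actions2 G s = {1..acts2 G s}"

definition wf_game :: "stochastic_game \<Rightarrow> bool" where
  "wf_game G \<longleftrightarrow>
     (\<forall>s\<in>states G. acts1 G s \<ge> 1 \<and> acts2 G s \<ge> 1 \<and>
       (\<forall>a\<in>actions1 G s. \<forall>b\<in>actions2 G s. set_pmf (transition G s a b) \<subseteq> states G))"

text \<open>
  A history lists, in chronological order, the triples (state, action of I, action of II) of the
  completed stages. A strategy maps a history and the current state to a mixed action.
\<close>

type_synonym history = "(nat \<times> nat \<times> nat) list"
type_synonym strategy = "history \<Rightarrow> nat \<Rightarrow> nat pmf"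

definition strategies1 :: "stochastic_game \<Rightarrow> strategy set" where
  "strategies1 G = {\<mu>. \<forall>h. \<forall>s\<in>states G. set_pmf (\<mu> h s) \<subseteq> actions1 G s}"

definition strategies2 :: "stochastic_game \<Rightarrow> strategy set" where
  "strategies2 G = {\<nu>. \<forall>h. \<forall>s\<in>states G. set_pmf (\<nu> h s) \<subseteq> actions2 G s}"

text \<open>
  Given the history and the current state, the two players randomise independently.
\<close>

definition stage :: "strategy \<Rightarrow> strategy \<Rightarrow> history \<Rightarrow> nat \<Rightarrow> (history \<times> nat \<times> nat \<times> nat) pmf" where
  "stage \<mu> \<nu> h s = map_pmf (\<lambda>(a, b). (h, s, a, b)) (pair_pmf (\<mu> h s) (\<nu> h s))"

text \<open>
  \<open>play G \<mu> \<nu> s0 t\<close> is the joint law of the states and actions at stages \<open>0, \<dots>, t\<close> when play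
  starts in \<open>s0\<close>: an outcome \<open>(h, s, a, b)\<close> consists of the history \<open>h\<close> of the stages before \<open>t\<close>
  and the state and actions at stage \<open>t\<close>. These are the finite-dimensional marginals of the
  law on infinite plays; the expectation of the stage-\<open>t\<close> payoff only involves the \<open>t\<close>-th one.
\<close>

primrec play ::
  "stochastic_game \<Rightarrow> strategy \<Rightarrow> strategy \<Rightarrow> nat \<Rightarrow> nat \<Rightarrow> (history \<times> nat \<times> nat \<times> nat) pmf" where
  "play G \<mu> \<nu> s0 0 = stage \<mu> \<nu> [] s0"
| "play G \<mu> \<nu> s0 (Suc t) =
     bind_pmf (play G \<mu> \<nu> s0 t) (\<lambda>(h, s, a, b).
       bind_pmf (transition G s a b) (\<lambda>s'. stage \<mu> \<nu> (h @ [(s, a, b)]) s'))"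

definition expected_payoff ::
  "stochastic_game \<Rightarrow> strategy \<Rightarrow> strategy \<Rightarrow> nat \<Rightarrow> nat \<Rightarrow> real" where
  "expected_payoff G \<mu> \<nu> s0 t =
     measure_pmf.expectation (play G \<mu> \<nu> s0 t) (\<lambda>(h, s, a, b). reward G s a b)"

definition limavg_payoff :: "stochastic_game \<Rightarrow> strategy \<Rightarrow> strategy \<Rightarrow> nat \<Rightarrow> ereal" where
  "limavg_payoff G \<mu> \<nu> s0 =
     liminf (\<lambda>\<tau>. ereal (1 / real (\<tau> + 1) * (\<Sum>t=0..\<tau>. expected_payoff G \<mu> \<nu> s0 t)))"

definition is_limavg_value :: "stochastic_game \<Rightarrow> nat \<Rightarrow> real \<Rightarrow> bool" where
  "is_limavg_value G s v \<longleftrightarrow>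
     ereal v = (SUP \<mu>\<in>strategies1 G. INF \<nu>\<in>strategies2 G. limavg_payoff G \<mu> \<nu> s) \<and>
     ereal v = (INF \<nu>\<in>strategies2 G. SUP \<mu>\<in>strategies1 G. limavg_payoff G \<mu> \<nu> s)"

text \<open>
  At most one \<open>v\<close> satisfies \<open>is_limavg_value G s v\<close>. That one exists for every well-formed
  game and state is the theorem of Mertens and Neyman; it is not built into the definition.
\<close>

definition limavg_value :: "stochastic_game \<Rightarrow> nat \<Rightarrow> real" where
  "limavg_value G s = (THE v. is_limavg_value G s v)"

end

theory Submission
  imports Defs "Jordan_Normal_Form.Determinant"
begin

text \<open>
  Throughout, \<open>l\<close> is the weight of the present stage, that is \<open>1 - \<beta>\<close> for the discount factor
  \<open>\<beta>\<close>; the limiting average game is the limit \<open>l \<rightarrow> 0\<close>. The number \<open>limavg_value G s\<close> is a definite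
  description, so the proof has to produce the value: it shows that both players can guarantee
  \<open>lim v\<^sub>l(s)\<close>, where \<open>v\<^sub>l(s)\<close> is the discounted value, and that this limit exists and is algebraic.
  Everything comes from one fact about each state \<open>s\<close>: \<^emph>\<open>the point \<open>(l, v\<^sub>l(s))\<close> stays on an algebraic curve
  \<open>Q(l, w) = 0\<close>, where \<open>Q\<close> is a nonzero polynomial with algebraic coefficients.\<close>

  \<^bold>\<open>The curve.\<close> For pure stationary strategies \<open>f\<close> and \<open>g\<close>, Cramer's rule writes the discounted payoff
  from a state as a quotient \<open>D\<^sup>1(f, g) / D\<^sup>0(f, g)\<close> of determinants that are polynomials in \<open>l\<close>, with
  \<open>D\<^sup>0 > 0\<close>. Determinants are linear in each row, so when one player mixes independently in each state,
  numerator and denominator are both averages of their values at pure strategies. Inserting optimal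
  stationary strategies shows that in the matrix game with entries \<open>D\<^sup>1(f, g) - w D\<^sup>0(f, g)\<close> the row
  player can secure a nonnegative payoff exactly when \<open>w \<le> v\<^sub>l(s)\<close>
  (\<open>auxiliary_game_feasible_iff\<close>, an idea of Attia and Oliu-Barton). This reduces the fixed point
  system for all states to one unknown \<open>w\<close>. Whether the row player can do so is the feasibility of a linear
  program, and Fourier-Motzkin elimination shows that it depends only on the signs of finitely many
  polynomials in \<open>(l, w)\<close> (\<open>feasible_sign_determined\<close>). Since the answer changes as \<open>w\<close> crosses
  \<open>v\<^sub>l(s)\<close>, one of the nonzero polynomials vanishes there; \<open>Q\<close> is the product of all of them.

  \<^bold>\<open>What the curve gives.\<close> For all but finitely many levels \<open>c\<close>, the polynomial \<open>Q(\<cdot>, c)\<close> is nonzero, so the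
  continuous function \<open>l \<mapsto> v\<^sub>l(s)\<close> attains the level \<open>c\<close> at most as often as the degree of \<open>Q\<close> in \<open>l\<close>. Hence it converges as
  \<open>l \<rightarrow> 0\<close>, and its variation is bounded, being the integral over \<open>c\<close> of the number of crossings of the
  level \<open>c\<close>. Dividing \<open>Q\<close> by the largest possible power of \<open>l\<close> and letting \<open>l \<rightarrow> 0\<close> exhibits the limit as a
  root of a nonzero polynomial in one variable with algebraic coefficients, so it is algebraic.

  \<^bold>\<open>The limit is the value.\<close> This is the theorem of Mertens and Neyman, for which bounded variation of the
  discounted values suffices. A player keeps a statistic that grows with the excess of the payoffs
  received over the discounted value of the state reached, and plays at each stage optimally in the discounted
  game whose parameter is a slowly decreasing, integrable function of the statistic. The current
  discounted value, corrected by the tail integral of that function, is then a submartingale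
  (\<open>potential_drift\<close>), so the discounted value stays high on average, while the growth of the statistic
  turns this into a bound for the accumulated payoff (\<open>total_payoff_lower\<close>). The argument is
  written for an arbitrary payoff function and serves the second player after a change of signs.
\<close>

section \<open>Real algebraic numbers form a relatively algebraically closed field\<close>

interpretation rat_real: vector_space "\<lambda>(q::rat) (x::real). of_rat q * x"
  by unfold_locales (simp_all add: algebra_simps of_rat_add of_rat_mult)

text \<open>
  That some finite \<open>S\<close> containing \<open>1\<close> has a rational span stable under multiplication by \<open>c\<close> is
  equivalent to \<open>c\<close> being algebraic. Unlike annihilating polynomials, such sets can be shared by
  several numbers, and stability passes to sums and products.
\<close>

definition rat_span_stable :: "real \<Rightarrow> real set \<Rightarrow> bool" where
  "rat_span_stable c S \<longleftrightarrow> (\<forall>x\<in>rat_real.span S. c * x \<in> rat_real.span S)"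

lemma rat_span_stableI:
  assumes "\<And>s. s \<in> S \<Longrightarrow> c * s \<in> rat_real.span S"
  shows "rat_span_stable c S"
  unfolding rat_span_stable_def
proof
  fix x assume "x \<in> rat_real.span S"
  then show "c * x \<in> rat_real.span S"
  proof (induction rule: rat_real.span_induct_alt)
    case base show ?case using rat_real.span_zero by simp
  next
    case (step q s y)
    have "c * (of_rat q * s + y) = of_rat q * (c * s) + c * y"
      by (simp add: algebra_simps)
    then show ?case
      using rat_real.span_add[OF rat_real.span_scale[OF assms[OF step(1)]] step(2)] by simp
  qed
qed

text \<open>
  All powers of \<open>c\<close> lie in the span of \<open>S\<close>, whose dimension is at most \<open>card S\<close>; hence two of the
  powers with exponents up to \<open>card S\<close> coincide or these powers are linearly dependent over the rationals.
\<close>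

lemma algebraic_of_rat_span_stable:
  assumes S: "finite S" "1 \<in> S" and c: "rat_span_stable c S"
  shows "algebraic c"
proof (cases "inj_on (\<lambda>k. c ^ k) {..card S}")
  case False
  then obtain i j where ij: "i < j" "c ^ i = c ^ j"
    unfolding inj_on_def by (metis linorder_neqE_nat)
  define p :: "real poly" where "p = monom 1 j - monom 1 i"
  have "coeff p j = 1" using ij by (simp add: p_def)
  then have "p \<noteq> 0" by force
  moreover have "poly p c = 0" using ij by (simp add: p_def poly_monom)
  moreover have "coeff p n \<in> \<int>" for n by (simp add: p_def)
  ultimately show ?thesis by (intro algebraicI) auto
next
  case True
  have pw: "c ^ k \<in> rat_real.span S" for k
  proof (induction k)
    case 0 then show ?case using S rat_real.span_base by simp
  next
    case (Suc k) then show ?case using c by (simp add: rat_span_stable_def)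
  qed
  let ?P = "(\<lambda>k. c ^ k) ` {..card S}"
  have "card ?P = Suc (card S)" using True by (simp add: card_image)
  then have "rat_real.dependent ?P"
    using rat_real.independent_span_bound[OF S(1), of ?P] pw by force
  then obtain u v where u: "(\<Sum>v\<in>?P. of_rat (u v) * v) = 0" "v \<in> ?P" "u v \<noteq> 0"
    unfolding rat_real.dependent_finite[OF finite_imageI[OF finite_atMost]] by blast
  define p :: "real poly" where "p = (\<Sum>k\<le>card S. monom (of_rat (u (c ^ k))) k)"
  have cp: "coeff p k = (if k \<le> card S then of_rat (u (c ^ k)) else 0)" for k
    by (simp add: p_def coeff_sum sum.delta)
  have "poly p c = (\<Sum>k\<le>card S. of_rat (u (c ^ k)) * c ^ k)"
    by (simp add: p_def poly_sum poly_monom)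
  also have "\<dots> = (\<Sum>v\<in>?P. of_rat (u v) * v)"
    using True by (simp add: sum.reindex)
  finally have "poly p c = 0" using u by simp
  moreover have "p \<noteq> 0"
  proof -
    obtain k where "k \<le> card S" "v = c ^ k" using u(2) by auto
    then have "coeff p k \<noteq> 0" using u(3) cp by simp
    then show ?thesis by force
  qed
  ultimately show ?thesis by (intro algebraicI') (auto simp: cp)
qed

text \<open>
  The products \<open>s z\<^sup>k\<close> with \<open>s \<in> S\<close> and \<open>k\<close> below the degree work: since \<open>p\<close> is monic, \<open>z\<^sup>m\<close> is a
  combination of lower powers, with coefficients that map \<open>S\<close> into its span. Applied to rational
  \<open>p\<close> this adjoins one more algebraic number to \<open>S\<close>; applied to algebraic \<open>p\<close> it shows that algebraic
  over algebraic is algebraic.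
\<close>

lemma rat_span_stable_adjoin_root:
  fixes p :: "real poly"
  assumes S: "finite S" "1 \<in> S"
    and lc: "lead_coeff p = 1" and z: "poly p z = 0"
    and st: "\<And>i. rat_span_stable (coeff p i) S"
  shows "\<exists>S'. finite S' \<and> 1 \<in> S' \<and> rat_span_stable z S' \<and>
           (\<forall>c. rat_span_stable c S \<longrightarrow> rat_span_stable c S')"
proof -
  define m where "m = degree p"
  have m0: "m > 0"
  proof (rule ccontr)
    assume "\<not> m > 0"
    then obtain a where "p = [:a:]" unfolding m_def by (metis degree_eq_zeroE gr0I)
    then show False using lc z by simp
  qed
  define S' where "S' = (\<lambda>(s, k). s * z ^ k) ` (S \<times> {..<m})"
  have fin: "finite S'" using S by (simp add: S'_def)
  have one: "1 \<in> S'" unfolding S'_def using S(2) m0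
    by (intro image_eqI[of _ _ "(1, 0)"]) auto
  have base: "x * z ^ k \<in> rat_real.span S'" if "x \<in> rat_real.span S" "k < m" for x k
    using that(1)
  proof (induction rule: rat_real.span_induct_alt)
    case base show ?case using rat_real.span_zero by simp
  next
    case (step q s y)
    have "s * z ^ k \<in> S'" unfolding S'_def using step(1) that(2) by force
    moreover have "(of_rat q * s + y) * z ^ k = of_rat q * (s * z ^ k) + y * z ^ k"
      by (simp add: algebra_simps)
    ultimately show ?case
      using rat_real.span_add[OF rat_real.span_scale[OF rat_real.span_base] step(2)] by simp
  qed
  have zm: "z ^ m = - (\<Sum>i<m. coeff p i * z ^ i)"
    using z lc by (simp add: poly_altdef m_def flip: lessThan_Suc_atMost)
  have "rat_span_stable z S'"
  proof (rule rat_span_stableI)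
    fix t assume "t \<in> S'"
    then obtain s k where t: "t = s * z ^ k" "s \<in> S" "k < m" by (auto simp: S'_def)
    show "z * t \<in> rat_real.span S'"
    proof (cases "Suc k < m")
      case True
      have "z * t = s * z ^ Suc k" using t by simp
      then show ?thesis using base[OF rat_real.span_base[OF t(2)] True] by (simp only:)
    next
      case False
      then have "m = Suc k" using t by simp
      then have "z * t = s * z ^ m" using t by simp
      also have "\<dots> = - (\<Sum>i<m. (coeff p i * s) * z ^ i)"
        by (simp add: zm sum_distrib_left mult_ac)
      also have "\<dots> \<in> rat_real.span S'"
        using st rat_real.span_base[OF t(2)]
        by (intro rat_real.span_neg rat_real.span_sum base) (auto simp: rat_span_stable_def)
      finally show ?thesis .
    qed
  qed
  moreover have "rat_span_stable c S'" if c: "rat_span_stable c S" for c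
  proof (rule rat_span_stableI)
    fix t assume "t \<in> S'"
    then obtain s k where t: "t = s * z ^ k" "s \<in> S" "k < m" by (auto simp: S'_def)
    have "c * s \<in> rat_real.span S"
      using c rat_real.span_base[OF t(2)] by (simp add: rat_span_stable_def)
    then have "c * s * z ^ k \<in> rat_real.span S'" by (rule base[OF _ t(3)])
    then show "c * t \<in> rat_real.span S'" using t by (simp add: mult_ac)
  qed
  ultimately show ?thesis using fin one by blast
qed

lemma rat_span_stable_of_rat: "q \<in> \<rat> \<Longrightarrow> rat_span_stable q S"
  by (auto simp: rat_span_stable_def elim!: Rats_cases intro: rat_real.span_scale)

lemma common_rat_span_stable:
  assumes "finite C" "\<And>c. c \<in> C \<Longrightarrow> algebraic c"
  shows "\<exists>S. finite S \<and> 1 \<in> S \<and> (\<forall>c\<in>C. rat_span_stable c S)"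
  using assms
proof (induction C rule: finite_induct)
  case empty then show ?case by (intro exI[of _ "{1}"]) auto
next
  case (insert c C)
  then obtain S where S: "finite S" "1 \<in> S" "\<forall>c\<in>C. rat_span_stable c S" by auto
  from insert.prems have "algebraic c" by simp
  then obtain p where p: "\<And>i. coeff p i \<in> \<rat>" "p \<noteq> 0" "poly p c = 0"
    unfolding algebraic_altdef by blast
  let ?p = "Polynomial.smult (inverse (lead_coeff p)) p"
  have "lead_coeff ?p = 1" using p by simp
  moreover have "poly ?p c = 0" using p by simp
  moreover have "rat_span_stable (coeff ?p i) S" for i
    using p by (intro rat_span_stable_of_rat) (auto simp del: inverse_eq_divide intro!: Rats_mult Rats_inverse)
  ultimately show ?case using rat_span_stable_adjoin_root[OF S(1,2), of ?p c] S(3) by auto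
qed

lemma rat_span_stable_add:
  "rat_span_stable a S \<Longrightarrow> rat_span_stable b S \<Longrightarrow> rat_span_stable (a + b) S"
  by (auto simp: rat_span_stable_def distrib_right intro: rat_real.span_add)

lemma rat_span_stable_mult:
  "rat_span_stable a S \<Longrightarrow> rat_span_stable b S \<Longrightarrow> rat_span_stable (a * b) S"
  by (auto simp: rat_span_stable_def mult.assoc)

lemma algebraic_add_real:
  fixes a b :: real
  assumes "algebraic a" "algebraic b"
  shows "algebraic (a + b)"
proof -
  obtain S where S: "finite S" "1 \<in> S" "\<forall>c\<in>{a, b}. rat_span_stable c S"
    using common_rat_span_stable[of "{a, b}"] assms by auto
  then have "rat_span_stable (a + b) S" by (simp add: rat_span_stable_add)
  with S show ?thesis using algebraic_of_rat_span_stable by blast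
qed

lemma algebraic_mult_real:
  fixes a b :: real
  assumes "algebraic a" "algebraic b"
  shows "algebraic (a * b)"
proof -
  obtain S where S: "finite S" "1 \<in> S" "\<forall>c\<in>{a, b}. rat_span_stable c S"
    using common_rat_span_stable[of "{a, b}"] assms by auto
  then have "rat_span_stable (a * b) S" by (simp add: rat_span_stable_mult)
  with S show ?thesis using algebraic_of_rat_span_stable by blast
qed

lemma algebraic_root_of_algebraic_poly:
  fixes p :: "real poly"
  assumes alg: "\<And>i. algebraic (coeff p i)" and p: "p \<noteq> 0" "poly p z = 0"
  shows "algebraic z"
proof -
  let ?p = "Polynomial.smult (inverse (lead_coeff p)) p"
  have fin: "finite (range (coeff ?p))"
    by (simp only: range_coeff finite_insert finite_set)
  have "algebraic (coeff ?p i)" for i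
    using alg by (auto intro: algebraic_mult_real)
  then have "\<exists>S. finite S \<and> 1 \<in> S \<and> (\<forall>c\<in>range (coeff ?p). rat_span_stable c S)"
    by (intro common_rat_span_stable[OF fin]) blast
  then obtain S where S: "finite S" "1 \<in> S" "\<And>i. rat_span_stable (coeff ?p i) S" by blast
  have lc: "lead_coeff ?p = 1" and z: "poly ?p z = 0" using p by simp_all
  obtain S' where "finite S'" "1 \<in> S'" "rat_span_stable z S'"
    using rat_span_stable_adjoin_root[OF S(1,2) lc z S(3)] by blast
  then show ?thesis by (rule algebraic_of_rat_span_stable)
qed

section \<open>Fourier-Motzkin elimination and matrix games\<close>

text \<open>
  One elimination step: the rows with positive slope bound \<open>t\<close> from below, those with negative slope
  from above, and \<open>t\<close> exists iff every lower bound is at most every upper bound. Multiplying out the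
  denominators keeps the condition polynomial in the coefficients.
\<close>

lemma ex_real_affine_ineqs_iff:
  fixes b c :: "'r \<Rightarrow> real"
  assumes "finite R"
  shows "(\<exists>t. \<forall>r\<in>R. 0 \<le> c r + b r * t) \<longleftrightarrow>
    (\<forall>r\<in>R. b r = 0 \<longrightarrow> 0 \<le> c r) \<and>
    (\<forall>r\<in>R. \<forall>q\<in>R. 0 < b r \<longrightarrow> b q < 0 \<longrightarrow> 0 \<le> b r * c q - b q * c r)"
    (is "?L \<longleftrightarrow> ?Z \<and> ?X")
proof
  assume ?L
  then obtain t where t: "\<And>r. r \<in> R \<Longrightarrow> 0 \<le> c r + b r * t" by blast
  have "0 \<le> b r * c q - b q * c r" if "r \<in> R" "q \<in> R" "0 < b r" "b q < 0" for r q
  proof -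
    have "0 \<le> b r * (c q + b q * t)" "0 \<le> (- b q) * (c r + b r * t)"
      using t[OF that(1)] t[OF that(2)] that(3,4) by (simp_all add: mult_nonpos_nonneg)
    then show ?thesis by (simp add: algebra_simps)
  qed
  then show "?Z \<and> ?X" using t by fastforce
next
  assume "?Z \<and> ?X"
  then have Z: "\<And>r. r \<in> R \<Longrightarrow> b r = 0 \<Longrightarrow> 0 \<le> c r"
    and X: "\<And>r q. r \<in> R \<Longrightarrow> q \<in> R \<Longrightarrow> 0 < b r \<Longrightarrow> b q < 0 \<Longrightarrow> 0 \<le> b r * c q - b q * c r"
    by blast+
  define lo where "lo = (\<lambda>r. - c r / b r) ` {r \<in> R. 0 < b r}"
  define up where "up = (\<lambda>r. - c r / b r) ` {r \<in> R. b r < 0}"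
  have fin: "finite lo" "finite up" using assms by (simp_all add: lo_def up_def)
  have lu: "l \<le> u" if "l \<in> lo" "u \<in> up" for l u
  proof -
    from that obtain r q where rq: "l = - c r / b r" "u = - c q / b q" "r \<in> R" "q \<in> R" "0 < b r" "b q < 0"
      by (auto simp: lo_def up_def)
    then have lu': "c r = - (l * b r)" "c q = - (u * b q)" by simp_all
    have "0 \<le> b r * c q - b q * c r" using X rq by blast
    also have "\<dots> = (b r * (- b q)) * (u - l)" unfolding lu' by (simp add: algebra_simps)
    finally have "0 \<le> (b r * (- b q)) * (u - l)" .
    moreover have "0 < b r * (- b q)" using rq(5,6) by (intro mult_pos_pos) auto
    ultimately have "0 \<le> u - l" by (meson zero_le_mult_iff not_less)
    then show ?thesis by simp
  qed
  obtain t where t: "\<And>l. l \<in> lo \<Longrightarrow> l \<le> t" "\<And>u. u \<in> up \<Longrightarrow> t \<le> u"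
  proof (cases "lo = {}")
    case False
    then show ?thesis using fin lu by (intro that[of "Max lo"]) auto
  next
    case True
    show ?thesis
    proof (cases "up = {}")
      case False
      then show ?thesis using fin True by (intro that[of "Min up"]) auto
    qed (use True that in auto)
  qed
  have "0 \<le> c r + b r * t" if r: "r \<in> R" for r
  proof -
    consider "b r = 0" | "0 < b r" | "b r < 0" by linarith
    then show ?thesis
    proof cases
      case 1 then show ?thesis using Z r by simp
    next
      case 2
      then have "- c r / b r \<le> t" using r by (intro t) (auto simp: lo_def)
      then show ?thesis using 2 by (simp add: field_simps)
    next
      case 3
      then have "t \<le> - c r / b r" using r by (intro t) (auto simp: up_def)
      then show ?thesis using 3 by (simp add: field_simps)
    qed
  qed
  then show ?L by blast
qed

text \<open>
  A row is an affine form in the variables; \<open>None\<close> indexes its constant term.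
\<close>

definition row_holds :: "'v set \<Rightarrow> ('v \<Rightarrow> real) \<Rightarrow> ('v option \<Rightarrow> real) \<Rightarrow> bool" where
  "row_holds V x r \<longleftrightarrow> 0 \<le> r None + (\<Sum>v\<in>V. r (Some v) * x v)"

definition feasible :: "'v set \<Rightarrow> ('v option \<Rightarrow> real) set \<Rightarrow> bool" where
  "feasible V R \<longleftrightarrow> (\<exists>x. \<forall>r\<in>R. row_holds V x r)"

definition combine_rows :: "'v \<Rightarrow> ('v option \<Rightarrow> real) \<Rightarrow> ('v option \<Rightarrow> real) \<Rightarrow> 'v option \<Rightarrow> real" where
  "combine_rows v r q = (\<lambda>k. r (Some v) * q k - q (Some v) * r k)"

definition eliminate :: "'v \<Rightarrow> ('v option \<Rightarrow> real) set \<Rightarrow> ('v option \<Rightarrow> real) set" where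
  "eliminate v R = {r \<in> R. r (Some v) = 0} \<union>
     (\<lambda>(r, q). combine_rows v r q) ` ({r \<in> R. 0 < r (Some v)} \<times> {q \<in> R. q (Some v) < 0})"

lemma finite_eliminate [simp]: "finite R \<Longrightarrow> finite (eliminate v R)"
  by (auto simp: eliminate_def)

lemma feasible_eliminate:
  assumes "finite V" "v \<notin> V" "finite R"
  shows "feasible (insert v V) R \<longleftrightarrow> feasible V (eliminate v R)"
proof -
  have comb: "row_holds V x (combine_rows v r q) \<longleftrightarrow>
      0 \<le> r (Some v) * (q None + (\<Sum>u\<in>V. q (Some u) * x u))
        - q (Some v) * (r None + (\<Sum>u\<in>V. r (Some u) * x u))" for x r q
    by (simp add: row_holds_def combine_rows_def sum_distrib_left algebra_simps sum_subtractf)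
  have key: "(\<exists>t. \<forall>r\<in>R. 0 \<le> (r None + (\<Sum>u\<in>V. r (Some u) * x u)) + r (Some v) * t) \<longleftrightarrow>
      (\<forall>r\<in>eliminate v R. row_holds V x r)" for x
    unfolding ex_real_affine_ineqs_iff[OF assms(3)]
    by (auto simp: eliminate_def comb ball_Un) (auto simp: row_holds_def)
  have ins: "row_holds (insert v V) x r \<longleftrightarrow>
      0 \<le> (r None + (\<Sum>u\<in>V. r (Some u) * x u)) + r (Some v) * x v" for x r
    using assms(1,2) by (simp add: row_holds_def algebra_simps)
  show ?thesis
  proof
    assume "feasible (insert v V) R"
    then obtain x where "\<forall>r\<in>R. row_holds (insert v V) x r" by (auto simp: feasible_def)
    then show "feasible V (eliminate v R)"
      unfolding feasible_def by (intro exI[of _ x], subst key[symmetric]) (auto simp: ins)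
  next
    assume "feasible V (eliminate v R)"
    then obtain x where "\<forall>r\<in>eliminate v R. row_holds V x r" by (auto simp: feasible_def)
    then obtain t where t: "\<forall>r\<in>R. 0 \<le> (r None + (\<Sum>u\<in>V. r (Some u) * x u)) + r (Some v) * t"
      unfolding key[symmetric] by blast
    have "(\<Sum>u\<in>V. r (Some u) * (x(v := t)) u) = (\<Sum>u\<in>V. r (Some u) * x u)" for r
      using assms(2) by (intro sum.cong) auto
    then show "feasible (insert v V) R"
      unfolding feasible_def using t by (intro exI[of _ "x(v := t)"]) (auto simp: ins)
  qed
qed

text \<open>
  The rows that follow from \<open>R\<close> by nonnegative combination, as in Farkas' lemma.
\<close>

inductive_set row_cone :: "('v option \<Rightarrow> real) set \<Rightarrow> ('v option \<Rightarrow> real) set" for R where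
  base: "r \<in> R \<Longrightarrow> r \<in> row_cone R"
| add: "r \<in> row_cone R \<Longrightarrow> q \<in> row_cone R \<Longrightarrow> (\<lambda>k. r k + q k) \<in> row_cone R"
| scale: "r \<in> row_cone R \<Longrightarrow> 0 \<le> a \<Longrightarrow> (\<lambda>k. a * r k) \<in> row_cone R"

lemma row_cone_eliminate: "r \<in> row_cone (eliminate v R) \<Longrightarrow> r \<in> row_cone R \<and> r (Some v) = 0"
proof (induction rule: row_cone.induct)
  case (base r)
  show ?case
  proof (cases "r \<in> R \<and> r (Some v) = 0")
    case False
    then obtain p q where pq: "p \<in> R" "q \<in> R" "0 < p (Some v)" "q (Some v) < 0" "r = combine_rows v p q"
      using base by (auto simp: eliminate_def)
    have "(\<lambda>k. (\<lambda>k. p (Some v) * q k) k + (\<lambda>k. (- q (Some v)) * p k) k) \<in> row_cone R"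
      using pq by (intro row_cone.intros) auto
    then show ?thesis using pq by (simp add: combine_rows_def algebra_simps)
  qed (auto intro: row_cone.base)
qed (auto intro: row_cone.intros)

text \<open>
  Farkas' lemma: elimination of all variables only forms nonnegative combinations, and without
  variables an infeasible system contains a negative constant.
\<close>

lemma infeasible_certificate:
  assumes "finite V" "finite R" "\<not> feasible V R"
  shows "\<exists>r\<in>row_cone R. r None < 0 \<and> (\<forall>v\<in>V. r (Some v) = 0)"
  using assms
proof (induction V arbitrary: R rule: finite_induct)
  case empty
  then show ?case by (auto simp: feasible_def row_holds_def not_le intro: row_cone.base)
next
  case (insert v V)
  have "\<not> feasible V (eliminate v R)"
    using feasible_eliminate[OF insert.hyps(1,2) insert.prems(1)] insert.prems(2) by simp
  moreover have "finite (eliminate v R)" using insert.prems by simp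
  ultimately obtain r where r: "r \<in> row_cone (eliminate v R)" "r None < 0" "\<forall>v\<in>V. r (Some v) = 0"
    using insert.IH by blast
  have "r \<in> row_cone R" "r (Some v) = 0" using row_cone_eliminate[OF r(1)] by auto
  then show ?case using r by blast
qed

lemma sgn_eq_cases:
  fixes a b :: real
  assumes "sgn a = sgn b"
  shows "(a = 0 \<longleftrightarrow> b = 0) \<and> (0 < a \<longleftrightarrow> 0 < b) \<and> (a < 0 \<longleftrightarrow> b < 0)"
  using assms by (auto simp: sgn_if split: if_splits)

text \<open>
  Quantifier elimination for linear programs whose coefficients are functions of a parameter \<open>t\<close>.
  The signs of the coefficients of the eliminated variable decide which rows are combined; for each of
  the finitely many choices the combined coefficients again lie in \<open>P\<close>, so the induction
  hypothesis supplies finitely many further functions. Their union over all choices works for every \<open>t\<close>.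
\<close>

lemma feasible_sign_determined:
  fixes P :: "('t \<Rightarrow> real) set" and R :: "('v option \<Rightarrow> 't \<Rightarrow> real) set"
  assumes closed: "\<And>f g h k. f \<in> P \<Longrightarrow> g \<in> P \<Longrightarrow> h \<in> P \<Longrightarrow> k \<in> P \<Longrightarrow> (\<lambda>t. f t * g t - h t * k t) \<in> P"
  assumes "finite V" "finite R" "\<And>r k. r \<in> R \<Longrightarrow> r k \<in> P"
  shows "\<exists>S. finite S \<and> S \<subseteq> P \<and> (\<forall>t t'. (\<forall>f\<in>S. sgn (f t) = sgn (f t')) \<longrightarrow>
     feasible V ((\<lambda>r k. r k t) ` R) = feasible V ((\<lambda>r k. r k t') ` R))"
  using assms(2-4)
proof (induction V arbitrary: R rule: finite_induct)
  case empty
  have "feasible {} ((\<lambda>r k. r k t) ` R) \<longleftrightarrow> (\<forall>r\<in>R. sgn (r None t) \<noteq> -1)" for t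
    by (auto simp: feasible_def row_holds_def sgn_if)
  then show ?case using empty
    by (intro exI[of _ "(\<lambda>r. r None) ` R"]) auto
next
  case (insert v V)
  define comb where "comb r q = (\<lambda>k t. r (Some v) t * q k t - q (Some v) t * r k t)"
    for r q :: "'v option \<Rightarrow> 't \<Rightarrow> real"
  define F where "F Z A B = Z \<union> (\<lambda>(r, q). comb r q) ` (A \<times> B)"
    for Z A B :: "('v option \<Rightarrow> 't \<Rightarrow> real) set"
  define inst where "inst t Q = (\<lambda>r k. r k t) ` Q" for t and Q :: "('v option \<Rightarrow> 't \<Rightarrow> real) set"
  define Z where "Z t = {r \<in> R. r (Some v) t = 0}" for t
  define A where "A t = {r \<in> R. 0 < r (Some v) t}" for t
  define B where "B t = {r \<in> R. r (Some v) t < 0}" for t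
  have elim: "eliminate v (inst t R) = inst t (F (Z t) (A t) (B t))" for t
    unfolding eliminate_def inst_def F_def Z_def A_def B_def comb_def combine_rows_def
    by (auto simp: image_iff)
  let ?T = "Pow R \<times> Pow R \<times> Pow R"
  have "\<exists>S. finite S \<and> S \<subseteq> P \<and> (\<forall>t t'. (\<forall>f\<in>S. sgn (f t) = sgn (f t')) \<longrightarrow>
     feasible V (inst t (F X Y W)) = feasible V (inst t' (F X Y W)))"
    if "X \<subseteq> R" "Y \<subseteq> R" "W \<subseteq> R" for X Y W
    unfolding inst_def
  proof (rule insert.IH)
    have "finite X" "finite Y" "finite W" using that insert.prems finite_subset by blast+
    then show "finite (F X Y W)" by (simp add: F_def)
    show "r k \<in> P" if "r \<in> F X Y W" for r k
      using that \<open>X \<subseteq> R\<close> \<open>Y \<subseteq> R\<close> \<open>W \<subseteq> R\<close> insert.prems(2) closed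
      by (auto simp: F_def comb_def subset_iff)
  qed
  then have "\<forall>x\<in>?T. \<exists>S. finite S \<and> S \<subseteq> P \<and> (\<forall>t t'. (\<forall>f\<in>S. sgn (f t) = sgn (f t')) \<longrightarrow>
     feasible V (inst t (F (fst x) (fst (snd x)) (snd (snd x)))) =
     feasible V (inst t' (F (fst x) (fst (snd x)) (snd (snd x)))))"
    by auto
  then obtain S where S: "\<And>x. x \<in> ?T \<Longrightarrow> finite (S x) \<and> S x \<subseteq> P \<and>
     (\<forall>t t'. (\<forall>f\<in>S x. sgn (f t) = sgn (f t')) \<longrightarrow>
     feasible V (inst t (F (fst x) (fst (snd x)) (snd (snd x)))) =
     feasible V (inst t' (F (fst x) (fst (snd x)) (snd (snd x)))))"
    by metis
  define S' where "S' = (\<lambda>r. r (Some v)) ` R \<union> (\<Union>x\<in>?T. S x)"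
  have finS: "finite S'" using insert.prems S by (auto simp: S'_def)
  have subS: "S' \<subseteq> P" unfolding S'_def
  proof (intro Un_least UN_least)
    show "(\<lambda>r. r (Some v)) ` R \<subseteq> P" using insert.prems(2) by blast
    show "S x \<subseteq> P" if "x \<in> ?T" for x using S[OF that] by (elim conjE)
  qed
  have "feasible (insert v V) (inst t R) = feasible (insert v V) (inst t' R)"
    if sg: "\<forall>f\<in>S'. sgn (f t) = sgn (f t')" for t t'
  proof -
    have "(r (Some v) t = 0 \<longleftrightarrow> r (Some v) t' = 0) \<and> (0 < r (Some v) t \<longleftrightarrow> 0 < r (Some v) t') \<and>
       (r (Some v) t < 0 \<longleftrightarrow> r (Some v) t' < 0)" if "r \<in> R" for r
    proof (rule sgn_eq_cases)
      have "r (Some v) \<in> S'" using that by (simp add: S'_def)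
      then show "sgn (r (Some v) t) = sgn (r (Some v) t')" using sg by blast
    qed
    then have eq: "Z t' = Z t" "A t' = A t" "B t' = B t" by (auto simp: Z_def A_def B_def)
    have T: "(Z t, A t, B t) \<in> ?T" by (auto simp: Z_def A_def B_def)
    have "\<forall>f\<in>S (Z t, A t, B t). sgn (f t) = sgn (f t')"
      using sg T unfolding S'_def by blast
    then have "feasible V (inst t (F (Z t) (A t) (B t))) = feasible V (inst t' (F (Z t) (A t) (B t)))"
      using S[OF T] by simp
    moreover have "finite (inst t R)" "finite (inst t' R)" using insert.prems by (simp_all add: inst_def)
    ultimately show ?thesis
      using insert.hyps by (simp add: feasible_eliminate elim eq)
  qed
  then show ?case unfolding inst_def using finS subS by blast
qed

definition mixed :: "'i set \<Rightarrow> ('i \<Rightarrow> real) \<Rightarrow> bool" where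
  "mixed I x \<longleftrightarrow> (\<forall>i\<in>I. 0 \<le> x i) \<and> sum x I = 1"

lemma mixed_scale:
  assumes "\<And>i. i \<in> I \<Longrightarrow> 0 \<le> x i" "sum x I > 0"
  shows "mixed I (\<lambda>i. x i / sum x I)"
  using assms by (auto simp: mixed_def simp flip: sum_divide_distrib)

text \<open>
  The linear program for a strategy of the row player that secures at least \<open>0\<close> in the matrix game
  \<open>C\<close>. It asks for total weight at least \<open>1\<close> rather than equal to \<open>1\<close>, which is enough because the
  conditions on the payoffs are homogeneous.
\<close>

definition guarantee_rows :: "'i set \<Rightarrow> 'j set \<Rightarrow> ('i \<Rightarrow> 'j \<Rightarrow> real) \<Rightarrow> ('i option \<Rightarrow> real) set" where
  "guarantee_rows I J C =
     insert (\<lambda>k. if k = None then -1 else 1)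
       ((\<lambda>i k. if k = Some i then 1 else 0) ` I \<union>
        (\<lambda>j k. case k of None \<Rightarrow> 0 | Some i \<Rightarrow> C i j) ` J)"

lemma sum_indicator_weight:
  fixes x :: "'i \<Rightarrow> real"
  shows "finite I \<Longrightarrow> i \<in> I \<Longrightarrow> (\<Sum>v\<in>I. (if v = i then 1 else 0) * x v) = x i"
  by (subst sum.remove[of _ i]) (auto intro!: sum.neutral)

lemma sum_indicator_weight':
  fixes x :: "'i \<Rightarrow> real"
  shows "finite I \<Longrightarrow> i \<in> I \<Longrightarrow> (\<Sum>v\<in>I. x v * (if v = i then 1 else 0)) = x i"
  using sum_indicator_weight[of I i x] by (simp only: mult.commute)

lemma feasible_guarantee_rows:
  assumes "finite I"
  shows "feasible I (guarantee_rows I J C) \<longleftrightarrow>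
    (\<exists>x. mixed I x \<and> (\<forall>j\<in>J. 0 \<le> (\<Sum>i\<in>I. x i * C i j)))"
proof
  assume "feasible I (guarantee_rows I J C)"
  then obtain x where x: "row_holds I x r" if "r \<in> guarantee_rows I J C" for r
    unfolding feasible_def by blast
  have nn: "0 \<le> x i" if "i \<in> I" for i
    using x[of "\<lambda>k. if k = Some i then 1 else 0"] that assms
    by (simp add: guarantee_rows_def row_holds_def sum_indicator_weight)
  have s: "1 \<le> sum x I"
    using x[of "\<lambda>k. if k = None then -1 else 1"] by (simp add: guarantee_rows_def row_holds_def)
  have c: "0 \<le> (\<Sum>i\<in>I. x i * C i j)" if "j \<in> J" for j
    using x[of "\<lambda>k. case k of None \<Rightarrow> 0 | Some i \<Rightarrow> C i j"] that
    by (simp add: guarantee_rows_def row_holds_def mult.commute)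
  have "(\<Sum>i\<in>I. x i / sum x I * C i j) = (\<Sum>i\<in>I. x i * C i j) / sum x I" for j
    by (simp add: sum_divide_distrib)
  then show "\<exists>x. mixed I x \<and> (\<forall>j\<in>J. 0 \<le> (\<Sum>i\<in>I. x i * C i j))"
    using mixed_scale[of I x] nn s c by (intro exI[of _ "\<lambda>i. x i / sum x I"]) auto
next
  assume "\<exists>x. mixed I x \<and> (\<forall>j\<in>J. 0 \<le> (\<Sum>i\<in>I. x i * C i j))"
  then obtain x where x: "mixed I x" "\<forall>j\<in>J. 0 \<le> (\<Sum>i\<in>I. x i * C i j)" by blast
  show "feasible I (guarantee_rows I J C)"
    unfolding feasible_def
  proof (intro exI[of _ x] ballI)
    fix r assume "r \<in> guarantee_rows I J C"
    then consider "r = (\<lambda>k. if k = None then -1 else 1)"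
      | i where "i \<in> I" "r = (\<lambda>k. if k = Some i then 1 else 0)"
      | j where "j \<in> J" "r = (\<lambda>k. case k of None \<Rightarrow> 0 | Some i \<Rightarrow> C i j)"
      by (auto simp: guarantee_rows_def)
    then show "row_holds I x r"
      using x assms
      by cases (auto simp: row_holds_def mixed_def sum_indicator_weight mult.commute[of "C _ _"])
  qed
qed

text \<open>
  The multipliers of the payoff rows in an infeasibility certificate are, up to scaling, a mixed strategy
  of the column player; the multiplier of the weight row makes the payoffs strictly negative.
\<close>

lemma ville_alternative:
  assumes I: "finite I" "I \<noteq> {}" and J: "finite J"
  assumes no: "\<not> (\<exists>x. mixed I x \<and> (\<forall>j\<in>J. 0 \<le> (\<Sum>i\<in>I. x i * C i j)))"
  shows "\<exists>y. mixed J y \<and> (\<forall>i\<in>I. (\<Sum>j\<in>J. C i j * y j) < 0)"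
proof -
  have fin: "finite (guarantee_rows I J C)" using I J by (simp add: guarantee_rows_def)
  obtain r where r: "r \<in> row_cone (guarantee_rows I J C)" "r None < 0" "\<forall>i\<in>I. r (Some i) = 0"
    using infeasible_certificate[OF I(1) fin] no feasible_guarantee_rows[OF I(1)] by blast
  have "\<exists>p q y. (\<forall>i. 0 \<le> p i) \<and> 0 \<le> q \<and> (\<forall>j. 0 \<le> y j) \<and> r None = - q \<and>
      (\<forall>i\<in>I. r (Some i) = p i + q + (\<Sum>j\<in>J. C i j * y j))"
    using r(1)
  proof (induction rule: row_cone.induct)
    case (base r)
    then consider "r = (\<lambda>k. if k = None then -1 else 1)"
      | i where "i \<in> I" "r = (\<lambda>k. if k = Some i then 1 else 0)"
      | j where "j \<in> J" "r = (\<lambda>k. case k of None \<Rightarrow> 0 | Some i \<Rightarrow> C i j)"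
      by (auto simp: guarantee_rows_def)
    then show ?case
    proof cases
      case 1 then show ?thesis
        by (intro exI[of _ "\<lambda>_. 0"] exI[of _ 1]) auto
    next
      case (2 i) then show ?thesis
        by (intro exI[of _ "\<lambda>i'. if i' = i then 1 else 0"] exI[of _ 0] exI[of _ "\<lambda>_. 0"]) auto
    next
      case (3 j) then show ?thesis using J
        by (intro exI[of _ "\<lambda>_. 0"] exI[of _ 0] exI[of _ "\<lambda>j'. if j' = j then 1 else 0"])
          (auto simp: sum_indicator_weight')
    qed
  next
    case (add r r')
    obtain p q y where a: "\<forall>i. 0 \<le> p i" "0 \<le> q" "\<forall>j. 0 \<le> y j" "r None = - q"
      "\<forall>i\<in>I. r (Some i) = p i + q + (\<Sum>j\<in>J. C i j * y j)" using add by blast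
    obtain p' q' y' where b: "\<forall>i. 0 \<le> p' i" "0 \<le> q'" "\<forall>j. 0 \<le> y' j" "r' None = - q'"
      "\<forall>i\<in>I. r' (Some i) = p' i + q' + (\<Sum>j\<in>J. C i j * y' j)" using add by blast
    show ?case using a b
      by (intro exI[of _ "\<lambda>i. p i + p' i"] exI[of _ "q + q'"] exI[of _ "\<lambda>j. y j + y' j"])
        (auto simp: algebra_simps sum.distrib)
  next
    case (scale r a)
    obtain p q y where "\<forall>i. 0 \<le> p i" "0 \<le> q" "\<forall>j. 0 \<le> y j" "r None = - q"
      "\<forall>i\<in>I. r (Some i) = p i + q + (\<Sum>j\<in>J. C i j * y j)" using scale by blast
    then show ?case using scale(2)
      by (intro exI[of _ "\<lambda>i. a * p i"] exI[of _ "a * q"] exI[of _ "\<lambda>j. a * y j"])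
        (auto simp: algebra_simps sum_distrib_left)
  qed
  then obtain p q y where y: "\<forall>i. 0 \<le> p i" "0 \<le> q" "\<forall>j. 0 \<le> y j" "r None = - q"
      "\<forall>i\<in>I. r (Some i) = p i + q + (\<Sum>j\<in>J. C i j * y j)" by blast
  have neg: "(\<Sum>j\<in>J. C i j * y j) < 0" if "i \<in> I" for i
  proof -
    have "r (Some i) = 0" using r(3) that by blast
    then have "p i + q + (\<Sum>j\<in>J. C i j * y j) = 0" using y(5) that by simp
    moreover have "0 \<le> p i" "0 < q" using y r(2) by auto
    ultimately show ?thesis by linarith
  qed
  obtain i where i: "i \<in> I" using I by blast
  have "sum y J \<noteq> 0"
  proof
    assume "sum y J = 0"
    then have "\<forall>j\<in>J. y j = 0" using y J by (simp add: sum_nonneg_eq_0_iff)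
    then show False using neg[OF i] by simp
  qed
  then have pos: "sum y J > 0" using y by (simp add: order.not_eq_order_implies_strict sum_nonneg)
  have "(\<Sum>j\<in>J. C i j * (y j / sum y J)) < 0" if "i \<in> I" for i
  proof -
    have "(\<Sum>j\<in>J. C i j * (y j / sum y J)) = (\<Sum>j\<in>J. C i j * y j) / sum y J"
      by (simp add: sum_divide_distrib)
    then show ?thesis using neg[OF that] pos by (simp add: divide_neg_pos)
  qed
  moreover have "mixed J (\<lambda>j. y j / sum y J)"
    using y(3) pos by (intro mixed_scale) auto
  ultimately show ?thesis by blast
qed

lemma mixed_sum_const: "mixed I x \<Longrightarrow> (\<Sum>i\<in>I. x i * c) = (c::real)"
  by (simp add: mixed_def flip: sum_distrib_right)

lemma mixed_sum_mono:
  assumes "mixed I x" "\<And>i. i \<in> I \<Longrightarrow> f i \<le> (g i :: real)"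
  shows "(\<Sum>i\<in>I. x i * f i) \<le> (\<Sum>i\<in>I. x i * g i)"
  using assms by (intro sum_mono mult_left_mono) (auto simp: mixed_def)

lemma mixed_sum_abs_le:
  assumes "mixed I x" "\<And>i. i \<in> I \<Longrightarrow> \<bar>f i\<bar> \<le> (c :: real)"
  shows "\<bar>\<Sum>i\<in>I. x i * f i\<bar> \<le> c"
proof -
  have "(\<Sum>i\<in>I. x i * f i) \<le> (\<Sum>i\<in>I. x i * c)"
    using assms(2) by (intro mixed_sum_mono[OF assms(1)]) (auto simp: abs_le_iff)
  moreover have "(\<Sum>i\<in>I. x i * (- c)) \<le> (\<Sum>i\<in>I. x i * f i)"
    using assms(2) by (intro mixed_sum_mono[OF assms(1)]) (auto simp: abs_le_iff minus_le_iff)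
  ultimately show ?thesis
    unfolding mixed_sum_const[OF assms(1)] by (simp add: abs_le_iff)
qed

lemma mixed_sum_pos:
  assumes "mixed I x" "\<And>i. i \<in> I \<Longrightarrow> 0 < (f i :: real)" "finite I"
  shows "0 < (\<Sum>i\<in>I. x i * f i)"
proof -
  have nn: "\<forall>i\<in>I. 0 \<le> x i * f i" using assms by (auto simp: mixed_def less_imp_le)
  have "(\<Sum>i\<in>I. x i * f i) \<noteq> 0"
  proof
    assume "(\<Sum>i\<in>I. x i * f i) = 0"
    then have "\<forall>i\<in>I. x i * f i = 0" using nn assms(3) by (simp add: sum_nonneg_eq_0_iff)
    then have "\<forall>i\<in>I. x i = 0" using assms(2) by fastforce
    then show False using assms(1) by (simp add: mixed_def)
  qed
  then show ?thesis using nn by (simp add: order.not_eq_order_implies_strict sum_nonneg)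
qed

text \<open>
  The supremum of the securable levels is attained: otherwise Ville's alternative yields a strategy of
  the column player that keeps all payoffs strictly below the supremum, hence uniformly so, as there
  are finitely many rows. The same alternative for the transposed game gives the column player's strategy.
\<close>

theorem matrix_game_value:
  fixes C :: "'i \<Rightarrow> 'j \<Rightarrow> real"
  assumes I: "finite I" "I \<noteq> {}" and J: "finite J" "J \<noteq> {}"
  shows "\<exists>w x y. mixed I x \<and> mixed J y \<and>
    (\<forall>j\<in>J. w \<le> (\<Sum>i\<in>I. x i * C i j)) \<and> (\<forall>i\<in>I. (\<Sum>j\<in>J. C i j * y j) \<le> w)"
proof -
  define W where "W = {w. \<exists>x. mixed I x \<and> (\<forall>j\<in>J. w \<le> (\<Sum>i\<in>I. x i * C i j))}"
  have shift1: "(\<Sum>i\<in>I. x i * (C i j - w)) = (\<Sum>i\<in>I. x i * C i j) - w" if "mixed I x" for x j w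
    using mixed_sum_const[OF that, of w] by (simp add: algebra_simps sum_subtractf)
  have shift2: "(\<Sum>j\<in>J. (C i j - w) * y j) = (\<Sum>j\<in>J. C i j * y j) - w" if "mixed J y" for y i w
    using mixed_sum_const[OF that, of w] by (simp add: algebra_simps sum_subtractf)
  obtain j0 where j0: "j0 \<in> J" using J by blast
  obtain i0 where i0: "i0 \<in> I" using I by blast
  have bdd: "bdd_above W"
  proof (rule bdd_aboveI)
    fix w assume "w \<in> W"
    then obtain x where "mixed I x" "w \<le> (\<Sum>i\<in>I. x i * C i j0)" using j0 by (auto simp: W_def)
    moreover have "(\<Sum>i\<in>I. x i * C i j0) \<le> (\<Sum>i\<in>I. x i * Max ((\<lambda>i. C i j0) ` I))"
      using \<open>mixed I x\<close> I by (intro mixed_sum_mono) auto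
    ultimately show "w \<le> Max ((\<lambda>i. C i j0) ` I)" using mixed_sum_const by fastforce
  qed
  have "mixed I (\<lambda>i. if i = i0 then 1 else 0)" using I i0 by (auto simp: mixed_def)
  then have ne: "Min (C i0 ` J) \<in> W" unfolding W_def using I i0 J
    by (intro CollectI exI[of _ "\<lambda>i. if i = i0 then 1 else 0"]) (auto simp: sum_indicator_weight)
  let ?w = "Sup W"
  have "\<exists>x. mixed I x \<and> (\<forall>j\<in>J. ?w \<le> (\<Sum>i\<in>I. x i * C i j))"
  proof (rule ccontr)
    assume no: "\<not> ?thesis"
    have "\<not> (\<exists>x. mixed I x \<and> (\<forall>j\<in>J. 0 \<le> (\<Sum>i\<in>I. x i * (C i j - ?w))))"
      using no by (auto simp: shift1)
    then obtain y where y: "mixed J y" "\<And>i. i \<in> I \<Longrightarrow> (\<Sum>j\<in>J. C i j * y j) < ?w"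
      using ville_alternative[OF I J(1), of "\<lambda>i j. C i j - ?w"] shift2 by force
    let ?m = "Max ((\<lambda>i. \<Sum>j\<in>J. C i j * y j) ` I)"
    have lt: "?m < ?w" using I y by simp
    have le: "w \<le> ?m" if "w \<in> W" for w
    proof -
      obtain x where x: "mixed I x" "\<forall>j\<in>J. w \<le> (\<Sum>i\<in>I. x i * C i j)" using \<open>w \<in> W\<close> by (auto simp: W_def)
      have "w = (\<Sum>j\<in>J. y j * w)" using mixed_sum_const[OF y(1)] by simp
      also have "\<dots> \<le> (\<Sum>j\<in>J. y j * (\<Sum>i\<in>I. x i * C i j))" using x y by (intro mixed_sum_mono) auto
      also have "\<dots> = (\<Sum>i\<in>I. x i * (\<Sum>j\<in>J. C i j * y j))"
        by (simp add: sum_distrib_left mult_ac) (rule sum.swap)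
      also have "\<dots> \<le> (\<Sum>i\<in>I. x i * ?m)" using x I by (intro mixed_sum_mono) auto
      also have "\<dots> = ?m" using mixed_sum_const[OF x(1)] .
      finally show ?thesis .
    qed
    have "W \<noteq> {}" using ne by auto
    then have "?w \<le> ?m" using le by (rule cSup_least)
    then show False using lt by linarith
  qed
  then obtain x where x: "mixed I x" "\<forall>j\<in>J. ?w \<le> (\<Sum>i\<in>I. x i * C i j)" by blast
  have "\<exists>y. mixed J y \<and> (\<forall>i\<in>I. (\<Sum>j\<in>J. C i j * y j) \<le> ?w)"
  proof (rule ccontr)
    assume no: "\<not> ?thesis"
    have "\<not> (\<exists>y. mixed J y \<and> (\<forall>i\<in>I. 0 \<le> (\<Sum>j\<in>J. y j * (?w - C i j))))"
    proof
      assume "\<exists>y. mixed J y \<and> (\<forall>i\<in>I. 0 \<le> (\<Sum>j\<in>J. y j * (?w - C i j)))"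
      then obtain y where y: "mixed J y" "\<forall>i\<in>I. 0 \<le> (\<Sum>j\<in>J. y j * (?w - C i j))" by blast
      have "(\<Sum>j\<in>J. y j * (?w - C i j)) = ?w - (\<Sum>j\<in>J. C i j * y j)" for i
        using mixed_sum_const[OF y(1), of ?w] by (simp add: algebra_simps sum_subtractf)
      then show False using no y by auto
    qed
    then obtain z where z: "mixed I z" "\<And>j. j \<in> J \<Longrightarrow> (\<Sum>i\<in>I. (?w - C i j) * z i) < 0"
      using ville_alternative[OF J I(1), of "\<lambda>j i. ?w - C i j"] by auto
    have "(\<Sum>i\<in>I. (?w - C i j) * z i) = ?w - (\<Sum>i\<in>I. z i * C i j)" for j
      using mixed_sum_const[OF z(1), of ?w] by (simp add: algebra_simps sum_subtractf)
    then have gt: "?w < (\<Sum>i\<in>I. z i * C i j)" if "j \<in> J" for j using z that by fastforce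
    let ?m = "Min ((\<lambda>j. \<Sum>i\<in>I. z i * C i j) ` J)"
    have "?m \<in> W" unfolding W_def using z J by auto
    then have "?m \<le> ?w" using bdd by (rule cSup_upper)
    moreover have "?w < ?m" using J gt by simp
    ultimately show False by simp
  qed
  then show ?thesis using x by blast
qed

section \<open>Functions whose graph lies on an algebraic curve\<close>

text \<open>
  The outer variable of the bivariate polynomial is the discount weight \<open>l\<close>, the coefficients are
  polynomials in \<open>w\<close>. So the coefficients remain polynomials in the value when powers of \<open>l\<close> are split off.
\<close>

definition bieval :: "real poly poly \<Rightarrow> real \<Rightarrow> real \<Rightarrow> real" where
  "bieval p l w = poly (poly p [:l:]) w"

definition algebraic_coeffs :: "real poly poly \<Rightarrow> bool" where
  "algebraic_coeffs p \<longleftrightarrow> (\<forall>i j. algebraic (coeff (coeff p i) j))"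

lemma algebraic_sum_real:
  fixes f :: "'a \<Rightarrow> real"
  shows "(\<And>x. x \<in> A \<Longrightarrow> algebraic (f x)) \<Longrightarrow> algebraic (sum f A)"
  by (induction A rule: infinite_finite_induct) (auto intro: algebraic_add_real)

lemma algebraic_coeffs_add: "algebraic_coeffs p \<Longrightarrow> algebraic_coeffs q \<Longrightarrow> algebraic_coeffs (p + q)"
  by (simp add: algebraic_coeffs_def algebraic_add_real)

lemma algebraic_coeffs_mult: "algebraic_coeffs p \<Longrightarrow> algebraic_coeffs q \<Longrightarrow> algebraic_coeffs (p * q)"
  by (simp add: algebraic_coeffs_def coeff_mult coeff_sum algebraic_sum_real algebraic_mult_real)

lemma algebraic_coeffs_const: "algebraic c \<Longrightarrow> algebraic_coeffs [:[:c:]:]"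
  by (auto simp: algebraic_coeffs_def coeff_pCons split: nat.splits)

lemma algebraic_coeffs_prod:
  "(\<And>x. x \<in> A \<Longrightarrow> algebraic_coeffs (f x)) \<Longrightarrow> algebraic_coeffs (prod f A)"
proof (induction A rule: infinite_finite_induct)
  case (insert x A)
  then show ?case by (simp add: algebraic_coeffs_mult)
qed (use algebraic_coeffs_const[of 1] in \<open>simp_all flip: one_pCons\<close>)

definition alg_functions :: "(real \<times> real \<Rightarrow> real) set" where
  "alg_functions = {\<lambda>t. bieval p (fst t) (snd t) | p. algebraic_coeffs p}"

lemma alg_functions_const: "algebraic c \<Longrightarrow> (\<lambda>t. c) \<in> alg_functions"
  unfolding alg_functions_def
  by (intro CollectI exI[of _ "[:[:c:]:]"]) (auto simp: bieval_def algebraic_coeffs_const)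

lemma alg_functions_fst: "(\<lambda>t. fst t) \<in> alg_functions"
  unfolding alg_functions_def
  by (intro CollectI exI[of _ "[:0, 1:]"])
    (auto simp: bieval_def algebraic_coeffs_def coeff_pCons split: nat.splits)

lemma alg_functions_snd: "(\<lambda>t. snd t) \<in> alg_functions"
  unfolding alg_functions_def
  by (intro CollectI exI[of _ "[:[:0, 1:]:]"])
    (auto simp: bieval_def algebraic_coeffs_def coeff_pCons split: nat.splits)

lemma alg_functions_add:
  assumes "f \<in> alg_functions" "g \<in> alg_functions"
  shows "(\<lambda>t. f t + g t) \<in> alg_functions"
proof -
  obtain p q where "algebraic_coeffs p" "f = (\<lambda>t. bieval p (fst t) (snd t))"
    "algebraic_coeffs q" "g = (\<lambda>t. bieval q (fst t) (snd t))"
    using assms by (auto simp: alg_functions_def)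
  then show ?thesis unfolding alg_functions_def
    by (intro CollectI exI[of _ "p + q"]) (auto simp: bieval_def algebraic_coeffs_add)
qed

lemma alg_functions_mult:
  assumes "f \<in> alg_functions" "g \<in> alg_functions"
  shows "(\<lambda>t. f t * g t) \<in> alg_functions"
proof -
  obtain p q where "algebraic_coeffs p" "f = (\<lambda>t. bieval p (fst t) (snd t))"
    "algebraic_coeffs q" "g = (\<lambda>t. bieval q (fst t) (snd t))"
    using assms by (auto simp: alg_functions_def)
  then show ?thesis unfolding alg_functions_def
    by (intro CollectI exI[of _ "p * q"]) (auto simp: bieval_def algebraic_coeffs_mult)
qed

lemma alg_functions_diff:
  assumes "f \<in> alg_functions" "g \<in> alg_functions"
  shows "(\<lambda>t. f t - g t) \<in> alg_functions"
  using alg_functions_add[OF assms(1) alg_functions_mult[OF alg_functions_const[of "-1"] assms(2)]]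
  by simp

lemma alg_functions_sum:
  "(\<And>x. x \<in> A \<Longrightarrow> f x \<in> alg_functions) \<Longrightarrow> (\<lambda>t. \<Sum>x\<in>A. f x t) \<in> alg_functions"
  by (induction A rule: infinite_finite_induct) (auto intro: alg_functions_add alg_functions_const)

lemma alg_functions_prod:
  "(\<And>x. x \<in> A \<Longrightarrow> f x \<in> alg_functions) \<Longrightarrow> (\<lambda>t. \<Prod>x\<in>A. f x t) \<in> alg_functions"
  by (induction A rule: infinite_finite_induct) (auto intro: alg_functions_mult alg_functions_const)

text \<open>
  The polynomials of \<open>S\<close> that are nonzero at \<open>(l, v l)\<close> keep their signs for \<open>w\<close> slightly above \<open>v l\<close>,
  and the zero polynomial does so trivially. If this covered all of \<open>S\<close>, the truth value of \<open>F\<close> could not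
  change at \<open>v l\<close>. Hence the product of the members of \<open>S\<close> that come from nonzero polynomials vanishes on the graph of \<open>v\<close>.
\<close>

lemma boundary_on_algebraic_curve:
  fixes v :: "real \<Rightarrow> real"
  assumes S: "finite S" "S \<subseteq> alg_functions"
    and det: "\<And>t t'. (\<forall>f\<in>S. sgn (f t) = sgn (f t')) \<Longrightarrow> F t = F t'"
    and F: "\<And>l w. l \<in> X \<Longrightarrow> F (l, w) \<longleftrightarrow> w \<le> v l"
  shows "\<exists>p. algebraic_coeffs p \<and> p \<noteq> 0 \<and> (\<forall>l\<in>X. bieval p l (v l) = 0)"
proof -
  have "\<forall>f\<in>S. \<exists>p. algebraic_coeffs p \<and> f = (\<lambda>t. bieval p (fst t) (snd t))"
    using S(2) by (auto simp: alg_functions_def)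
  then obtain rep where rep: "\<And>f. f \<in> S \<Longrightarrow> algebraic_coeffs (rep f)"
    "\<And>f. f \<in> S \<Longrightarrow> f = (\<lambda>t. bieval (rep f) (fst t) (snd t))"
    by metis
  let ?S = "{f \<in> S. rep f \<noteq> 0}"
  let ?p = "\<Prod>f\<in>?S. rep f"
  have "bieval ?p l (v l) = 0" if l: "l \<in> X" for l
  proof (rule ccontr)
    assume "bieval ?p l (v l) \<noteq> 0"
    moreover have "bieval ?p l (v l) = (\<Prod>f\<in>?S. bieval (rep f) l (v l))"
      by (simp add: bieval_def poly_prod)
    ultimately have nz: "bieval (rep f) l (v l) \<noteq> 0" if "f \<in> ?S" for f
      using that S(1) by auto
    have "\<forall>\<^sub>F w in at_right (v l). sgn (f (l, v l)) = sgn (f (l, w))" if f: "f \<in> S" for f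
    proof (cases "rep f = 0")
      case True
      then have "f t = 0" for t using rep(2)[OF f] by (metis bieval_def poly_0)
      then show ?thesis by simp
    next
      case False
      have lim: "((\<lambda>w. bieval (rep f) l w) \<longlongrightarrow> bieval (rep f) l (v l)) (at_right (v l))"
        unfolding bieval_def by (intro tendsto_intros)
      have f': "f (l, w) = bieval (rep f) l w" for w using rep(2)[OF f] by (metis fst_conv snd_conv)
      have "bieval (rep f) l (v l) \<noteq> 0" using nz f False by simp
      then consider "bieval (rep f) l (v l) > 0" | "bieval (rep f) l (v l) < 0" by linarith
      then show ?thesis
      proof cases
        case 1
        from order_tendstoD(1)[OF lim 1] show ?thesis
          by eventually_elim (use 1 in \<open>simp add: f'\<close>)
      next
        case 2
        from order_tendstoD(2)[OF lim 2] show ?thesis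
          by eventually_elim (use 2 in \<open>simp add: f'\<close>)
      qed
    qed
    then have "\<forall>\<^sub>F w in at_right (v l). \<forall>f\<in>S. sgn (f (l, v l)) = sgn (f (l, w))"
      using S(1) by (simp add: eventually_ball_finite)
    moreover have "\<forall>\<^sub>F w in at_right (v l). v l < w" by (simp add: eventually_at_right_less)
    ultimately have "\<forall>\<^sub>F w in at_right (v l). False"
    proof eventually_elim
      case (elim w)
      have "F (l, v l) = F (l, w)" by (rule det) (use elim in blast)
      then show ?case using F[OF l] elim by simp
    qed
    then show False by simp
  qed
  moreover have "algebraic_coeffs ?p" by (intro algebraic_coeffs_prod rep) auto
  moreover have "?p \<noteq> 0" using S(1) by simp
  ultimately show ?thesis by blast
qed

lemma bieval_sum: "bieval p l w = (\<Sum>i\<le>degree p. poly (coeff p i) w * l ^ i)"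
  by (simp add: bieval_def poly_altdef[of p] poly_sum)

text \<open>
  Outside the roots of the leading coefficient, fixing \<open>w = c\<close> leaves a polynomial in \<open>l\<close> of full
  degree, so it has at most that many roots.
\<close>

lemma level_sets_bounded:
  fixes v :: "real \<Rightarrow> real"
  assumes p: "p \<noteq> 0" "\<And>l. l \<in> X \<Longrightarrow> bieval p l (v l) = 0"
  shows "\<exists>E. finite E \<and> (\<forall>c. c \<notin> E \<longrightarrow> finite {l \<in> X. v l = c} \<and> card {l \<in> X. v l = c} \<le> degree p)"
proof (intro exI conjI allI impI)
  let ?E = "{c. poly (lead_coeff p) c = 0}"
  show "finite ?E" using p by (simp add: poly_roots_finite)
  fix c assume c: "c \<notin> ?E"
  define q where "q = map_poly (\<lambda>q. poly q c) p"
  have cq: "coeff q i = poly (coeff p i) c" for i by (simp add: q_def coeff_map_poly)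
  have dq: "degree q \<le> degree p" by (rule degree_le) (simp add: cq coeff_eq_0)
  have q0: "q \<noteq> 0" using c cq[of "degree p"] by auto
  have "degree q = degree p"
    using dq c cq[of "degree p"] le_degree[of q "degree p"] by simp
  then have ev: "poly q l = bieval p l c" for l by (simp add: bieval_sum poly_altdef cq)
  have sub: "{l \<in> X. v l = c} \<subseteq> {l. poly q l = 0}" using p ev by auto
  have fin: "finite {l. poly q l = 0}" using q0 by (rule poly_roots_finite)
  show "finite {l \<in> X. v l = c}" using sub fin by (rule finite_subset)
  have "card {l \<in> X. v l = c} \<le> card {l. poly q l = 0}" using fin sub by (rule card_mono)
  also have "\<dots> \<le> degree q" using q0 by (rule card_poly_roots_bound)
  finally show "card {l \<in> X. v l = c} \<le> degree p" using dq by simp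
qed

text \<open>
  A function without limit would cross infinitely often every level strictly between its lower and upper
  limit, but all levels outside a finite set are attained only finitely often.
\<close>

lemma algebraic_curve_limit_exists:
  fixes v :: "real \<Rightarrow> real"
  assumes cont: "continuous_on {0<..<1} v" and bd: "\<And>l. l \<in> {0<..<1} \<Longrightarrow> \<bar>v l\<bar> \<le> C"
    and p: "p \<noteq> 0" "\<And>l. l \<in> {0<..<1} \<Longrightarrow> bieval p l (v l) = 0"
  shows "\<exists>L. (v \<longlongrightarrow> L) (at_right 0)"
proof -
  have "\<exists>E. finite E \<and> (\<forall>c. c \<notin> E \<longrightarrow>
    finite {l \<in> {0<..<1}. v l = c} \<and> card {l \<in> {0<..<1}. v l = c} \<le> degree p)"
    by (rule level_sets_bounded) (rule p, rule p(2))
  then obtain E where E: "finite E"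
    "\<forall>c. c \<notin> E \<longrightarrow> finite {l \<in> {0<..<1}. v l = c} \<and> card {l \<in> {0<..<1}. v l = c} \<le> degree p"
    by (elim exE conjE) (rule that)
  define A where "A = {c. \<forall>\<^sub>F l in at_right 0. c \<le> v l}"
  have ev01: "\<forall>\<^sub>F l in at_right (0::real). l \<in> {0<..<1}"
    by (rule eventually_at_right_real) simp
  have "- C \<in> A" unfolding A_def mem_Collect_eq
    using ev01
  proof eventually_elim
    case (elim l) then show ?case using bd[of l] by auto
  qed
  have A_le: "c \<le> C" if "c \<in> A" for c
  proof -
    have "\<forall>\<^sub>F l in at_right (0::real). c \<le> C"
      using ev01 that[unfolded A_def mem_Collect_eq]
    proof eventually_elim
      case (elim l) then show ?case using bd[of l] by auto
    qed
    then show ?thesis by simp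
  qed
  have bdd: "bdd_above A" using A_le by (auto simp: bdd_above_def)
  have side: "(\<forall>\<^sub>F l in at_right 0. c < v l) \<or> (\<forall>\<^sub>F l in at_right 0. v l < c)" if "c \<notin> E" for c
  proof -
    define Z where "Z = insert 1 {l \<in> {0<..<1}. v l = c}"
    define d where "d = Min Z"
    have fin: "finite Z" using E that by (simp add: Z_def)
    have d: "0 < d" "d \<le> 1" using fin by (auto simp: d_def Z_def)
    have ne: "v l \<noteq> c" if "l \<in> {0<..<d}" for l
    proof
      assume "v l = c"
      then have "l \<in> Z" using that d by (auto simp: Z_def)
      then have "d \<le> l" unfolding d_def using fin by (intro Min_le)
      then show False using that by simp
    qed
    have c': "continuous_on {0<..<d} v" using cont d by (rule_tac continuous_on_subset) auto
    have conn: "connected (v ` {0<..<d})" using c' by (intro connected_continuous_image) auto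
    have ev: "\<forall>\<^sub>F l in at_right 0. l \<in> {0<..<d}" using d by (intro eventually_at_right_real)
    show ?thesis
    proof (cases "\<exists>l\<in>{0<..<d}. c < v l")
      case True
      then obtain a where a: "a \<in> {0<..<d}" "c < v a" by blast
      have pos: "c < v l" if "l \<in> {0<..<d}" for l
      proof (rule ccontr)
        assume "\<not> c < v l"
        then have "c \<in> v ` {0<..<d}"
          using connectedD_interval[OF conn, of "v l" "v a" c] a that by auto
        then obtain t where "t \<in> {0<..<d}" "c = v t" by (rule imageE)
        then show False using ne[of t] by simp
      qed
      show ?thesis by (intro disjI1 eventually_mono[OF ev] pos)
    next
      case False
      have neg: "v l < c" if "l \<in> {0<..<d}" for l
      proof -
        have "\<not> c < v l" using False that by blast
        then show ?thesis using ne[OF that] by simp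
      qed
      show ?thesis by (intro disjI2 eventually_mono[OF ev] neg)
    qed
  qed
  have "(v \<longlongrightarrow> Sup A) (at_right 0)"
  proof (rule order_tendstoI)
    fix a assume "a < Sup A"
    moreover have "A \<noteq> {}" using \<open>- C \<in> A\<close> by blast
    ultimately obtain c where "c \<in> A" "a < c" using less_cSupD[of A a] by blast
    then have "\<forall>\<^sub>F l in at_right 0. c \<le> v l" by (simp add: A_def)
    then show "\<forall>\<^sub>F l in at_right 0. a < v l"
      by eventually_elim (use \<open>a < c\<close> in simp)
  next
    fix a assume a: "Sup A < a"
    have "infinite ({Sup A<..<a} - E)"
      using a E(1) by (intro Diff_infinite_finite) (auto simp: infinite_Ioo)
    then have "{Sup A<..<a} - E \<noteq> {}" by (metis finite.emptyI)
    then obtain c where "c \<in> {Sup A<..<a} - E" by (meson ex_in_conv)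
    then have c: "Sup A < c" "c < a" "c \<notin> E" by auto
    have "\<not> (\<forall>\<^sub>F l in at_right 0. c < v l)"
    proof
      assume "\<forall>\<^sub>F l in at_right 0. c < v l"
      then have "c \<in> A" unfolding A_def mem_Collect_eq by eventually_elim simp
      then show False using cSup_upper[OF _ bdd] c by fastforce
    qed
    then have "\<forall>\<^sub>F l in at_right 0. v l < c" using side[OF c(3)] by blast
    then show "\<forall>\<^sub>F l in at_right 0. v l < a" by eventually_elim (use c in simp)
  qed
  then show ?thesis by blast
qed

text \<open>
  After division by the power \<open>l\<^sup>j\<close> that makes the constant coefficient nonzero, the curve can be
  evaluated at \<open>l = 0\<close>.
\<close>

lemma algebraic_curve_limit_algebraic:
  fixes v :: "real \<Rightarrow> real"
  assumes p: "algebraic_coeffs p" "p \<noteq> 0" "\<And>l. l \<in> {0<..<1} \<Longrightarrow> bieval p l (v l) = 0"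
    and L: "(v \<longlongrightarrow> L) (at_right 0)"
  shows "algebraic L"
proof -
  define j where "j = (LEAST i. coeff p i \<noteq> 0)"
  have ex: "\<exists>i. coeff p i \<noteq> 0" using p(2) by (metis leading_coeff_0_iff)
  have j: "coeff p j \<noteq> 0" unfolding j_def using ex by (rule LeastI_ex)
  have small: "coeff p i = 0" if "i < j" for i using that not_less_Least unfolding j_def by blast
  define q where "q = poly_shift j p"
  have "p = monom 1 j * q"
    by (rule poly_eqI) (simp add: q_def coeff_monom_mult coeff_poly_shift small)
  then have ev: "bieval p l w = l ^ j * bieval q l w" for l w
    by (simp add: bieval_def poly_monom)
  have "bieval q l (v l) = 0" if "l \<in> {0<..<1}" for l
    using p(3)[OF that] that by (simp add: ev)
  then have "\<forall>\<^sub>F l in at_right 0. bieval q l (v l) = 0"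
    by (intro eventually_mono[OF eventually_at_right_real[of 0 1]]) auto
  then have "((\<lambda>l. bieval q l (v l)) \<longlongrightarrow> 0) (at_right 0)"
    by (rule tendsto_eventually)
  moreover have "((\<lambda>l. bieval q l (v l)) \<longlongrightarrow> bieval q 0 L) (at_right 0)"
    unfolding bieval_sum by (intro tendsto_intros L)
  ultimately have "bieval q 0 L = 0" using tendsto_unique[OF trivial_limit_at_right_real] by blast
  then have "poly (coeff p j) L = 0"
    by (simp add: bieval_def q_def coeff_poly_shift poly_0_coeff_0)
  then show ?thesis
    using p(1) j algebraic_root_of_algebraic_poly[of "coeff p j" L]
    by (simp add: algebraic_coeffs_def)
qed

text \<open>
  Banach's indicatrix: the variation is the integral over \<open>c\<close> of the number of intervals
  \<open>(v(l\<^sub>i\<^sub>+\<^sub>1), v(l\<^sub>i))\<close> containing \<open>c\<close>, and by the intermediate value theorem each of them contributes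
  its own solution of \<open>v t = c\<close>.
\<close>

lemma variation_le_level_count:
  fixes v :: "real \<Rightarrow> real" and l :: "nat \<Rightarrow> real"
  assumes cont: "continuous_on X v" and X: "is_interval X"
    and bd: "\<And>t. t \<in> X \<Longrightarrow> \<bar>v t\<bar> \<le> C"
    and E: "finite E" "\<And>c. c \<notin> E \<Longrightarrow> finite {t \<in> X. v t = c} \<and> card {t \<in> X. v t = c} \<le> D"
    and l: "\<And>i. l i \<in> X" "\<And>i. l (Suc i) \<le> l i"
  shows "(\<Sum>i<n. \<bar>v (l (Suc i)) - v (l i)\<bar>) \<le> 2 * C * real D"
proof -
  define I where "I i = {min (v (l (Suc i))) (v (l i)) <..< max (v (l (Suc i))) (v (l i))}" for i
  have C0: "0 \<le> C" using bd[OF l(1)[of 0]] by linarith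
  have dec: "l j \<le> l i" if "i \<le> j" for i j using l(2) that by (rule lift_Suc_antimono_le)
  have hit: "\<exists>t. l (Suc i) < t \<and> t < l i \<and> v t = c" if c: "c \<in> I i" for i c
  proof -
    have sub: "{l (Suc i)..l i} \<subseteq> X"
      using mem_is_interval_1_I[OF X l(1)[of "Suc i"] l(1)[of i]] by auto
    have "connected (v ` {l (Suc i)..l i})"
      using continuous_on_subset[OF cont sub] by (intro connected_continuous_image) auto
    moreover have "v (l (Suc i)) \<in> v ` {l (Suc i)..l i}" "v (l i) \<in> v ` {l (Suc i)..l i}"
      using l(2) by auto
    moreover have "v (l (Suc i)) \<le> c \<and> c \<le> v (l i) \<or> v (l i) \<le> c \<and> c \<le> v (l (Suc i))"
      using c by (auto simp: I_def min_def max_def split: if_splits)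
    ultimately have "c \<in> v ` {l (Suc i)..l i}"
      by (meson connectedD_interval)
    then obtain t where t: "t \<in> {l (Suc i)..l i}" "v t = c" by auto
    then have "t \<noteq> l i" "t \<noteq> l (Suc i)" using c by (auto simp: I_def)
    then show ?thesis using t by (intro exI[of _ t]) auto
  qed
  have count: "(\<Sum>i<n. indicator (I i) c) \<le> real D" if c: "c \<notin> E" for c
  proof -
    let ?N = "{i. i < n \<and> c \<in> I i}"
    define h where "h i = (SOME t. l (Suc i) < t \<and> t < l i \<and> v t = c)" for i
    have h: "l (Suc i) < h i \<and> h i < l i \<and> v (h i) = c" if "i \<in> ?N" for i
    proof -
      have "c \<in> I i" using that by simp
      from someI_ex[OF hit[OF this]] show ?thesis by (simp only: h_def)
    qed
    have "h j < h i" if "i \<in> ?N" "j \<in> ?N" "i < j" for i j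
      using h[OF that(1)] h[OF that(2)] dec[of "Suc i" j] that(3) by auto
    then have inj: "inj_on h ?N"
      by (intro linorder_inj_onI) fastforce+
    have sub: "h ` ?N \<subseteq> {t \<in> X. v t = c}"
    proof
      fix t assume "t \<in> h ` ?N"
      then obtain i where i: "i \<in> ?N" "t = h i" by auto
      then show "t \<in> {t \<in> X. v t = c}"
        using h[OF i(1)] mem_is_interval_1_I[OF X l(1)[of "Suc i"] l(1)[of i], of t] by simp
    qed
    have "card ?N \<le> card {t \<in> X. v t = c}"
      using E(2)[OF c] by (intro card_inj_on_le[OF inj sub]) simp
    moreover have "(\<Sum>i<n. indicator (I i) c) = real (card ?N)"
    proof -
      have "{..<n} \<inter> {i. c \<in> I i} = ?N" by auto
      then show ?thesis by (simp add: indicator_def sum.If_cases)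
    qed
    ultimately show ?thesis using E(2)[OF c] by simp
  qed
  have vb: "- C \<le> v (l i) \<and> v (l i) \<le> C" for i using bd[OF l(1)[of i]] by (simp add: abs_le_iff)
  have len: "measure lborel (I i) = \<bar>v (l (Suc i)) - v (l i)\<bar>" for i
    by (simp add: I_def min_def max_def)
  have int: "integrable lborel (indicator (I i) :: real \<Rightarrow> real)" for i
    unfolding I_def by (intro integrable_real_indicator) auto
  have "(\<Sum>i<n. \<bar>v (l (Suc i)) - v (l i)\<bar>) = (\<Sum>i<n. \<integral>c. indicator (I i) c \<partial>lborel)"
    by (simp add: len)
  also have "\<dots> = (\<integral>c. (\<Sum>i<n. indicator (I i) c) \<partial>lborel)"
    using int by (intro Bochner_Integration.integral_sum[symmetric]) auto
  also have "\<dots> \<le> (\<integral>c. real D * indicator {- C..C} c \<partial>lborel)"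
  proof (rule integral_mono_AE)
    show "integrable lborel (\<lambda>c. \<Sum>i<n. indicator (I i) c :: real)" using int by auto
    show "integrable lborel (\<lambda>c. real D * indicator {- C..C} c)"
      by (intro integrable_mult_right integrable_real_indicator) (auto simp: emeasure_lborel_Icc_eq)
    have "AE c in lborel. c \<notin> E"
      using E(1) by (intro AE_not_in finite_imp_null_set_lborel)
    then show "AE c in lborel. (\<Sum>i<n. indicator (I i) c) \<le> real D * indicator {- C..C} c"
    proof eventually_elim
      case (elim c)
      show ?case
      proof (cases "c \<in> {- C..C}")
        case True then show ?thesis using count[OF elim] by simp
      next
        case False
        then have "c \<notin> I i" for i using vb[of i] vb[of "Suc i"] by (auto simp: I_def)
        then show ?thesis by simp
      qed
    qed
  qed
  also have "\<dots> = real D * (2 * C)" using C0 by simp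
  finally show ?thesis by (simp add: mult_ac)
qed

section \<open>Plays as Markov processes of positions\<close>

lemma expectation_mono_finite_support:
  fixes f g :: "'a \<Rightarrow> real"
  assumes "finite (set_pmf p)" "\<And>x. x \<in> set_pmf p \<Longrightarrow> f x \<le> g x"
  shows "measure_pmf.expectation p f \<le> measure_pmf.expectation p g"
  using assms
  by (intro integral_mono_AE) (auto intro: integrable_measure_pmf_finite simp: AE_measure_pmf_iff)

text \<open>
  Finite supports make every real function integrable, so expectations can be iterated although rewards
  are not assumed bounded outside the valid indices.
\<close>

lemma expectation_bind_finite_support:
  fixes f :: "'b \<Rightarrow> real"
  assumes "finite (set_pmf p)" "\<And>x. x \<in> set_pmf p \<Longrightarrow> finite (set_pmf (F x))"
  shows "measure_pmf.expectation (bind_pmf p F) f =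
    measure_pmf.expectation p (\<lambda>x. measure_pmf.expectation (F x) f)"
proof -
  have "measure_pmf.expectation (bind_pmf p F) f =
      (\<Sum>x\<in>set_pmf p. pmf p x *\<^sub>R measure_pmf.expectation (F x) f)"
    using assms by (intro pmf_expectation_bind) auto
  also have "\<dots> = measure_pmf.expectation p (\<lambda>x. measure_pmf.expectation (F x) f)"
    using assms(1) by (subst integral_measure_pmf_real[of "set_pmf p"]) (auto simp: mult.commute)
  finally show ?thesis .
qed

text \<open>
  A position consists of a history and the state reached after it. Since the last stage is recorded
  in the new history, both its payoff and the new state are functions of the next position alone.
\<close>

definition next_position ::
  "stochastic_game \<Rightarrow> strategy \<Rightarrow> strategy \<Rightarrow> history \<times> nat \<Rightarrow> (history \<times> nat) pmf" where
  "next_position G \<mu> \<nu> = (\<lambda>(h, s). bind_pmf (pair_pmf (\<mu> h s) (\<nu> h s)) (\<lambda>(a, b).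
     map_pmf (\<lambda>s'. (h @ [(s, a, b)], s')) (transition G s a b)))"

primrec position ::
  "stochastic_game \<Rightarrow> strategy \<Rightarrow> strategy \<Rightarrow> nat \<Rightarrow> nat \<Rightarrow> (history \<times> nat) pmf" where
  "position G \<mu> \<nu> s0 0 = return_pmf ([], s0)"
| "position G \<mu> \<nu> s0 (Suc t) = bind_pmf (position G \<mu> \<nu> s0 t) (next_position G \<mu> \<nu>)"

definition last_payoff :: "(nat \<Rightarrow> nat \<Rightarrow> nat \<Rightarrow> real) \<Rightarrow> history \<Rightarrow> real" where
  "last_payoff \<rho> h = (case last h of (s, a, b) \<Rightarrow> \<rho> s a b)"

lemma play_eq_position:
  "play G \<mu> \<nu> s0 t = bind_pmf (position G \<mu> \<nu> s0 t) (\<lambda>(h, s). stage \<mu> \<nu> h s)"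
proof (induction t)
  case 0
  then show ?case by (simp add: bind_return_pmf)
next
  case (Suc t)
  show ?case
    by (simp add: Suc bind_assoc_pmf next_position_def stage_def bind_map_pmf map_pmf_def
        bind_return_pmf case_prod_beta)
qed

lemma finite_actions: "finite (actions1 G s)" "finite (actions2 G s)" "finite (states G)"
  by (simp_all add: actions1_def actions2_def states_def)

context
  fixes G \<mu> \<nu>
  assumes wf: "wf_game G" and \<mu>: "\<mu> \<in> strategies1 G" and \<nu>: "\<nu> \<in> strategies2 G"
begin

lemma supports:
  assumes "s \<in> states G"
  shows "set_pmf (\<mu> h s) \<subseteq> actions1 G s" "set_pmf (\<nu> h s) \<subseteq> actions2 G s"
    "finite (set_pmf (\<mu> h s))" "finite (set_pmf (\<nu> h s))"
proof -
  show "set_pmf (\<mu> h s) \<subseteq> actions1 G s" using \<mu> assms by (simp add: strategies1_def)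
  then show "finite (set_pmf (\<mu> h s))" using finite_actions(1) by (rule finite_subset)
  show "set_pmf (\<nu> h s) \<subseteq> actions2 G s" using \<nu> assms by (simp add: strategies2_def)
  then show "finite (set_pmf (\<nu> h s))" using finite_actions(2) by (rule finite_subset)
qed

lemma transition_support:
  assumes "s \<in> states G" "a \<in> actions1 G s" "b \<in> actions2 G s"
  shows "set_pmf (transition G s a b) \<subseteq> states G" "finite (set_pmf (transition G s a b))"
proof -
  show "set_pmf (transition G s a b) \<subseteq> states G" using wf assms by (simp add: wf_game_def)
  then show "finite (set_pmf (transition G s a b))" using finite_actions(3) finite_subset by blast
qed

lemma next_position_support:
  assumes s: "s \<in> states G" and x: "x \<in> set_pmf (next_position G \<mu> \<nu> (h, s))"
  obtains a b s' where "a \<in> actions1 G s" "b \<in> actions2 G s" "s' \<in> states G" "x = (h @ [(s, a, b)], s')"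
  using x supports[OF s] transition_support[OF s]
  by (fastforce simp: next_position_def)

lemma finite_next_position:
  assumes s: "s \<in> states G"
  shows "finite (set_pmf (next_position G \<mu> \<nu> (h, s)))"
proof -
  have "set_pmf (next_position G \<mu> \<nu> (h, s)) \<subseteq>
      (\<lambda>(a, b, s'). (h @ [(s, a, b)], s')) ` (actions1 G s \<times> actions2 G s \<times> states G)"
  proof
    fix x assume "x \<in> set_pmf (next_position G \<mu> \<nu> (h, s))"
    from next_position_support[OF s this] obtain a b s' where
      "a \<in> actions1 G s" "b \<in> actions2 G s" "s' \<in> states G" "x = (h @ [(s, a, b)], s')" by blast
    then show "x \<in> (\<lambda>(a, b, s'). (h @ [(s, a, b)], s')) ` (actions1 G s \<times> actions2 G s \<times> states G)"
      by force
  qed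
  moreover have "finite ((\<lambda>(a, b, s'). (h @ [(s, a, b)], s')) ` (actions1 G s \<times> actions2 G s \<times> states G))"
    using finite_actions by (intro finite_imageI finite_cartesian_product) auto
  ultimately show ?thesis by (rule finite_subset)
qed

lemma position_support:
  assumes "s0 \<in> states G"
  shows "finite (set_pmf (position G \<mu> \<nu> s0 t)) \<and> snd ` set_pmf (position G \<mu> \<nu> s0 t) \<subseteq> states G"
proof (induction t)
  case 0
  then show ?case using assms by simp
next
  case (Suc t)
  have st: "s \<in> states G" if "(h, s) \<in> set_pmf (position G \<mu> \<nu> s0 t)" for h s
    using Suc that by force
  have "finite (set_pmf (position G \<mu> \<nu> s0 (Suc t)))"
    using Suc st finite_next_position by auto
  moreover have "s' \<in> states G" if "(h', s') \<in> set_pmf (position G \<mu> \<nu> s0 (Suc t))" for h' s'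
  proof -
    from that obtain h s where hs: "(h, s) \<in> set_pmf (position G \<mu> \<nu> s0 t)"
      "(h', s') \<in> set_pmf (next_position G \<mu> \<nu> (h, s))" by auto
    from next_position_support[OF st[OF hs(1)] hs(2)] show ?thesis by blast
  qed
  then have "snd ` set_pmf (position G \<mu> \<nu> s0 (Suc t)) \<subseteq> states G"
    by (intro image_subsetI) (metis prod.collapse)
  ultimately show ?case by blast
qed

lemma expectation_position_Suc:
  fixes f :: "history \<times> nat \<Rightarrow> real"
  assumes "s0 \<in> states G"
  shows "measure_pmf.expectation (position G \<mu> \<nu> s0 (Suc t)) f =
    measure_pmf.expectation (position G \<mu> \<nu> s0 t)
      (\<lambda>x. measure_pmf.expectation (next_position G \<mu> \<nu> x) f)"
  unfolding position.simps
proof (rule expectation_bind_finite_support)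
  show "finite (set_pmf (position G \<mu> \<nu> s0 t))" using position_support[OF assms] by blast
  fix x assume "x \<in> set_pmf (position G \<mu> \<nu> s0 t)"
  then have "snd x \<in> states G" using position_support[OF assms, of t] by blast
  then show "finite (set_pmf (next_position G \<mu> \<nu> x))"
    using finite_next_position[of "snd x" "fst x"] by simp
qed

lemma expectation_position_step_mono:
  fixes f g :: "history \<times> nat \<Rightarrow> real"
  assumes s0: "s0 \<in> states G"
    and le: "\<And>h s. s \<in> states G \<Longrightarrow> f (h, s) \<le> measure_pmf.expectation (next_position G \<mu> \<nu> (h, s)) g"
  shows "measure_pmf.expectation (position G \<mu> \<nu> s0 t) f \<le>
    measure_pmf.expectation (position G \<mu> \<nu> s0 (Suc t)) g"
  unfolding expectation_position_Suc[OF s0]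
proof (rule expectation_mono_finite_support)
  show "finite (set_pmf (position G \<mu> \<nu> s0 t))" using position_support[OF s0] by blast
  fix x assume "x \<in> set_pmf (position G \<mu> \<nu> s0 t)"
  then have "snd x \<in> states G" using position_support[OF s0, of t] by blast
  then show "f x \<le> measure_pmf.expectation (next_position G \<mu> \<nu> x) g"
    using le[of "snd x" "fst x"] by simp
qed

lemma expected_payoff_eq_position:
  assumes s0: "s0 \<in> states G"
  shows "expected_payoff G \<mu> \<nu> s0 t =
    measure_pmf.expectation (position G \<mu> \<nu> s0 (Suc t)) (\<lambda>(h, s). last_payoff (reward G) h)"
proof -
  let ?r = "\<lambda>(h :: history, s, a, b). reward G s a b"
  have fin: "finite (set_pmf (position G \<mu> \<nu> s0 t))" using position_support[OF s0] by blast
  have st: "snd x \<in> states G" if "x \<in> set_pmf (position G \<mu> \<nu> s0 t)" for x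
    using position_support[OF s0, of t] that by blast
  have "expected_payoff G \<mu> \<nu> s0 t = measure_pmf.expectation (position G \<mu> \<nu> s0 t)
      (\<lambda>x. measure_pmf.expectation (stage \<mu> \<nu> (fst x) (snd x)) ?r)"
    unfolding expected_payoff_def play_eq_position case_prod_beta
    using fin supports[OF st] by (intro expectation_bind_finite_support) (auto simp: stage_def)
  also have "\<dots> = measure_pmf.expectation (position G \<mu> \<nu> s0 t)
      (\<lambda>x. measure_pmf.expectation (next_position G \<mu> \<nu> x) (\<lambda>(h, s). last_payoff (reward G) h))"
  proof (intro integral_cong_AE)
    show "AE x in measure_pmf (position G \<mu> \<nu> s0 t).
      measure_pmf.expectation (stage \<mu> \<nu> (fst x) (snd x)) ?r =
      measure_pmf.expectation (next_position G \<mu> \<nu> x) (\<lambda>(h, s). last_payoff (reward G) h)"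
      unfolding AE_measure_pmf_iff
    proof
      fix x assume x: "x \<in> set_pmf (position G \<mu> \<nu> s0 t)"
      obtain h s where hs: "x = (h, s)" by (cases x)
      have s: "s \<in> states G" using st[OF x] hs by simp
      let ?F = "\<lambda>(a, b). map_pmf (\<lambda>s'. (h @ [(s, a, b)], s')) (transition G s a b)"
      let ?l = "\<lambda>(h :: history, s :: nat). last_payoff (reward G) h"
      have "measure_pmf.expectation (next_position G \<mu> \<nu> x) ?l =
          measure_pmf.expectation (pair_pmf (\<mu> h s) (\<nu> h s)) (\<lambda>y. measure_pmf.expectation (?F y) ?l)"
        unfolding hs next_position_def prod.case
        using supports[OF s, of h] transition_support(2)[OF s]
        by (intro expectation_bind_finite_support) (auto simp: subset_iff)
      also have "\<dots> = measure_pmf.expectation (pair_pmf (\<mu> h s) (\<nu> h s)) (\<lambda>(a, b). reward G s a b)"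
        by (intro Bochner_Integration.integral_cong) (auto simp: last_payoff_def)
      also have "\<dots> = measure_pmf.expectation (stage \<mu> \<nu> (fst x) (snd x)) ?r"
        by (simp add: stage_def hs case_prod_unfold)
      finally show "measure_pmf.expectation (stage \<mu> \<nu> (fst x) (snd x)) ?r =
        measure_pmf.expectation (next_position G \<mu> \<nu> x) ?l" by simp
    qed
  qed simp_all
  also have "\<dots> = measure_pmf.expectation (position G \<mu> \<nu> s0 (Suc t)) (\<lambda>(h, s). last_payoff (reward G) h)"
    unfolding expectation_position_Suc[OF s0] ..
  finally show ?thesis .
qed

end

section \<open>The Mertens-Neyman submartingale\<close>

text \<open>
  The statistic of Mertens and Neyman, computed along the reversed history. It increases by the payoff minus the
  discounted value of the state reached, plus the bonus \<open>\<eta>\<close>, and is truncated at \<open>0\<close>. The discount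
  weight in use is \<open>lam\<close> of the statistic itself.
\<close>

fun statistic_rev ::
  "(real \<Rightarrow> real) \<Rightarrow> (real \<Rightarrow> nat \<Rightarrow> real) \<Rightarrow> (nat \<Rightarrow> nat \<Rightarrow> nat \<Rightarrow> real) \<Rightarrow> real \<Rightarrow> history \<Rightarrow> nat \<Rightarrow> real" where
  "statistic_rev lam v \<rho> \<eta> [] z = 0"
| "statistic_rev lam v \<rho> \<eta> ((s, a, b) # h) z =
     max 0 (statistic_rev lam v \<rho> \<eta> h s + \<rho> s a b - v (lam (statistic_rev lam v \<rho> \<eta> h s)) z + \<eta>)"

definition statistic ::
  "(real \<Rightarrow> real) \<Rightarrow> (real \<Rightarrow> nat \<Rightarrow> real) \<Rightarrow> (nat \<Rightarrow> nat \<Rightarrow> nat \<Rightarrow> real) \<Rightarrow> real \<Rightarrow> history \<Rightarrow> nat \<Rightarrow> real" where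
  "statistic lam v \<rho> \<eta> h z = statistic_rev lam v \<rho> \<eta> (rev h) z"

lemma statistic_Nil [simp]: "statistic lam v \<rho> \<eta> [] z = 0"
  by (simp add: statistic_def)

lemma statistic_snoc [simp]: "statistic lam v \<rho> \<eta> (h @ [(s, a, b)]) z =
    max 0 (statistic lam v \<rho> \<eta> h s + \<rho> s a b - v (lam (statistic lam v \<rho> \<eta> h s)) z + \<eta>)"
  by (simp add: statistic_def)

lemma statistic_nonneg: "0 \<le> statistic lam v \<rho> \<eta> h z"
  by (cases h rule: rev_cases) (auto simp: statistic_def split: prod.splits)

text \<open>
  The payoff function \<open>\<rho>\<close> and the discounted values \<open>v\<close> are those of the game for the first player, and
  their negatives for the second. The function \<open>phi\<close> stands for the integral of \<open>lam\<close> from \<open>x\<close> to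
  infinity, and the first of the two step conditions bounds its decrease from below accordingly, with
  an error \<open>\<epsilon> lam\<close>. The second one says that \<open>lam\<close> changes so slowly that discounted values move only
  by \<open>\<epsilon> lam\<close>. The bound \<open>2 C + 3 \<epsilon>\<close> is the largest possible step of the statistic. The last
  assumption is the one-stage inequality that optimal play in the discounted game selected by the
  statistic provides.
\<close>

locale adaptive_play =
  fixes G :: stochastic_game and \<mu> \<nu> :: strategy and s0 :: nat
    and \<rho> :: "nat \<Rightarrow> nat \<Rightarrow> nat \<Rightarrow> real" and v :: "real \<Rightarrow> nat \<Rightarrow> real" and L :: real
    and lam phi :: "real \<Rightarrow> real" and C \<epsilon> :: real
  assumes wf: "wf_game G" and \<mu>: "\<mu> \<in> strategies1 G" and \<nu>: "\<nu> \<in> strategies2 G"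
    and s0: "s0 \<in> states G"
    and \<rho>_bound: "\<And>s a b. s \<in> states G \<Longrightarrow> a \<in> actions1 G s \<Longrightarrow> b \<in> actions2 G s \<Longrightarrow> \<bar>\<rho> s a b\<bar> \<le> C"
    and v_bound: "\<And>l s. 0 < l \<Longrightarrow> l < 1 \<Longrightarrow> s \<in> states G \<Longrightarrow> \<bar>v l s\<bar> \<le> C"
    and \<epsilon>: "0 < \<epsilon>"
    and lam: "\<And>x. 0 \<le> x \<Longrightarrow> 0 < lam x \<and> lam x < 1"
    and phi: "\<And>x. 0 \<le> x \<Longrightarrow> 0 \<le> phi x \<and> phi x \<le> \<epsilon>"
    and phi_step: "\<And>x x'. 0 \<le> x \<Longrightarrow> 0 \<le> x' \<Longrightarrow> \<bar>x' - x\<bar> \<le> 2 * C + 3 * \<epsilon> \<Longrightarrow>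
        lam x * (x' - x) - \<epsilon> * lam x \<le> phi x - phi x'"
    and v_step: "\<And>x x' s. 0 \<le> x \<Longrightarrow> 0 \<le> x' \<Longrightarrow> \<bar>x' - x\<bar> \<le> 2 * C + 3 * \<epsilon> \<Longrightarrow> s \<in> states G \<Longrightarrow>
        \<bar>v (lam x') s - v (lam x) s\<bar> \<le> \<epsilon> * lam x"
    and start: "L - \<epsilon> \<le> v (lam 0) s0"
    and one_stage: "\<And>h s l. s \<in> states G \<Longrightarrow> l = lam (statistic lam v \<rho> (3 * \<epsilon>) h s) \<Longrightarrow>
        v l s \<le> measure_pmf.expectation (next_position G \<mu> \<nu> (h, s))
          (\<lambda>(h', s'). l * last_payoff \<rho> h' + (1 - l) * v l s')"
begin

text \<open>
  The statistic, the discount weight in use and the current discounted value, as functions of the position.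
\<close>

definition "stat x = statistic lam v \<rho> (3 * \<epsilon>) (fst x) (snd x)" for x :: "history \<times> nat"
definition "rate x = lam (stat x)" for x :: "history \<times> nat"
definition "cur x = v (rate x) (snd x)" for x :: "history \<times> nat"
definition "E t f = measure_pmf.expectation (position G \<mu> \<nu> s0 t) f" for t and f :: "history \<times> nat \<Rightarrow> real"

lemma stat_nonneg: "0 \<le> stat x" by (simp add: stat_def statistic_nonneg)

lemma rate_bounds: "0 < rate x" "rate x < 1" using lam[OF stat_nonneg] by (auto simp: rate_def)

lemma integrable_position: "integrable (measure_pmf (position G \<mu> \<nu> s0 t)) (f :: _ \<Rightarrow> real)"
  using position_support[OF wf \<mu> \<nu> s0] by (intro integrable_measure_pmf_finite) auto

lemma integrable_next:
  "s \<in> states G \<Longrightarrow> integrable (measure_pmf (next_position G \<mu> \<nu> (h, s))) (f :: _ \<Rightarrow> real)"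
  using finite_next_position[OF wf \<mu> \<nu>] by (intro integrable_measure_pmf_finite) auto

text \<open>
  Both estimates compare one move with the increment \<open>d\<close> of the statistic before truncation. The
  first only uses that truncation can increase the statistic. The second has to control the increase,
  which occurs only when the new statistic is \<open>0\<close>; there the discount weight is \<open>lam 0\<close>, so the
  defect is paid for by a multiple of the weight, whose total is bounded by \<open>total_rate_bound\<close>.
\<close>

lemma transition_estimates:
  assumes s: "s \<in> states G" and y: "y \<in> set_pmf (next_position G \<mu> \<nu> (h, s))"
  defines "x \<equiv> (h, s)"
  shows "rate x * last_payoff \<rho> (fst y) + (1 - rate x) * v (rate x) (snd y) - cur x + \<epsilon> * rate x
      \<le> (cur y - phi (stat y)) - (cur x - phi (stat x))"
    and "stat y - stat x + cur y - 4 * \<epsilon> - (2 * C + 3 * \<epsilon>) / lam 0 * rate y \<le> last_payoff \<rho> (fst y)"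
proof -
  obtain a b s' where ab: "a \<in> actions1 G s" "b \<in> actions2 G s" and s': "s' \<in> states G"
    and y_eq: "y = (h @ [(s, a, b)], s')"
    using next_position_support[OF wf \<mu> \<nu> s y] by blast
  define l where "l = rate x"
  define d where "d = \<rho> s a b - v l s' + 3 * \<epsilon>"
  have l: "0 < l" "l < 1" using rate_bounds by (auto simp: l_def)
  have pay: "last_payoff \<rho> (fst y) = \<rho> s a b" by (simp add: y_eq last_payoff_def)
  have snd_y: "snd y = s'" by (simp add: y_eq)
  have st: "stat y = max 0 (stat x + d)"
    by (simp add: stat_def y_eq x_def d_def l_def rate_def algebra_simps)
  have dB: "\<bar>d\<bar> \<le> 2 * C + 3 * \<epsilon>"
    using \<rho>_bound[OF s ab] v_bound[OF l s'] \<epsilon> unfolding d_def by linarith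
  have near: "\<bar>stat y - stat x\<bar> \<le> 2 * C + 3 * \<epsilon>"
    using dB stat_nonneg[of x] unfolding st by (auto simp: max_def abs_le_iff)
  have up: "d \<le> stat y - stat x" unfolding st by simp
  have ph: "l * (stat y - stat x) - \<epsilon> * l \<le> phi (stat x) - phi (stat y)"
    using phi_step[OF stat_nonneg stat_nonneg near] by (simp add: l_def rate_def)
  have vs: "\<bar>cur y - v l s'\<bar> \<le> \<epsilon> * l"
    using v_step[OF stat_nonneg stat_nonneg near s'] by (simp add: cur_def l_def rate_def snd_y)
  have "l * d \<le> l * (stat y - stat x)" using up l by simp
  then have "l * (\<rho> s a b - v l s') + 3 * (\<epsilon> * l) - \<epsilon> * l \<le> phi (stat x) - phi (stat y)"
    using ph by (simp add: d_def algebra_simps)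
  then show "rate x * last_payoff \<rho> (fst y) + (1 - rate x) * v (rate x) (snd y) - cur x + \<epsilon> * rate x
      \<le> (cur y - phi (stat y)) - (cur x - phi (stat x))"
    using vs unfolding pay snd_y l_def[symmetric] by (simp add: algebra_simps abs_le_iff)
  have lam0: "0 < lam 0" using lam[of 0] by simp
  have B: "0 \<le> 2 * C + 3 * \<epsilon>" using dB by linarith
  have "stat y - stat x - (2 * C + 3 * \<epsilon>) / lam 0 * rate y \<le> d"
  proof (cases "0 \<le> stat x + d")
    case True
    have "0 \<le> (2 * C + 3 * \<epsilon>) / lam 0 * rate y" using B lam0 rate_bounds(1)[of y] by simp
    then show ?thesis using True by (simp add: st max_def)
  next
    case False
    then have "stat y = 0" by (simp add: st)
    then have "(2 * C + 3 * \<epsilon>) / lam 0 * rate y = 2 * C + 3 * \<epsilon>" using lam0 by (simp add: rate_def)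
    then show ?thesis using \<open>stat y = 0\<close> stat_nonneg[of x] dB by (simp add: abs_le_iff)
  qed
  moreover have "\<epsilon> * l \<le> \<epsilon>" using l \<epsilon> by simp
  ultimately show "stat y - stat x + cur y - 4 * \<epsilon> - (2 * C + 3 * \<epsilon>) / lam 0 * rate y \<le> last_payoff \<rho> (fst y)"
    using vs unfolding pay d_def by (simp add: abs_le_iff)
qed

text \<open>
  The submartingale property. Optimal play gives \<open>v \<le> E(l r + (1 - l) v')\<close> for the discounted values
  with the present weight \<open>l\<close>, and the change of \<open>phi\<close> replaces \<open>l (r - v')\<close>. Of the bonus \<open>3 \<epsilon>\<close>, one \<open>\<epsilon>\<close> each is
  spent on the errors of \<open>phi\<close> and of \<open>v\<close>; the third is the drift.
\<close>

lemma potential_drift: "E t (\<lambda>x. cur x - phi (stat x)) + \<epsilon> * E t rate \<le> E (Suc t) (\<lambda>x. cur x - phi (stat x))"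
proof -
  have "E t (\<lambda>x. cur x - phi (stat x) + \<epsilon> * rate x) \<le> E (Suc t) (\<lambda>x. cur x - phi (stat x))"
    unfolding E_def
  proof (rule expectation_position_step_mono[OF wf \<mu> \<nu> s0])
    fix h s assume s: "s \<in> states G"
    let ?x = "(h, s)" and ?N = "next_position G \<mu> \<nu> (h, s)"
    let ?l = "rate ?x"
    have one: "cur ?x \<le> measure_pmf.expectation ?N (\<lambda>y. ?l * last_payoff \<rho> (fst y) + (1 - ?l) * v ?l (snd y))"
      using one_stage[OF s, of ?l h] by (simp add: cur_def rate_def stat_def case_prod_unfold)
    have "measure_pmf.expectation ?N (\<lambda>y. (?l * last_payoff \<rho> (fst y) + (1 - ?l) * v ?l (snd y)) +
        (\<epsilon> * ?l - phi (stat ?x))) \<le> measure_pmf.expectation ?N (\<lambda>y. cur y - phi (stat y))"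
    proof (rule expectation_mono_finite_support)
      show "finite (set_pmf ?N)" by (rule finite_next_position[OF wf \<mu> \<nu> s])
      fix y assume "y \<in> set_pmf ?N"
      from transition_estimates(1)[OF s this]
      show "(?l * last_payoff \<rho> (fst y) + (1 - ?l) * v ?l (snd y)) + (\<epsilon> * ?l - phi (stat ?x)) \<le> cur y - phi (stat y)"
        by (simp add: algebra_simps)
    qed
    moreover have "measure_pmf.expectation ?N (\<lambda>y. (?l * last_payoff \<rho> (fst y) + (1 - ?l) * v ?l (snd y)) +
        (\<epsilon> * ?l - phi (stat ?x))) =
        measure_pmf.expectation ?N (\<lambda>y. ?l * last_payoff \<rho> (fst y) + (1 - ?l) * v ?l (snd y)) +
        (\<epsilon> * ?l - phi (stat ?x))"
      by (subst Bochner_Integration.integral_add) (simp_all add: integrable_next[OF s])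
    ultimately show "cur ?x - phi (stat ?x) + \<epsilon> * rate ?x \<le> measure_pmf.expectation ?N (\<lambda>y. cur y - phi (stat y))"
      using one by linarith
  qed
  moreover have "E t (\<lambda>x. cur x - phi (stat x) + \<epsilon> * rate x) = E t (\<lambda>x. cur x - phi (stat x)) + \<epsilon> * E t rate"
    unfolding E_def by (subst Bochner_Integration.integral_add) (simp_all add: integrable_position)
  ultimately show ?thesis by simp
qed

lemma E_mono: "(\<And>x. snd x \<in> states G \<Longrightarrow> f x \<le> g x) \<Longrightarrow> E t f \<le> E t g"
  unfolding E_def using position_support[OF wf \<mu> \<nu> s0, of t]
  by (intro expectation_mono_finite_support) auto

lemma E_const: "E t (\<lambda>_. c) = c" by (simp add: E_def)

lemma potential_lower: "L - 2 * \<epsilon> + \<epsilon> * (\<Sum>k<t. E k rate) \<le> E t (\<lambda>x. cur x - phi (stat x))"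
proof (induction t)
  case 0
  have "stat ([], s0) = 0" by (simp add: stat_def)
  then have "E 0 (\<lambda>x. cur x - phi (stat x)) = v (lam 0) s0 - phi 0"
    by (simp add: E_def cur_def rate_def)
  then show ?case using start phi[of 0] by simp
next
  case (Suc t)
  then show ?case using potential_drift[of t] by (simp add: algebra_simps)
qed

lemma cur_le: "snd x \<in> states G \<Longrightarrow> cur x \<le> C"
  using v_bound[OF rate_bounds] unfolding cur_def by (meson abs_le_D1)

text \<open>
  The drift accumulates to at most the range of the bounded potential.
\<close>

lemma total_rate_bound: "(\<Sum>k<t. E k rate) \<le> (C - L + 2 * \<epsilon>) / \<epsilon>"
proof -
  have "E t (\<lambda>x. cur x - phi (stat x)) \<le> E t (\<lambda>_. C)"
  proof (rule E_mono)
    fix x :: "history \<times> nat" assume "snd x \<in> states G"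
    then show "cur x - phi (stat x) \<le> C" using cur_le[of x] phi[OF stat_nonneg[of x]] by linarith
  qed
  then show ?thesis using potential_lower[of t] \<epsilon> by (simp add: E_const field_simps)
qed

lemma cur_lower: "L - 2 * \<epsilon> \<le> E t cur"
proof -
  have "E t (\<lambda>x. cur x - phi (stat x)) \<le> E t cur"
    using phi[OF stat_nonneg] by (intro E_mono) simp
  moreover have "0 \<le> (\<Sum>k<t. E k rate)"
    unfolding E_def by (intro sum_nonneg Bochner_Integration.integral_nonneg less_imp_le[OF rate_bounds(1)])
  then have "0 \<le> \<epsilon> * (\<Sum>k<t. E k rate)" using \<epsilon> by simp
  ultimately show ?thesis using potential_lower[of t] by linarith
qed

text \<open>
  The increments of the statistic telescope in the sum over all stages, which is why they are kept in the estimate.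
\<close>

lemma stage_payoff_lower:
  "E (Suc t) stat - E t stat + L - 6 * \<epsilon> - (2 * C + 3 * \<epsilon>) / lam 0 * E (Suc t) rate
    \<le> E (Suc t) (\<lambda>x. last_payoff \<rho> (fst x))"
proof -
  let ?K = "(2 * C + 3 * \<epsilon>) / lam 0"
  let ?g = "\<lambda>y. last_payoff \<rho> (fst y) - stat y - cur y + ?K * rate y"
  have "E t (\<lambda>x. - stat x - 4 * \<epsilon>) \<le> E (Suc t) ?g"
    unfolding E_def
  proof (rule expectation_position_step_mono[OF wf \<mu> \<nu> s0])
    fix h s assume s: "s \<in> states G"
    let ?x = "(h, s)" and ?N = "next_position G \<mu> \<nu> (h, s)"
    have "measure_pmf.expectation ?N (\<lambda>_. - stat ?x - 4 * \<epsilon>) \<le> measure_pmf.expectation ?N ?g"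
    proof (rule expectation_mono_finite_support)
      show "finite (set_pmf ?N)" by (rule finite_next_position[OF wf \<mu> \<nu> s])
      fix y assume "y \<in> set_pmf ?N"
      from transition_estimates(2)[OF s this]
      show "- stat ?x - 4 * \<epsilon> \<le> ?g y" by (simp add: algebra_simps)
    qed
    then show "- stat ?x - 4 * \<epsilon> \<le> measure_pmf.expectation ?N ?g" by simp
  qed
  moreover have "E t (\<lambda>x. - stat x - 4 * \<epsilon>) = - E t stat - 4 * \<epsilon>"
    unfolding E_def by (subst Bochner_Integration.integral_diff) (simp_all add: integrable_position)
  moreover have "E (Suc t) ?g = E (Suc t) (\<lambda>x. last_payoff \<rho> (fst x)) - E (Suc t) stat - E (Suc t) cur + ?K * E (Suc t) rate"
    unfolding E_def
    by (simp add: integrable_position Bochner_Integration.integral_add Bochner_Integration.integral_diff del: position.simps)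
  ultimately show ?thesis using cur_lower[of "Suc t"] by linarith
qed

theorem total_payoff_lower:
  "\<exists>K. \<forall>\<tau>. real \<tau> * (L - 6 * \<epsilon>) - K \<le>
     (\<Sum>t<\<tau>. measure_pmf.expectation (position G \<mu> \<nu> s0 (Suc t)) (\<lambda>x. last_payoff \<rho> (fst x)))"
proof -
  let ?K = "(2 * C + 3 * \<epsilon>) / lam 0"
  have C: "0 \<le> C" using v_bound[OF rate_bounds s0] by (meson abs_ge_zero order_trans)
  then have K: "0 \<le> ?K" using \<epsilon> lam[of 0] by simp
  have lower: "E \<tau> stat + real \<tau> * (L - 6 * \<epsilon>) - ?K * (\<Sum>t<\<tau>. E (Suc t) rate)
      \<le> (\<Sum>t<\<tau>. E (Suc t) (\<lambda>x. last_payoff \<rho> (fst x)))" for \<tau>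
  proof (induction \<tau>)
    case 0
    have "stat ([], s0) = 0" by (simp add: stat_def)
    then show ?case by (simp add: E_def)
  next
    case (Suc \<tau>)
    have "?K * (\<Sum>t<Suc \<tau>. E (Suc t) rate) = ?K * (\<Sum>t<\<tau>. E (Suc t) rate) + ?K * E (Suc \<tau>) rate"
      by (simp only: sum.lessThan_Suc distrib_left)
    moreover have "real (Suc \<tau>) * (L - 6 * \<epsilon>) = real \<tau> * (L - 6 * \<epsilon>) + L - 6 * \<epsilon>"
      by (simp add: algebra_simps)
    moreover have "(\<Sum>t<Suc \<tau>. E (Suc t) (\<lambda>x. last_payoff \<rho> (fst x))) =
      (\<Sum>t<\<tau>. E (Suc t) (\<lambda>x. last_payoff \<rho> (fst x))) + E (Suc \<tau>) (\<lambda>x. last_payoff \<rho> (fst x))"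
      by (simp only: sum.lessThan_Suc)
    ultimately show ?case using Suc stage_payoff_lower[of \<tau>] by linarith
  qed
  have "real \<tau> * (L - 6 * \<epsilon>) - ?K * ((C - L + 2 * \<epsilon>) / \<epsilon>) \<le>
      (\<Sum>t<\<tau>. E (Suc t) (\<lambda>x. last_payoff \<rho> (fst x)))" for \<tau>
  proof -
    have "0 \<le> E 0 rate" using rate_bounds(1) by (simp add: E_def less_imp_le)
    then have "(\<Sum>t<\<tau>. E (Suc t) rate) \<le> (\<Sum>t<Suc \<tau>. E t rate)"
      by (simp only: sum.lessThan_Suc_shift)
    also have "\<dots> \<le> (C - L + 2 * \<epsilon>) / \<epsilon>" by (rule total_rate_bound)
    finally have "?K * (\<Sum>t<\<tau>. E (Suc t) rate) \<le> ?K * ((C - L + 2 * \<epsilon>) / \<epsilon>)"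
      using K by (rule mult_left_mono)
    moreover have "0 \<le> E \<tau> stat" unfolding E_def by (intro Bochner_Integration.integral_nonneg stat_nonneg)
    ultimately show ?thesis using lower[of \<tau>] by linarith
  qed
  then show ?thesis unfolding E_def by blast
qed

end

section \<open>Slowly varying discount schedules\<close>

text \<open>
  Greedy choice: from \<open>l\<close> descend to \<open>(1 - \<delta>) l\<close>, or only until the values have moved by \<open>\<delta> l\<close> in
  total, whichever comes first. Then \<open>\<delta> l\<close> is at most the movement of the values plus the decrease
  of \<open>l\<close>. Both quantities have bounded sums along the sequence, the first because of the bounded
  variation, so the sequence is summable.
\<close>

lemma slow_sequence:
  fixes v :: "real \<Rightarrow> 's \<Rightarrow> real"
  assumes S: "finite S" and \<delta>: "0 < \<delta>" "\<delta> < 1"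
    and cont: "\<And>s. s \<in> S \<Longrightarrow> continuous_on {0<..<1} (\<lambda>l. v l s)"
    and var: "\<And>s l n. s \<in> S \<Longrightarrow> (\<And>i. l i \<in> {0<..<1}) \<Longrightarrow> (\<And>i. l (Suc i) \<le> l i) \<Longrightarrow>
        (\<Sum>i<n. \<bar>v (l (Suc i)) s - v (l i) s\<bar>) \<le> K s"
  shows "\<exists>l :: nat \<Rightarrow> real. (\<forall>i. 0 < l i \<and> l i < 1 \<and> l (Suc i) \<le> l i \<and> (1 - \<delta>) * l i \<le> l (Suc i)) \<and>
    (\<forall>i. \<forall>s\<in>S. \<bar>v (l (Suc i)) s - v (l i) s\<bar> \<le> \<delta> * l i) \<and> summable l"
proof -
  \<comment> \<open>A sum over the states instead of a maximum, so that continuity is immediate.\<close>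
  define D where "D m l = (\<Sum>s\<in>S. \<bar>v m s - v l s\<bar>)" for m l
  have "\<exists>m. 0 < m \<and> m \<le> l \<and> (1 - \<delta>) * l \<le> m \<and> D m l \<le> \<delta> * l \<and> \<delta> * l \<le> D m l + (l - m)"
    if l: "0 < l" "l < 1" for l
  proof (cases "D ((1 - \<delta>) * l) l \<le> \<delta> * l")
    case True
    have "0 \<le> D ((1 - \<delta>) * l) l" by (simp add: D_def sum_nonneg)
    then show ?thesis using True l \<delta>
      by (intro exI[of _ "(1 - \<delta>) * l"]) (auto simp: algebra_simps)
  next
    case False
    have low: "0 < (1 - \<delta>) * l" "(1 - \<delta>) * l \<le> l" using l \<delta> by (auto simp: algebra_simps)
    have "continuous_on {(1 - \<delta>) * l..l} (\<lambda>m. v m s)" if "s \<in> S" for s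
      using low l by (intro continuous_on_subset[OF cont[OF that]]) auto
    then have "continuous_on {(1 - \<delta>) * l..l} (\<lambda>m. D m l)"
      unfolding D_def by (intro continuous_intros)
    moreover have "D l l \<le> \<delta> * l" using l \<delta> by (simp add: D_def)
    ultimately obtain m where "(1 - \<delta>) * l \<le> m" "m \<le> l" "D m l = \<delta> * l"
      using IVT2'[of "\<lambda>m. D m l" l "\<delta> * l" "(1 - \<delta>) * l"] False low by auto
    then show ?thesis using low by (intro exI[of _ m]) auto
  qed
  then obtain nx where nx: "\<And>l. 0 < l \<Longrightarrow> l < 1 \<Longrightarrow> 0 < nx l \<and> nx l \<le> l \<and> (1 - \<delta>) * l \<le> nx l \<and>
      D (nx l) l \<le> \<delta> * l \<and> \<delta> * l \<le> D (nx l) l + (l - nx l)"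
    by metis
  define l where "l i = (nx ^^ i) (1/2)" for i
  have l01: "0 < l i \<and> l i < 1" for i
  proof (induction i)
    case (Suc i) then show ?case using nx[of "l i"] by (auto simp: l_def)
  qed (simp add: l_def)
  have step: "0 < l (Suc i) \<and> l (Suc i) \<le> l i \<and> (1 - \<delta>) * l i \<le> l (Suc i) \<and>
      D (l (Suc i)) (l i) \<le> \<delta> * l i \<and> \<delta> * l i \<le> D (l (Suc i)) (l i) + (l i - l (Suc i))" for i
    using nx[of "l i"] l01[of i] by (simp add: l_def)
  have ch: "\<bar>v (l (Suc i)) s - v (l i) s\<bar> \<le> \<delta> * l i" if "s \<in> S" for i s
  proof -
    have "\<bar>v (l (Suc i)) s - v (l i) s\<bar> \<le> D (l (Suc i)) (l i)"
      unfolding D_def using S that by (intro member_le_sum) auto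
    then show ?thesis using step[of i] by linarith
  qed
  have "(\<Sum>i<n. l i) \<le> (sum K S + 1) / \<delta>" for n
  proof -
    have "\<delta> * (\<Sum>i<n. l i) \<le> (\<Sum>i<n. D (l (Suc i)) (l i) + (l i - l (Suc i)))"
      unfolding sum_distrib_left using step by (intro sum_mono) blast
    also have "\<dots> = (\<Sum>s\<in>S. \<Sum>i<n. \<bar>v (l (Suc i)) s - v (l i) s\<bar>) + (l 0 - l n)"
      unfolding sum.distrib D_def by (subst sum.swap) (simp add: sum_lessThan_telescope')
    also have "\<dots> \<le> sum K S + 1"
    proof (rule add_mono)
      show "(\<Sum>s\<in>S. \<Sum>i<n. \<bar>v (l (Suc i)) s - v (l i) s\<bar>) \<le> sum K S"
        using l01 step by (intro sum_mono var) auto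
      show "l 0 - l n \<le> 1" using l01[of 0] l01[of n] by linarith
    qed
    finally show ?thesis using \<delta> by (simp add: field_simps)
  qed
  then have "summable l"
    using l01 by (intro summableI_nonneg_bounded) (auto intro: less_imp_le)
  then show ?thesis using l01 step ch by blast
qed

text \<open>
  The conditions imposed on \<open>lam\<close> and \<open>phi\<close> in \<open>adaptive_play\<close>, with the condition on the initial
  weight for every state \<open>s\<close>.
\<close>

definition slow_schedule ::
  "'s set \<Rightarrow> (real \<Rightarrow> 's \<Rightarrow> real) \<Rightarrow> ('s \<Rightarrow> real) \<Rightarrow> real \<Rightarrow> real \<Rightarrow> (real \<Rightarrow> real) \<Rightarrow> (real \<Rightarrow> real) \<Rightarrow> bool" where
  "slow_schedule S v L B \<epsilon> lam phi \<longleftrightarrow>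
    (\<forall>x\<ge>0. 0 < lam x \<and> lam x < 1) \<and> (\<forall>x\<ge>0. 0 \<le> phi x \<and> phi x \<le> \<epsilon>) \<and>
    (\<forall>x\<ge>0. \<forall>x'\<ge>0. \<bar>x' - x\<bar> \<le> B \<longrightarrow> lam x * (x' - x) - \<epsilon> * lam x \<le> phi x - phi x') \<and>
    (\<forall>x\<ge>0. \<forall>x'\<ge>0. \<forall>s\<in>S. \<bar>x' - x\<bar> \<le> B \<longrightarrow> \<bar>v (lam x') s - v (lam x) s\<bar> \<le> \<epsilon> * lam x) \<and>
    (\<forall>s\<in>S. \<bar>v (lam 0) s - L s\<bar> \<le> \<epsilon>)"

lemma slow_scheduleD:
  assumes "slow_schedule S v L B \<epsilon> lam phi"
  shows "0 \<le> x \<Longrightarrow> 0 < lam x \<and> lam x < 1"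
    and "0 \<le> x \<Longrightarrow> 0 \<le> phi x \<and> phi x \<le> \<epsilon>"
    and "0 \<le> x \<Longrightarrow> 0 \<le> x' \<Longrightarrow> \<bar>x' - x\<bar> \<le> B \<Longrightarrow> lam x * (x' - x) - \<epsilon> * lam x \<le> phi x - phi x'"
    and "0 \<le> x \<Longrightarrow> 0 \<le> x' \<Longrightarrow> \<bar>x' - x\<bar> \<le> B \<Longrightarrow> s \<in> S \<Longrightarrow> \<bar>v (lam x') s - v (lam x) s\<bar> \<le> \<epsilon> * lam x"
    and "s \<in> S \<Longrightarrow> \<bar>v (lam 0) s - L s\<bar> \<le> \<epsilon>"
  using assms unfolding slow_schedule_def by simp_all

text \<open>
  A tail of the slow sequence is turned into a step function that takes each term on an interval of length \<open>B\<close>.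
  A step of the statistic then leads at most to a neighbouring interval, where the values and the weight differ by a small
  multiple of the weight. Summability makes the integral of the step function finite, and
  choosing a late tail makes it small and the first value close to the limit. The
  integral is convex in its lower limit because the sequence decreases, which yields the support inequality
  \<open>lam x' (x' - x) \<le> phi x - phi x'\<close>.
\<close>

lemma slow_schedule_exists:
  fixes v :: "real \<Rightarrow> 's \<Rightarrow> real"
  assumes S: "finite S" and \<epsilon>: "0 < \<epsilon>" and B: "0 < B"
    and cont: "\<And>s. s \<in> S \<Longrightarrow> continuous_on {0<..<1} (\<lambda>l. v l s)"
    and var: "\<And>s l n. s \<in> S \<Longrightarrow> (\<And>i. l i \<in> {0<..<1}) \<Longrightarrow> (\<And>i. l (Suc i) \<le> l i) \<Longrightarrow>
        (\<Sum>i<n. \<bar>v (l (Suc i)) s - v (l i) s\<bar>) \<le> K s"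
    and lim: "\<And>s. s \<in> S \<Longrightarrow> ((\<lambda>l. v l s) \<longlongrightarrow> L s) (at_right 0)"
  shows "\<exists>lam phi. slow_schedule S v L B \<epsilon> lam phi"
proof -
  \<comment> \<open>The factor 2 pays for a step back to the preceding, larger term \<open>l\<close>, which is at most twice its successor.\<close>
  define \<delta> where "\<delta> = min (1/2) (min (\<epsilon>/2) (\<epsilon> / (2 * B)))"
  have \<delta>: "0 < \<delta>" "\<delta> \<le> 1/2" "2 * \<delta> \<le> \<epsilon>" "2 * \<delta> * B \<le> \<epsilon>"
  proof -
    have "\<delta> \<le> \<epsilon> / (2 * B)" by (simp add: \<delta>_def)
    then show "2 * \<delta> * B \<le> \<epsilon>" using B by (simp add: field_simps)
  qed (use \<epsilon> B in \<open>auto simp: \<delta>_def\<close>)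
  have "\<exists>l :: nat \<Rightarrow> real. (\<forall>i. 0 < l i \<and> l i < 1 \<and> l (Suc i) \<le> l i \<and> (1 - \<delta>) * l i \<le> l (Suc i)) \<and>
    (\<forall>i. \<forall>s\<in>S. \<bar>v (l (Suc i)) s - v (l i) s\<bar> \<le> \<delta> * l i) \<and> summable l"
    using \<delta> by (intro slow_sequence[OF S _ _ cont var]) auto
  then obtain l0 :: "nat \<Rightarrow> real" where l0: "\<And>i. 0 < l0 i \<and> l0 i < 1 \<and> l0 (Suc i) \<le> l0 i \<and> (1 - \<delta>) * l0 i \<le> l0 (Suc i)"
    "\<And>i s. s \<in> S \<Longrightarrow> \<bar>v (l0 (Suc i)) s - v (l0 i) s\<bar> \<le> \<delta> * l0 i" and sm0: "summable l0"
    by blast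
  have "filterlim l0 (at_right 0) sequentially"
    using summable_LIMSEQ_zero[OF sm0] l0(1)
    by (intro tendsto_imp_filterlim_at_right) (auto intro: always_eventually)
  then have "(\<lambda>i. v (l0 i) s) \<longlonglongrightarrow> L s" if "s \<in> S" for s
    using filterlim_compose[OF lim[OF that]] by blast
  then have "\<forall>\<^sub>F i in sequentially. \<bar>v (l0 i) s - L s\<bar> \<le> \<epsilon>" if "s \<in> S" for s
    using tendstoD[OF _ \<epsilon>] that by (force simp: dist_real_def elim: eventually_mono)
  then have "\<forall>\<^sub>F i in sequentially. \<forall>s\<in>S. \<bar>v (l0 i) s - L s\<bar> \<le> \<epsilon>"
    using S by (simp add: eventually_ball_finite)
  then obtain N1 where N1: "\<And>i s. i \<ge> N1 \<Longrightarrow> s \<in> S \<Longrightarrow> \<bar>v (l0 i) s - L s\<bar> \<le> \<epsilon>"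
    unfolding eventually_sequentially by blast
  obtain N2 where N2: "\<And>n. n \<ge> N2 \<Longrightarrow> norm (\<Sum>i. l0 (i + n)) < \<epsilon> / B"
    using suminf_exist_split[of "\<epsilon> / B" l0] \<epsilon> B sm0 by auto
  define N where "N = max N1 N2"
  define l where "l i = l0 (i + N)" for i
  have l: "0 < l i" "l i < 1" "l (Suc i) \<le> l i" "(1 - \<delta>) * l i \<le> l (Suc i)" for i
    using l0(1)[of "i + N"] by (auto simp: l_def)
  have lv: "\<bar>v (l (Suc i)) s - v (l i) s\<bar> \<le> \<delta> * l i" if "s \<in> S" for i s
    using l0(2)[OF that, of "i + N"] by (simp add: l_def)
  have sm: "summable (\<lambda>j. l (j + i))" for i
    using summable_ignore_initial_segment[OF sm0, of "N + i"] by (simp add: l_def add_ac)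
  define T where "T i = (\<Sum>j. l (j + i))" for i
  have T_Suc: "T i = l i + T (Suc i)" for i
    unfolding T_def using suminf_split_head[OF sm[of i]] by simp
  have T_nn: "0 \<le> T i" for i unfolding T_def using l(1) by (intro suminf_nonneg sm) (simp add: less_imp_le)
  have T_anti: "T i \<le> T 0" for i
  proof (induction i)
    case (Suc i)
    then show ?case using T_Suc[of i] l(1)[of i] by linarith
  qed simp
  have "norm (T 0) < \<epsilon> / B"
    using N2[of N] by (simp add: N_def T_def l_def)
  then have T0: "B * T 0 \<le> \<epsilon>" using B T_nn[of 0] by (simp add: field_simps)
  define idx where "idx x = nat \<lfloor>x / B\<rfloor>" for x
  have idx: "B * real (idx x) \<le> x" "x < B * (real (idx x) + 1)" if "0 \<le> x" for x
  proof -
    have "0 \<le> x / B" using that B by simp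
    then have "real (idx x) \<le> x / B" "x / B < real (idx x) + 1"
      unfolding idx_def by linarith+
    then show "B * real (idx x) \<le> x" "x < B * (real (idx x) + 1)" using B by (simp_all add: field_simps)
  qed
  define lam where "lam x = l (idx x)" for x
  \<comment> \<open>The integral of \<open>lam\<close> over \<open>[x, \<infinity>)\<close>: the rest of the interval of \<open>x\<close> plus the later intervals.\<close>
  define phi where "phi x = B * T (Suc (idx x)) + (B * (real (idx x) + 1) - x) * l (idx x)" for x
  have phi_bounds: "0 \<le> phi x \<and> phi x \<le> \<epsilon>" if x: "0 \<le> x" for x
  proof
    show "0 \<le> phi x" unfolding phi_def
      using idx[OF x] l(1)[of "idx x"] T_nn[of "Suc (idx x)"] B
      by (intro add_nonneg_nonneg mult_nonneg_nonneg) auto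
    have "(B * (real (idx x) + 1) - x) * l (idx x) \<le> B * l (idx x)"
      using idx[OF x] l(1)[of "idx x"] by (intro mult_right_mono) (auto simp: algebra_simps)
    then have "phi x \<le> B * T (idx x)" by (simp add: phi_def T_Suc[of "idx x"] algebra_simps)
    also have "\<dots> \<le> B * T 0" using B T_anti by simp
    finally show "phi x \<le> \<epsilon>" using T0 by simp
  qed
  have near: "\<bar>l (idx x') - l (idx x)\<bar> \<le> 2 * \<delta> * l (idx x) \<and>
      (\<forall>s\<in>S. \<bar>v (l (idx x')) s - v (l (idx x)) s\<bar> \<le> 2 * \<delta> * l (idx x)) \<and>
      l (idx x') * (x' - x) \<le> phi x - phi x'"
    if x: "0 \<le> x" "0 \<le> x'" "\<bar>x' - x\<bar> \<le> B" for x x'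
  proof -
    have pos: "0 \<le> \<delta> * l i" for i using \<delta>(1) l(1)[of i] by simp
    have halving: "\<delta> * l i \<le> 2 * \<delta> * l (Suc i)" for i
    proof -
      have "1 / 2 * l i \<le> (1 - \<delta>) * l i"
        using \<delta>(2) l(1)[of i] by (intro mult_right_mono) auto
      then have "l i \<le> 2 * l (Suc i)" using l(4)[of i] by linarith
      then have "\<delta> * l i \<le> \<delta> * (2 * l (Suc i))" using \<delta>(1) by (intro mult_left_mono) auto
      then show ?thesis by simp
    qed
    have "B * real (idx x') < B * (real (idx x) + 2)" "B * real (idx x) < B * (real (idx x') + 2)"
      using idx[OF x(1)] idx[OF x(2)] x(3) by (auto simp: algebra_simps abs_le_iff)
    then have "real (idx x') < real (idx x) + 2" "real (idx x) < real (idx x') + 2" using B by simp_all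
    then consider "idx x' = idx x" | "idx x' = Suc (idx x)" | "idx x = Suc (idx x')" by linarith
    then show ?thesis
    proof cases
      case 1
      then show ?thesis using pos[of "idx x"] by (simp add: phi_def algebra_simps)
    next
      case 2
      have "l (Suc (idx x)) * (B * (real (idx x) + 1) - x) \<le> l (idx x) * (B * (real (idx x) + 1) - x)"
        using idx[OF x(1)] l(3) by (intro mult_right_mono) auto
      then have "l (idx x') * (x' - x) \<le> phi x - phi x'"
        by (simp add: phi_def 2 T_Suc[of "Suc (idx x)"] algebra_simps)
      moreover have "\<bar>l (idx x') - l (idx x)\<bar> \<le> 2 * \<delta> * l (idx x)"
        using l(3)[of "idx x"] l(4)[of "idx x"] pos[of "idx x"] by (simp add: 2 abs_le_iff algebra_simps)
      moreover have "\<bar>v (l (idx x')) s - v (l (idx x)) s\<bar> \<le> 2 * \<delta> * l (idx x)" if "s \<in> S" for s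
        using lv[OF that, of "idx x"] pos[of "idx x"] by (simp add: 2)
      ultimately show ?thesis by blast
    next
      case 3
      have "l (Suc (idx x')) * (x - B * (real (idx x') + 1)) \<le> l (idx x') * (x - B * (real (idx x') + 1))"
        using idx(1)[OF x(1)] l(3) by (intro mult_right_mono) (auto simp: 3 algebra_simps)
      then have "l (idx x') * (x' - x) \<le> phi x - phi x'"
        by (simp add: phi_def 3 T_Suc[of "Suc (idx x')"] algebra_simps)
      moreover have "\<bar>l (idx x') - l (idx x)\<bar> \<le> 2 * \<delta> * l (idx x)"
        using l(3)[of "idx x'"] l(4)[of "idx x'"] halving[of "idx x'"] pos[of "idx x"]
        by (simp add: 3 abs_le_iff algebra_simps)
      moreover have "\<bar>v (l (idx x')) s - v (l (idx x)) s\<bar> \<le> 2 * \<delta> * l (idx x)" if "s \<in> S" for s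
        using lv[OF that, of "idx x'"] halving[of "idx x'"] by (simp add: 3 abs_minus_commute)
      ultimately show ?thesis by blast
    qed
  qed
  have phi_step: "lam x * (x' - x) - \<epsilon> * lam x \<le> phi x - phi x'"
    if x: "0 \<le> x" "0 \<le> x'" "\<bar>x' - x\<bar> \<le> B" for x x'
  proof -
    have "\<bar>l (idx x') - l (idx x)\<bar> * \<bar>x' - x\<bar> \<le> (2 * \<delta> * l (idx x)) * B"
      using near[OF x] x(3) by (intro mult_mono) auto
    also have "\<dots> = (2 * \<delta> * B) * l (idx x)" by simp
    also have "\<dots> \<le> \<epsilon> * l (idx x)" using \<delta>(4) l(1)[of "idx x"] by (intro mult_right_mono) auto
    finally have "\<bar>(l (idx x') - l (idx x)) * (x' - x)\<bar> \<le> \<epsilon> * l (idx x)" by (simp add: abs_mult)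
    then show ?thesis using near[OF x] by (simp add: lam_def algebra_simps abs_le_iff)
  qed
  have v_step: "\<bar>v (lam x') s - v (lam x) s\<bar> \<le> \<epsilon> * lam x"
    if x: "0 \<le> x" "0 \<le> x'" "\<bar>x' - x\<bar> \<le> B" and s: "s \<in> S" for x x' s
  proof -
    have "2 * \<delta> * l (idx x) \<le> \<epsilon> * l (idx x)" using \<delta>(3) l(1)[of "idx x"] by (intro mult_right_mono) auto
    moreover have "\<bar>v (lam x') s - v (lam x) s\<bar> \<le> 2 * \<delta> * l (idx x)" using near[OF x] s by (simp add: lam_def)
    ultimately show ?thesis unfolding lam_def by linarith
  qed
  have start: "\<bar>v (lam 0) s - L s\<bar> \<le> \<epsilon>" if "s \<in> S" for s
    using N1[of N s] that by (simp add: lam_def idx_def l_def N_def)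
  have "0 < lam x \<and> lam x < 1" for x using l(1,2) by (simp add: lam_def)
  then show ?thesis unfolding slow_schedule_def
    using phi_bounds phi_step v_step start by (intro exI[of _ lam] exI[of _ phi]) simp
qed

section \<open>Determinants of discounted resolvents\<close>

text \<open>
  The determinant of an array of functions. Matrices of size \<open>n\<close> are represented by functions, so that rows can be
  mixed and replaced without dimension side conditions.
\<close>

definition leibniz :: "nat \<Rightarrow> (nat \<Rightarrow> nat \<Rightarrow> real) \<Rightarrow> real" where
  "leibniz n F = (\<Sum>\<pi> | \<pi> permutes {0..<n}. signof \<pi> * (\<Prod>i = 0..<n. F i (\<pi> i)))"

lemma leibniz_eq_det: "leibniz n F = Determinant.det (mat n n (\<lambda>(i, j). F i j))"
proof -
  have "(\<Prod>i = 0..<n. mat n n (\<lambda>(i, j). F i j) $$ (i, \<pi> i)) = (\<Prod>i = 0..<n. F i (\<pi> i))"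
    if "\<pi> permutes {0..<n}" for \<pi>
  proof (rule prod.cong)
    fix i assume i: "i \<in> {0..<n}"
    then have "\<pi> i < n" using permutes_in_image[OF that, of i] by auto
    then show "mat n n (\<lambda>(i, j). F i j) $$ (i, \<pi> i) = F i (\<pi> i)" using i by simp
  qed simp
  then show ?thesis by (simp add: leibniz_def Determinant.det_def)
qed

lemma leibniz_cong:
  assumes "\<And>i j. i < n \<Longrightarrow> j < n \<Longrightarrow> F i j = F' i j"
  shows "leibniz n F = leibniz n F'"
  unfolding leibniz_def
proof (intro sum.cong refl arg_cong2[where f = "(*)"] prod.cong)
  fix \<pi> i assume "\<pi> \<in> {\<pi>. \<pi> permutes {0..<n}}" and i: "i \<in> {0..<n}"
  then have "\<pi> i < n" using permutes_in_image[of \<pi> "{0..<n}" i] by auto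
  then show "F i (\<pi> i) = F' i (\<pi> i)" using assms i by simp
qed

text \<open>
  If every row is an average, the determinant is the average over all independent choices of one row
  from each, weighted by the product measure.
\<close>

lemma leibniz_multilinear:
  assumes "\<And>i. finite (A i)"
  shows "leibniz n (\<lambda>i j. \<Sum>a\<in>A i. x i a * F i a j) =
    (\<Sum>f\<in>PiE {0..<n} A. (\<Prod>i = 0..<n. x i (f i)) * leibniz n (\<lambda>i j. F i (f i) j))"
proof -
  have "leibniz n (\<lambda>i j. \<Sum>a\<in>A i. x i a * F i a j) =
      (\<Sum>\<pi> | \<pi> permutes {0..<n}. \<Sum>f\<in>PiE {0..<n} A.
        signof \<pi> * ((\<Prod>i = 0..<n. x i (f i)) * (\<Prod>i = 0..<n. F i (f i) (\<pi> i))))"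
    unfolding leibniz_def
    by (subst prod_sum_PiE) (auto simp: assms sum_distrib_left prod.distrib)
  also have "\<dots> = (\<Sum>f\<in>PiE {0..<n} A. \<Sum>\<pi> | \<pi> permutes {0..<n}.
        signof \<pi> * ((\<Prod>i = 0..<n. x i (f i)) * (\<Prod>i = 0..<n. F i (f i) (\<pi> i))))"
    by (rule sum.swap)
  finally show ?thesis by (simp add: leibniz_def sum_distrib_left mult_ac)
qed

text \<open>
  At a minimum, \<open>z\<close> is at least \<open>t\<close> times an average of larger or equal values; as \<open>t < 1\<close>, the
  minimum cannot be negative.
\<close>

lemma substochastic_minimum_principle:
  fixes q :: "nat \<Rightarrow> nat \<Rightarrow> real"
  assumes q: "\<And>i j. i < n \<Longrightarrow> j < n \<Longrightarrow> 0 \<le> q i j" "\<And>i. i < n \<Longrightarrow> (\<Sum>j = 0..<n. q i j) = 1"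
    and t: "0 \<le> t" "t < 1"
    and z: "\<And>i. i < n \<Longrightarrow> t * (\<Sum>j = 0..<n. q i j * z j) \<le> z i"
    and i: "i < n"
  shows "0 \<le> z i"
proof -
  let ?m = "Min (z ` {0..<n})"
  have m: "?m \<le> z j" if "j < n" for j using that by (intro Min_le) auto
  have "?m \<in> z ` {0..<n}" using i by (intro Min_in) auto
  then obtain k where k: "k < n" "?m = z k" by auto
  have "?m = (\<Sum>j = 0..<n. q k j * ?m)" using q(2)[OF k(1)] by (simp flip: sum_distrib_right)
  also have "\<dots> \<le> (\<Sum>j = 0..<n. q k j * z j)"
    using m q(1)[OF k(1)] by (intro sum_mono mult_left_mono) auto
  finally have "t * ?m \<le> t * (\<Sum>j = 0..<n. q k j * z j)" using t by (intro mult_left_mono)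
  also have "\<dots> \<le> ?m" using z[OF k(1)] k(2) by simp
  finally have "0 \<le> (1 - t) * ?m" by (simp add: algebra_simps)
  then have "0 \<le> ?m" using t by (simp add: zero_le_mult_iff)
  then show ?thesis using m[OF i] by linarith
qed

text \<open>
  The determinant of \<open>1 - t q\<close> equals \<open>1\<close> at \<open>t = 0\<close> and has no zero for \<open>0 \<le> t < 1\<close>, because the
  minimum principle applied to \<open>z\<close> and to \<open>-z\<close> excludes a kernel.
\<close>

lemma leibniz_resolvent_pos:
  fixes q :: "nat \<Rightarrow> nat \<Rightarrow> real"
  assumes q: "\<And>i j. i < n \<Longrightarrow> j < n \<Longrightarrow> 0 \<le> q i j" "\<And>i. i < n \<Longrightarrow> (\<Sum>j = 0..<n. q i j) = 1"
    and t: "0 \<le> t" "t < 1"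
  shows "0 < leibniz n (\<lambda>i j. (if i = j then 1 else 0) - t * q i j)"
proof (rule ccontr)
  define D where "D t = leibniz n (\<lambda>i j. (if i = j then 1 else 0) - t * q i j)" for t
  assume "\<not> ?thesis"
  then have "D t \<le> 0" by (simp add: D_def)
  moreover have "D 0 = 1"
  proof -
    have "mat n n (\<lambda>(i, j). (if i = j then 1 else 0) - 0 * q i j) = (1\<^sub>m n :: real mat)"
      by (rule eq_matI) auto
    then show ?thesis by (simp add: D_def leibniz_eq_det)
  qed
  moreover have "continuous_on {0..t} D"
    unfolding D_def leibniz_def by (intro continuous_intros)
  ultimately obtain \<tau> where \<tau>: "0 \<le> \<tau>" "\<tau> \<le> t" "D \<tau> = 0"
    using IVT2'[of D t 0 0] t by auto
  define M where "M = mat n n (\<lambda>(i, j). (if i = j then 1 else 0) - \<tau> * q i j)"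
  have M: "M \<in> carrier_mat n n" by (simp add: M_def)
  have "Determinant.det M = 0" using \<tau>(3) by (simp add: D_def leibniz_eq_det M_def)
  then obtain z where z: "z \<in> carrier_vec n" "z \<noteq> 0\<^sub>v n" "M *\<^sub>v z = 0\<^sub>v n"
    using det_0_iff_vec_prod_zero[OF M] by blast
  have eq: "vec_index z i = \<tau> * (\<Sum>j = 0..<n. q i j * vec_index z j)" if i: "i < n" for i
  proof -
    have "0 = vec_index (M *\<^sub>v z) i" using z(3) i by simp
    also have "\<dots> = (\<Sum>j = 0..<n. ((if i = j then 1 else 0) - \<tau> * q i j) * vec_index z j)"
      using i z(1) by (simp add: M_def scalar_prod_def)
    also have "\<dots> = (\<Sum>j = 0..<n. (if i = j then vec_index z j else 0)) - \<tau> * (\<Sum>j = 0..<n. q i j * vec_index z j)"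
      unfolding sum_distrib_left sum_subtractf[symmetric] by (intro sum.cong) (auto simp: algebra_simps)
    finally show ?thesis using i by simp
  qed
  have \<tau>1: "\<tau> < 1" using \<tau>(2) t(2) by linarith
  have "0 \<le> vec_index z i" if "i < n" for i
    using q \<tau>(1) \<tau>1 _ that
    by (rule substochastic_minimum_principle[where z = "\<lambda>i. vec_index z i"]) (use eq in auto)
  moreover have "0 \<le> - (vec_index z i)" if "i < n" for i
    using q \<tau>(1) \<tau>1 _ that
    by (rule substochastic_minimum_principle[where z = "\<lambda>i. - (vec_index z i)"]) (use eq in \<open>auto simp: sum_negf\<close>)
  ultimately have "vec_index z i = 0" if "i < n" for i using that by force
  then have "z = 0\<^sub>v n" using z(1) by (intro eq_vecI) auto
  then show False using z(2) by simp
qed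

text \<open>
  The witness \<open>c\<close> is the \<open>k\<close>-th coordinate of the solution of \<open>z = b + t q z\<close>, the discounted payoff
  from state \<open>k\<close>. The minimum principle compares it with sub- and supersolutions \<open>u\<close>.
\<close>

lemma cramer_resolvent:
  fixes q :: "nat \<Rightarrow> nat \<Rightarrow> real"
  assumes q: "\<And>i j. i < n \<Longrightarrow> j < n \<Longrightarrow> 0 \<le> q i j" "\<And>i. i < n \<Longrightarrow> (\<Sum>j = 0..<n. q i j) = 1"
    and t: "0 \<le> t" "t < 1" and k: "k < n"
  defines "F \<equiv> (\<lambda>i j. (if i = j then 1 else 0) - t * q i j)"
  shows "\<exists>c. leibniz n (\<lambda>i j. if j = k then b i else F i j) = c * leibniz n F \<and>
    ((\<forall>i<n. u i \<le> b i + t * (\<Sum>j = 0..<n. q i j * u j)) \<longrightarrow> u k \<le> c) \<and>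
    ((\<forall>i<n. b i + t * (\<Sum>j = 0..<n. q i j * u j) \<le> u i) \<longrightarrow> c \<le> u k)"
proof -
  define M where "M = mat n n (\<lambda>(i, j). F i j)"
  have M: "M \<in> carrier_mat n n" by (simp add: M_def)
  have det: "Determinant.det M = leibniz n F" by (simp add: leibniz_eq_det M_def)
  then have "Determinant.det M \<noteq> 0" using leibniz_resolvent_pos[of n q t, OF q t] by (simp add: F_def)
  then have "M \<in> Units (ring_mat TYPE(real) n ())" by (rule det_non_zero_imp_unit[OF M])
  then obtain B where B: "B \<in> carrier_mat n n" "M * B = 1\<^sub>m n"
    by (auto simp: Units_def ring_mat_def)
  define z where "z = B *\<^sub>v vec n b"
  have z: "z \<in> carrier_vec n" using B by (simp add: z_def)
  have Mz: "M *\<^sub>v z = vec n b"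
    unfolding z_def using M B by (simp flip: assoc_mult_mat_vec[of M n n B n])
  have eq: "vec_index z i = b i + t * (\<Sum>j = 0..<n. q i j * vec_index z j)" if i: "i < n" for i
  proof -
    have "b i = vec_index (M *\<^sub>v z) i" using Mz i by simp
    also have "\<dots> = (\<Sum>j = 0..<n. F i j * vec_index z j)"
      using i z by (simp add: M_def scalar_prod_def)
    also have "\<dots> = (\<Sum>j = 0..<n. (if i = j then vec_index z j else 0)) - t * (\<Sum>j = 0..<n. q i j * vec_index z j)"
      unfolding sum_distrib_left sum_subtractf[symmetric] F_def by (intro sum.cong) (auto simp: algebra_simps)
    finally show ?thesis using i by simp
  qed
  have "replace_col M (M *\<^sub>v z) k = mat n n (\<lambda>(i, j). if j = k then b i else F i j)"
    unfolding Mz by (rule eq_matI) (auto simp: replace_col_def M_def)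
  then have cr: "leibniz n (\<lambda>i j. if j = k then b i else F i j) = vec_index z k * leibniz n F"
    using cramer_lemma_mat[OF M z k] det by (simp add: leibniz_eq_det)
  have up: "u k \<le> vec_index z k" if u: "\<forall>i<n. u i \<le> b i + t * (\<Sum>j = 0..<n. q i j * u j)"
  proof -
    have "0 \<le> vec_index z k - u k"
      using q t _ k
    proof (rule substochastic_minimum_principle[where z = "\<lambda>i. vec_index z i - u i"])
      fix i assume i: "i < n"
      have "t * (\<Sum>j = 0..<n. q i j * (vec_index z j - u j)) = vec_index z i - (b i + t * (\<Sum>j = 0..<n. q i j * u j))"
        using eq[OF i] by (simp add: right_diff_distrib sum_subtractf)
      then show "t * (\<Sum>j = 0..<n. q i j * (vec_index z j - u j)) \<le> vec_index z i - u i" using u i by auto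
    qed
    then show ?thesis by simp
  qed
  have dn: "vec_index z k \<le> u k" if u: "\<forall>i<n. b i + t * (\<Sum>j = 0..<n. q i j * u j) \<le> u i"
  proof -
    have "0 \<le> u k - vec_index z k"
      using q t _ k
    proof (rule substochastic_minimum_principle[where z = "\<lambda>i. u i - vec_index z i"])
      fix i assume i: "i < n"
      have "t * (\<Sum>j = 0..<n. q i j * (u j - vec_index z j)) = (b i + t * (\<Sum>j = 0..<n. q i j * u j)) - vec_index z i"
        using eq[OF i] by (simp add: right_diff_distrib sum_subtractf)
      then show "t * (\<Sum>j = 0..<n. q i j * (u j - vec_index z j)) \<le> u i - vec_index z i" using u i by auto
    qed
    then show ?thesis by simp
  qed
  show ?thesis using cr up dn by (intro exI[of _ "vec_index z k"]) blast
qed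

section \<open>Values of discounted games\<close>

definition saddle :: "'i set \<Rightarrow> 'j set \<Rightarrow> ('i \<Rightarrow> 'j \<Rightarrow> real) \<Rightarrow> real \<Rightarrow> ('i \<Rightarrow> real) \<Rightarrow> ('j \<Rightarrow> real) \<Rightarrow> bool" where
  "saddle I J C w x y \<longleftrightarrow> mixed I x \<and> mixed J y \<and>
     (\<forall>j\<in>J. w \<le> (\<Sum>i\<in>I. x i * C i j)) \<and> (\<forall>i\<in>I. (\<Sum>j\<in>J. C i j * y j) \<le> w)"

lemma saddle_mono:
  assumes a: "saddle I J C w x y" and b: "saddle I J D w' x' y'"
    and le: "\<And>i j. i \<in> I \<Longrightarrow> j \<in> J \<Longrightarrow> C i j \<le> D i j + k"
  shows "w \<le> w' + k"
proof -
  have x: "mixed I x" and y': "mixed J y'" using a b by (auto simp: saddle_def)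
  have "w = (\<Sum>j\<in>J. y' j * w)" using mixed_sum_const[OF y'] by simp
  also have "\<dots> \<le> (\<Sum>j\<in>J. y' j * (\<Sum>i\<in>I. x i * C i j))"
    using a by (intro mixed_sum_mono[OF y']) (auto simp: saddle_def)
  also have "\<dots> \<le> (\<Sum>j\<in>J. y' j * (\<Sum>i\<in>I. x i * (D i j + k)))"
    using le by (intro mixed_sum_mono[OF y'] mixed_sum_mono[OF x]) auto
  also have "\<dots> = (\<Sum>j\<in>J. y' j * ((\<Sum>i\<in>I. x i * D i j) + k))"
    using mixed_sum_const[OF x, of k] by (simp add: distrib_left sum.distrib)
  also have "\<dots> = (\<Sum>j\<in>J. y' j * (\<Sum>i\<in>I. x i * D i j)) + k"
    using mixed_sum_const[OF y', of k] by (simp add: distrib_left sum.distrib)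
  also have "(\<Sum>j\<in>J. y' j * (\<Sum>i\<in>I. x i * D i j)) = (\<Sum>i\<in>I. x i * (\<Sum>j\<in>J. D i j * y' j))"
    by (simp add: sum_distrib_left mult_ac) (rule sum.swap)
  also have "\<dots> \<le> (\<Sum>i\<in>I. x i * w')"
    using b by (intro mixed_sum_mono[OF x]) (auto simp: saddle_def)
  also have "\<dots> = w'" using mixed_sum_const[OF x] .
  finally show ?thesis by simp
qed

definition transition_prob :: "stochastic_game \<Rightarrow> nat \<Rightarrow> nat \<Rightarrow> nat \<Rightarrow> nat \<Rightarrow> real" where
  "transition_prob G s a b s' = pmf (transition G s a b) s'"

text \<open>
  The one-stage game of Shapley, with weight \<open>l\<close> on the present stage and continuation values \<open>u\<close>.
\<close>

definition shapley_entry :: "stochastic_game \<Rightarrow> real \<Rightarrow> (nat \<Rightarrow> real) \<Rightarrow> nat \<Rightarrow> nat \<Rightarrow> nat \<Rightarrow> real" where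
  "shapley_entry G l u s a b =
     l * reward G s a b + (1 - l) * (\<Sum>s'\<in>states G. transition_prob G s a b s' * u s')"

definition reward_bound :: "stochastic_game \<Rightarrow> real" where
  "reward_bound G = (\<Sum>s\<in>states G. \<Sum>a\<in>actions1 G s. \<Sum>b\<in>actions2 G s. \<bar>reward G s a b\<bar>)"

definition disc_fixpoint :: "stochastic_game \<Rightarrow> real \<Rightarrow> (nat \<Rightarrow> real) \<Rightarrow> bool" where
  "disc_fixpoint G l u \<longleftrightarrow> (\<forall>s\<in>states G. \<bar>u s\<bar> \<le> reward_bound G \<and>
     (\<exists>x y. saddle (actions1 G s) (actions2 G s) (shapley_entry G l u s) (u s) x y))"

definition disc_value :: "stochastic_game \<Rightarrow> real \<Rightarrow> nat \<Rightarrow> real" where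
  "disc_value G l = (SOME u. disc_fixpoint G l u)"

lemma reward_bound_nonneg: "0 \<le> reward_bound G"
  unfolding reward_bound_def by (intro sum_nonneg) auto

lemma reward_le_bound:
  assumes "s \<in> states G" "a \<in> actions1 G s" "b \<in> actions2 G s"
  shows "\<bar>reward G s a b\<bar> \<le> reward_bound G"
proof -
  have "\<bar>reward G s a b\<bar> \<le> (\<Sum>b\<in>actions2 G s. \<bar>reward G s a b\<bar>)"
    using assms finite_actions by (intro member_le_sum) auto
  also have "\<dots> \<le> (\<Sum>a\<in>actions1 G s. \<Sum>b\<in>actions2 G s. \<bar>reward G s a b\<bar>)"
    using assms finite_actions by (intro member_le_sum[of a]) (auto intro: sum_nonneg)
  also have "\<dots> \<le> reward_bound G"
    unfolding reward_bound_def using assms finite_actions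
    by (intro member_le_sum[of s]) (auto intro: sum_nonneg)
  finally show ?thesis .
qed

context
  fixes G
  assumes wf: "wf_game G"
begin

lemma nonempty_actions: "s \<in> states G \<Longrightarrow> actions1 G s \<noteq> {}" "s \<in> states G \<Longrightarrow> actions2 G s \<noteq> {}"
  using wf by (auto simp: wf_game_def actions1_def actions2_def)

lemma transition_prob_mixed:
  assumes "s \<in> states G" "a \<in> actions1 G s" "b \<in> actions2 G s"
  shows "mixed (states G) (transition_prob G s a b)"
proof -
  have "set_pmf (transition G s a b) \<subseteq> states G" using wf assms by (simp add: wf_game_def)
  then show ?thesis
    using sum_pmf_eq_1[OF finite_actions(3)] by (simp add: mixed_def transition_prob_def)
qed

lemma shapley_saddle_exists:
  assumes "s \<in> states G"
  shows "\<exists>w x y. saddle (actions1 G s) (actions2 G s) (shapley_entry G l u s) w x y"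
  unfolding saddle_def using nonempty_actions[OF assms]
  by (intro matrix_game_value finite_actions)

lemma shapley_entry_mono:
  assumes s: "s \<in> states G" "a \<in> actions1 G s" "b \<in> actions2 G s"
    and l: "l < 1" and u: "\<And>s. s \<in> states G \<Longrightarrow> u' s \<le> u s"
  shows "shapley_entry G l u' s a b \<le> shapley_entry G l u s a b"
  unfolding shapley_entry_def using l u
  by (intro add_left_mono mult_left_mono mixed_sum_mono[OF transition_prob_mixed[OF s]]) auto

lemma shapley_entry_diff:
  assumes s: "s \<in> states G" "a \<in> actions1 G s" "b \<in> actions2 G s"
    and l: "l < 1" and u: "\<And>s. s \<in> states G \<Longrightarrow> \<bar>u s\<bar> \<le> reward_bound G"
    and d: "\<And>s. s \<in> states G \<Longrightarrow> \<bar>u' s - u s\<bar> \<le> d"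
  shows "\<bar>shapley_entry G l u' s a b - shapley_entry G m u s a b\<bar> \<le>
    2 * reward_bound G * \<bar>l - m\<bar> + (1 - l) * d"
proof -
  note mx = transition_prob_mixed[OF s]
  let ?P = "\<lambda>u. \<Sum>s'\<in>states G. transition_prob G s a b s' * u s'"
  have "\<bar>?P (\<lambda>s. u' s - u s)\<bar> \<le> d" using d by (rule mixed_sum_abs_le[OF mx])
  then have 1: "\<bar>(1 - l) * ?P (\<lambda>s. u' s - u s)\<bar> \<le> (1 - l) * d" using l by (simp add: abs_mult)
  have 2: "\<bar>(m - l) * ?P u\<bar> \<le> \<bar>l - m\<bar> * reward_bound G"
    unfolding abs_mult abs_minus_commute[of m l]
    using mixed_sum_abs_le[OF mx u] by (intro mult_left_mono) auto
  have 3: "\<bar>(l - m) * reward G s a b\<bar> \<le> \<bar>l - m\<bar> * reward_bound G"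
    unfolding abs_mult using reward_le_bound[OF s] by (intro mult_left_mono) auto
  have D: "?P (\<lambda>s. u' s - u s) = ?P u' - ?P u" by (simp add: right_diff_distrib sum_subtractf)
  have "shapley_entry G l u' s a b - shapley_entry G m u s a b =
      (l - m) * reward G s a b + (m - l) * ?P u + (1 - l) * ?P (\<lambda>s. u' s - u s)"
    unfolding shapley_entry_def D by (simp add: algebra_simps)
  then have "\<bar>shapley_entry G l u' s a b - shapley_entry G m u s a b\<bar> \<le>
      \<bar>l - m\<bar> * reward_bound G + \<bar>l - m\<bar> * reward_bound G + (1 - l) * d"
    using 1 2 3 by linarith
  then show ?thesis by (simp add: algebra_simps)
qed

text \<open>
  The operator \<open>V\<close> that maps continuation values to the values of the one-stage games is monotone and
  maps functions bounded by the reward bound to such functions. So the pointwise supremum of the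
  functions \<open>u \<le> V u\<close> is a fixed point, as in the theorem of Knaster and Tarski.
\<close>

lemma disc_fixpoint_exists:
  assumes l: "0 < l" "l < 1"
  shows "\<exists>u. disc_fixpoint G l u"
proof -
  let ?C = "reward_bound G"
  define V where "V u s = (SOME w. \<exists>x y. saddle (actions1 G s) (actions2 G s) (shapley_entry G l u s) w x y)" for u s
  have V: "\<exists>x y. saddle (actions1 G s) (actions2 G s) (shapley_entry G l u s) (V u s) x y"
    if "s \<in> states G" for u s
    unfolding V_def by (rule someI_ex) (rule shapley_saddle_exists[OF that])
  have V_mono: "V u' s \<le> V u s"
    if s: "s \<in> states G" and u: "\<And>s. s \<in> states G \<Longrightarrow> \<bar>u s\<bar> \<le> ?C" "\<And>s. s \<in> states G \<Longrightarrow> u' s \<le> u s"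
    for u u' s
  proof -
    obtain x y where a: "saddle (actions1 G s) (actions2 G s) (shapley_entry G l u' s) (V u' s) x y"
      using V[OF s] by blast
    obtain x' y' where b: "saddle (actions1 G s) (actions2 G s) (shapley_entry G l u s) (V u s) x' y'"
      using V[OF s] by blast
    have "V u' s \<le> V u s + 0"
      using shapley_entry_mono[OF s _ _ l(2), of _ _ u' u] u(2) by (intro saddle_mono[OF a b]) auto
    then show ?thesis by simp
  qed
  have V_bound: "\<bar>V u s\<bar> \<le> ?C" if s: "s \<in> states G" and u: "\<And>s. s \<in> states G \<Longrightarrow> \<bar>u s\<bar> \<le> ?C" for u s
  proof -
    obtain x y where a: "saddle (actions1 G s) (actions2 G s) (shapley_entry G l u s) (V u s) x y"
      using V[OF s] by blast
    then have c: "saddle (actions1 G s) (actions2 G s) (\<lambda>_ _. c) c x y" for c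
      using mixed_sum_const[of "actions1 G s" x c] mixed_sum_const[of "actions2 G s" y c]
      by (auto simp: saddle_def mult.commute)
    have e: "\<bar>shapley_entry G l u s a b\<bar> \<le> ?C" if ab: "a \<in> actions1 G s" "b \<in> actions2 G s" for a b
    proof -
      note mx = transition_prob_mixed[OF s ab]
      let ?P = "\<Sum>s'\<in>states G. transition_prob G s a b s' * u s'"
      have "\<bar>?P\<bar> \<le> ?C" using u by (rule mixed_sum_abs_le[OF mx])
      then have "\<bar>(1 - l) * ?P\<bar> \<le> (1 - l) * ?C" using l by (simp add: abs_mult)
      moreover have "\<bar>l * reward G s a b\<bar> \<le> l * ?C" using l reward_le_bound[OF s ab] by (simp add: abs_mult)
      moreover have "l * ?C + (1 - l) * ?C = ?C" by (simp add: algebra_simps)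
      ultimately show ?thesis unfolding shapley_entry_def by linarith
    qed
    have "V u s \<le> ?C + 0" using e by (intro saddle_mono[OF a c]) (auto simp: abs_le_iff)
    moreover have "- ?C \<le> V u s + 0" using e by (intro saddle_mono[OF c a]) (auto simp: abs_le_iff minus_le_iff)
    ultimately show ?thesis by (simp add: abs_le_iff)
  qed
  define W where "W = {u. \<forall>s\<in>states G. \<bar>u s\<bar> \<le> ?C \<and> u s \<le> V u s}"
  have W0: "(\<lambda>_. - ?C) \<in> W"
  proof -
    have "- ?C \<le> V (\<lambda>_. - ?C) s" if "s \<in> states G" for s
      using V_bound[OF that, of "\<lambda>_. - ?C"] reward_bound_nonneg by (simp add: abs_le_iff)
    then show ?thesis using reward_bound_nonneg by (simp add: W_def)
  qed
  define U where "U s = Sup ((\<lambda>u. u s) ` W)" for s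
  have bdd: "bdd_above ((\<lambda>u. u s) ` W)" if "s \<in> states G" for s
    using that by (auto simp: W_def bdd_above_def abs_le_iff)
  have U_upper: "u s \<le> U s" if "u \<in> W" "s \<in> states G" for u s
    unfolding U_def using that bdd by (intro cSup_upper) auto
  have U_least: "U s \<le> c" if "\<And>u. u \<in> W \<Longrightarrow> u s \<le> c" for s c
    unfolding U_def using W0 that by (intro cSup_least) auto
  have U_bound: "\<bar>U s\<bar> \<le> ?C" if "s \<in> states G" for s
  proof -
    have "U s \<le> ?C" using that by (intro U_least) (auto simp: W_def abs_le_iff)
    then show ?thesis using U_upper[OF W0 that] by (simp add: abs_le_iff)
  qed
  have U_le: "U s \<le> V U s" if s: "s \<in> states G" for s
  proof (rule U_least)
    fix u assume u: "u \<in> W"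
    then have "u s \<le> V u s" using s by (simp add: W_def)
    also have "\<dots> \<le> V U s" using U_bound U_upper[OF u] by (intro V_mono[OF s])
    finally show "u s \<le> V U s" .
  qed
  \<comment> \<open>As \<open>V U\<close> is again a subsolution, it is below the supremum \<open>U\<close>.\<close>
  have "V U \<in> W"
  proof -
    have "V U s \<le> V (V U) s" if "s \<in> states G" for s
      using V_bound U_bound U_le that by (intro V_mono) auto
    then show ?thesis using V_bound U_bound by (simp add: W_def)
  qed
  then have eq: "V U s = U s" if "s \<in> states G" for s
    using U_le[OF that] U_upper[OF _ that] by (simp add: antisym)
  have "\<bar>U s\<bar> \<le> ?C \<and> (\<exists>x y. saddle (actions1 G s) (actions2 G s) (shapley_entry G l U s) (U s) x y)"
    if "s \<in> states G" for s
    using V[OF that, of U] U_bound[OF that] by (simp only: eq[OF that])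
  then show ?thesis unfolding disc_fixpoint_def by blast
qed

lemma disc_value:
  assumes "0 < l" "l < 1"
  shows "disc_fixpoint G l (disc_value G l)"
  unfolding disc_value_def using disc_fixpoint_exists[OF assms] by (rule someI_ex)

lemma disc_value_bound: "0 < l \<Longrightarrow> l < 1 \<Longrightarrow> s \<in> states G \<Longrightarrow> \<bar>disc_value G l s\<bar> \<le> reward_bound G"
  using disc_value by (simp add: disc_fixpoint_def)

text \<open>
  The values are compared where their distance \<open>d\<close> is largest. Changing the weight moves the one-stage payoffs
  by at most \<open>2 C \<bar>l - m\<bar>\<close>, changing the continuation values by at most \<open>(1 - l) d\<close>; hence
  \<open>l d \<le> 2 C \<bar>l - m\<bar>\<close>.
\<close>

lemma disc_value_diff:
  assumes l: "0 < l" "l < 1" and m: "0 < m" "m < 1" and s: "s \<in> states G"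
  shows "\<bar>disc_value G l s - disc_value G m s\<bar> \<le> 2 * reward_bound G / l * \<bar>l - m\<bar>"
proof -
  let ?u = "disc_value G l" and ?w = "disc_value G m" and ?C = "reward_bound G"
  define d where "d = Max ((\<lambda>s. \<bar>?u s - ?w s\<bar>) ` states G)"
  have d: "\<bar>?u s - ?w s\<bar> \<le> d" if "s \<in> states G" for s
    unfolding d_def using that finite_actions(3) by (intro Max_ge) auto
  have bound: "\<bar>?u s - ?w s\<bar> \<le> 2 * ?C * \<bar>l - m\<bar> + (1 - l) * d" if s: "s \<in> states G" for s
  proof -
    obtain x y where a: "saddle (actions1 G s) (actions2 G s) (shapley_entry G l ?u s) (?u s) x y"
      using disc_value[OF l] s by (auto simp: disc_fixpoint_def)
    obtain x' y' where b: "saddle (actions1 G s) (actions2 G s) (shapley_entry G m ?w s) (?w s) x' y'"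
      using disc_value[OF m] s by (auto simp: disc_fixpoint_def)
    have e: "\<bar>shapley_entry G l ?u s i j - shapley_entry G m ?w s i j\<bar> \<le> 2 * ?C * \<bar>l - m\<bar> + (1 - l) * d"
      if "i \<in> actions1 G s" "j \<in> actions2 G s" for i j
      using disc_value_bound[OF m] d by (intro shapley_entry_diff[OF s that l(2)])
    have "?u s \<le> ?w s + (2 * ?C * \<bar>l - m\<bar> + (1 - l) * d)"
    proof (rule saddle_mono[OF a b])
      fix i j assume "i \<in> actions1 G s" "j \<in> actions2 G s"
      from e[OF this] show "shapley_entry G l ?u s i j \<le> shapley_entry G m ?w s i j + (2 * ?C * \<bar>l - m\<bar> + (1 - l) * d)"
        by linarith
    qed
    moreover have "?w s \<le> ?u s + (2 * ?C * \<bar>l - m\<bar> + (1 - l) * d)"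
    proof (rule saddle_mono[OF b a])
      fix i j assume "i \<in> actions1 G s" "j \<in> actions2 G s"
      from e[OF this] show "shapley_entry G m ?w s i j \<le> shapley_entry G l ?u s i j + (2 * ?C * \<bar>l - m\<bar> + (1 - l) * d)"
        by linarith
    qed
    ultimately show ?thesis by (simp add: abs_le_iff algebra_simps)
  qed
  have "d \<in> (\<lambda>s. \<bar>?u s - ?w s\<bar>) ` states G"
    unfolding d_def using s finite_actions(3) by (intro Max_in) auto
  then have "d \<le> 2 * ?C * \<bar>l - m\<bar> + (1 - l) * d" using bound by auto
  then have "l * d \<le> 2 * ?C * \<bar>l - m\<bar>" by (simp add: algebra_simps)
  then have "d \<le> 2 * ?C / l * \<bar>l - m\<bar>" using l by (simp add: field_simps)
  then show ?thesis using d[OF s] by linarith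
qed

lemma continuous_disc_value:
  assumes s: "s \<in> states G"
  shows "continuous_on {0<..<1} (\<lambda>l. disc_value G l s)"
  unfolding continuous_on_iff
proof (intro ballI allI impI)
  fix l e :: real assume l: "l \<in> {0<..<1}" and e: "0 < e"
  define c where "c = 2 * reward_bound G / l"
  have c: "0 \<le> c" using l reward_bound_nonneg by (simp add: c_def)
  show "\<exists>d>0. \<forall>m\<in>{0<..<1}. dist m l < d \<longrightarrow> dist (disc_value G m s) (disc_value G l s) < e"
  proof (intro exI[of _ "e / (c + 1)"] conjI ballI impI)
    show "0 < e / (c + 1)" using e c by simp
    fix m :: real assume m: "m \<in> {0<..<1}" "dist m l < e / (c + 1)"
    have "\<bar>disc_value G l s - disc_value G m s\<bar> \<le> c * \<bar>l - m\<bar>"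
      using disc_value_diff[of l m s] l m(1) s by (simp add: c_def)
    also have "\<dots> \<le> c * (e / (c + 1))"
      using m(2) c by (intro mult_left_mono) (auto simp: dist_real_def)
    also have "\<dots> < e" using c e by (simp add: field_simps)
    finally show "dist (disc_value G m s) (disc_value G l s) < e" by (simp add: dist_real_def abs_minus_commute)
  qed
qed

end

section \<open>The discounted value as a root of an auxiliary matrix game\<close>

lemma mixed_PiE:
  fixes n :: nat
  assumes "\<And>i. finite (A i)" "\<And>i. i < n \<Longrightarrow> mixed (A i) (x i)"
  shows "mixed (PiE {0..<n} A) (\<lambda>f. \<Prod>i = 0..<n. x i (f i))"
proof -
  have "(\<Sum>f\<in>PiE {0..<n} A. \<Prod>i = 0..<n. x i (f i)) = (\<Prod>i = 0..<n. \<Sum>a\<in>A i. x i a)"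
    by (rule prod_sum_PiE[symmetric]) (simp_all add: assms(1))
  also have "\<dots> = 1" using assms(2) by (intro prod.neutral) (auto simp: mixed_def)
  finally show ?thesis using assms(2) by (auto simp: mixed_def PiE_iff intro!: prod_nonneg)
qed

text \<open>
  The denominator and the numerator in Cramer's rule for the discounted payoff with transition matrix
  \<open>P\<close> and payoff vector \<open>R\<close>.
\<close>

definition resolvent_det :: "nat \<Rightarrow> real \<Rightarrow> (nat \<Rightarrow> nat \<Rightarrow> real) \<Rightarrow> real" where
  "resolvent_det n l P = leibniz n (\<lambda>i j. (if i = j then 1 else 0) - (1 - l) * P i j)"

definition payoff_det :: "nat \<Rightarrow> nat \<Rightarrow> real \<Rightarrow> (nat \<Rightarrow> nat \<Rightarrow> real) \<Rightarrow> (nat \<Rightarrow> real) \<Rightarrow> real" where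
  "payoff_det n k l P R =
     leibniz n (\<lambda>i j. if j = k then l * R i else (if i = j then 1 else 0) - (1 - l) * P i j)"

text \<open>
  Both determinants are averages over pure choices, so their mixture is the pair of determinants of the
  averaged matrix. Their quotient is the discounted payoff against which \<open>u\<close> is a sub- or
  supersolution.
\<close>

lemma product_mixture_sign:
  fixes P :: "nat \<Rightarrow> 'a \<Rightarrow> nat \<Rightarrow> real" and R :: "nat \<Rightarrow> 'a \<Rightarrow> real" and u :: "nat \<Rightarrow> real"
  assumes A: "\<And>i. finite (A i)" and x: "\<And>i. i < n \<Longrightarrow> mixed (A i) (x i)"
    and P: "\<And>i a. i < n \<Longrightarrow> a \<in> A i \<Longrightarrow> mixed {0..<n} (P i a)"
    and l: "0 < l" "l < 1" and k: "k < n"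
  defines "S \<equiv> (\<Sum>f\<in>PiE {0..<n} A. (\<Prod>i = 0..<n. x i (f i)) *
      (payoff_det n k l (\<lambda>i. P i (f i)) (\<lambda>i. R i (f i)) - u k * resolvent_det n l (\<lambda>i. P i (f i))))"
    and "v \<equiv> \<lambda>i. \<Sum>a\<in>A i. x i a * (l * R i a + (1 - l) * (\<Sum>j = 0..<n. P i a j * u j))"
  shows "(\<forall>i<n. u i \<le> v i) \<longrightarrow> 0 \<le> S" and "(\<forall>i<n. v i \<le> u i) \<longrightarrow> S \<le> 0"
proof -
  define q where "q i j = (\<Sum>a\<in>A i. x i a * P i a j)" for i j
  define b where "b i = l * (\<Sum>a\<in>A i. x i a * R i a)" for i
  let ?w = "\<lambda>f. \<Prod>i = 0..<n. x i (f i)"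
  have q: "0 \<le> q i j" if "i < n" "j < n" for i j
    unfolding q_def using x[OF that(1)] P[OF that(1)] that(2)
    by (intro sum_nonneg mult_nonneg_nonneg) (auto simp: mixed_def)
  have q1: "(\<Sum>j = 0..<n. q i j) = 1" if i: "i < n" for i
  proof -
    have "(\<Sum>j = 0..<n. q i j) = (\<Sum>a\<in>A i. x i a * (\<Sum>j = 0..<n. P i a j))"
      unfolding q_def sum_distrib_left by (rule sum.swap)
    also have "\<dots> = (\<Sum>a\<in>A i. x i a * 1)" using P[OF i] by (intro sum.cong) (auto simp: mixed_def)
    finally show ?thesis using mixed_sum_const[OF x[OF i], of 1] by simp
  qed
  have lin: "(\<Sum>a\<in>A i. x i a * (c - (1 - l) * P i a j)) = c - (1 - l) * q i j" if "i < n" for c i j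
    using mixed_sum_const[OF x[OF that], of c]
    by (simp add: q_def right_diff_distrib sum_subtractf sum_distrib_left mult_ac)
  have D0: "(\<Sum>f\<in>PiE {0..<n} A. ?w f * resolvent_det n l (\<lambda>i. P i (f i))) = resolvent_det n l q"
  proof -
    have "(\<Sum>f\<in>PiE {0..<n} A. ?w f * resolvent_det n l (\<lambda>i. P i (f i))) =
        leibniz n (\<lambda>i j. \<Sum>a\<in>A i. x i a * ((if i = j then 1 else 0) - (1 - l) * P i a j))"
      unfolding resolvent_det_def by (rule leibniz_multilinear[OF A, symmetric])
    also have "\<dots> = resolvent_det n l q"
      unfolding resolvent_det_def by (rule leibniz_cong) (rule lin)
    finally show ?thesis .
  qed
  have D1: "(\<Sum>f\<in>PiE {0..<n} A. ?w f * payoff_det n k l (\<lambda>i. P i (f i)) (\<lambda>i. R i (f i))) =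
      leibniz n (\<lambda>i j. if j = k then b i else (if i = j then 1 else 0) - (1 - l) * q i j)"
  proof -
    have "(\<Sum>f\<in>PiE {0..<n} A. ?w f * payoff_det n k l (\<lambda>i. P i (f i)) (\<lambda>i. R i (f i))) =
        leibniz n (\<lambda>i j. \<Sum>a\<in>A i. x i a * (if j = k then l * R i a else (if i = j then 1 else 0) - (1 - l) * P i a j))"
      unfolding payoff_det_def by (rule leibniz_multilinear[OF A, symmetric])
    also have "\<dots> = leibniz n (\<lambda>i j. if j = k then b i else (if i = j then 1 else 0) - (1 - l) * q i j)"
    proof (rule leibniz_cong)
      fix i j assume ij: "i < n" "j < n"
      show "(\<Sum>a\<in>A i. x i a * (if j = k then l * R i a else (if i = j then 1 else 0) - (1 - l) * P i a j)) =
        (if j = k then b i else (if i = j then 1 else 0) - (1 - l) * q i j)"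
      proof (cases "j = k")
        case True then show ?thesis by (simp add: b_def sum_distrib_left mult_ac)
      next
        case False then show ?thesis using lin[OF ij(1), of "if i = j then 1 else 0" j] by (simp only: if_False)
      qed
    qed
    finally show ?thesis .
  qed
  have t: "0 \<le> 1 - l" "1 - l < 1" using l by auto
  obtain c where c: "leibniz n (\<lambda>i j. if j = k then b i else (if i = j then 1 else 0) - (1 - l) * q i j) =
      c * resolvent_det n l q"
    "(\<forall>i<n. u i \<le> b i + (1 - l) * (\<Sum>j = 0..<n. q i j * u j)) \<longrightarrow> u k \<le> c"
    "(\<forall>i<n. b i + (1 - l) * (\<Sum>j = 0..<n. q i j * u j) \<le> u i) \<longrightarrow> c \<le> u k"
    using cramer_resolvent[of n q "1 - l" k b u, OF q q1 t k] unfolding resolvent_det_def by blast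
  have v: "v i = b i + (1 - l) * (\<Sum>j = 0..<n. q i j * u j)" for i
  proof -
    have "(\<Sum>j = 0..<n. q i j * u j) = (\<Sum>a\<in>A i. x i a * (\<Sum>j = 0..<n. P i a j * u j))"
      unfolding q_def sum_distrib_left sum_distrib_right
      by (subst sum.swap) (simp add: mult_ac)
    then show ?thesis
      by (simp add: v_def b_def distrib_left sum.distrib sum_distrib_left mult_ac)
  qed
  have "S = (c - u k) * resolvent_det n l q"
    unfolding S_def right_diff_distrib sum_subtractf D1 c(1)
    using D0 by (simp add: left_diff_distrib mult.left_commute[of _ "u k"] flip: sum_distrib_left)
  moreover have "0 < resolvent_det n l q"
    unfolding resolvent_det_def by (rule leibniz_resolvent_pos[of n q "1 - l", OF q q1 t])
  ultimately show "(\<forall>i<n. u i \<le> v i) \<longrightarrow> 0 \<le> S" "(\<forall>i<n. v i \<le> u i) \<longrightarrow> S \<le> 0"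
    using c(2,3) unfolding v by (auto simp: mult_le_0_iff)
qed

lemma sum_states: "(\<Sum>s\<in>states G. f s) = (\<Sum>j = 0..<nstates G. f (Suc j))"
  by (simp add: states_def sum.atLeast1_atMost_eq atLeast0LessThan)

text \<open>
  Pure stationary strategies. The state \<open>Suc i\<close> has the matrix index \<open>i\<close>.
\<close>

definition profiles1 :: "stochastic_game \<Rightarrow> (nat \<Rightarrow> nat) set" where
  "profiles1 G = PiE {0..<nstates G} (\<lambda>i. actions1 G (Suc i))"

definition profiles2 :: "stochastic_game \<Rightarrow> (nat \<Rightarrow> nat) set" where
  "profiles2 G = PiE {0..<nstates G} (\<lambda>i. actions2 G (Suc i))"

text \<open>
  The argument \<open>t\<close> is the pair of the discount weight and the candidate value.
\<close>

definition auxiliary_game :: "stochastic_game \<Rightarrow> nat \<Rightarrow> (nat \<Rightarrow> nat) \<Rightarrow> (nat \<Rightarrow> nat) \<Rightarrow> real \<times> real \<Rightarrow> real" where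
  "auxiliary_game G k f g t =
     payoff_det (nstates G) k (fst t) (\<lambda>i j. transition_prob G (Suc i) (f i) (g i) (Suc j))
       (\<lambda>i. reward G (Suc i) (f i) (g i)) -
     snd t * resolvent_det (nstates G) (fst t) (\<lambda>i j. transition_prob G (Suc i) (f i) (g i) (Suc j))"

lemma finite_profiles: "finite (profiles1 G)" "finite (profiles2 G)"
  by (auto simp: profiles1_def profiles2_def finite_actions intro: finite_PiE)

context
  fixes G
  assumes wf: "wf_game G"
begin

text \<open>
  The product of optimal stationary actions of the first player secures \<open>0\<close> at \<open>w = v\<close>, hence also for smaller \<open>w\<close>,
  since the denominators are positive. For larger \<open>w\<close>, the product of optimal
  actions of the second player keeps all payoffs strictly below \<open>0\<close>.
\<close>

lemma auxiliary_game_feasible_iff: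
  assumes l: "0 < l" "l < 1" and k: "k < nstates G"
  shows "(\<exists>X. mixed (profiles1 G) X \<and>
      (\<forall>g\<in>profiles2 G. 0 \<le> (\<Sum>f\<in>profiles1 G. X f * auxiliary_game G k f g (l, w)))) \<longleftrightarrow>
    w \<le> disc_value G l (Suc k)"
proof -
  let ?n = "nstates G" and ?u = "disc_value G l"
  have st: "Suc i \<in> states G" if "i < ?n" for i using that by (simp add: states_def)
  have "\<exists>x y. saddle (actions1 G (Suc i)) (actions2 G (Suc i)) (shapley_entry G l ?u (Suc i)) (?u (Suc i)) x y"
    if "i < ?n" for i
    using disc_value[OF wf l] st[OF that] by (simp add: disc_fixpoint_def)
  then obtain x y where sad: "\<And>i. i < ?n \<Longrightarrow> saddle (actions1 G (Suc i)) (actions2 G (Suc i))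
      (shapley_entry G l ?u (Suc i)) (?u (Suc i)) (x i) (y i)"
    by metis
  define X where "X f = (\<Prod>i = 0..<?n. x i (f i))" for f
  define Y where "Y g = (\<Prod>i = 0..<?n. y i (g i))" for g
  let ?A = "\<lambda>f g. auxiliary_game G k f g (l, ?u (Suc k))"
  let ?D = "\<lambda>f g. resolvent_det ?n l (\<lambda>i j. transition_prob G (Suc i) (f i) (g i) (Suc j))"
  have shift: "auxiliary_game G k f g (l, w) = ?A f g + (?u (Suc k) - w) * ?D f g" for f g
    by (simp add: auxiliary_game_def algebra_simps)
  have tp: "mixed {0..<?n} (\<lambda>j. transition_prob G (Suc i) a b (Suc j))"
    if "i < ?n" "a \<in> actions1 G (Suc i)" "b \<in> actions2 G (Suc i)" for i a b
    using transition_prob_mixed[OF wf st[OF that(1)] that(2,3)]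
    by (auto simp: mixed_def sum_states transition_prob_def)
  have Dpos: "0 < ?D f g" if f: "f \<in> profiles1 G" and g: "g \<in> profiles2 G" for f g
    unfolding resolvent_det_def
  proof (rule leibniz_resolvent_pos)
    have m: "mixed {0..<?n} (\<lambda>j. transition_prob G (Suc i) (f i) (g i) (Suc j))" if "i < ?n" for i
      using f g that by (intro tp) (auto simp: profiles1_def profiles2_def PiE_iff)
    show "0 \<le> transition_prob G (Suc i) (f i) (g i) (Suc j)" for i j by (simp add: transition_prob_def)
    show "(\<Sum>j = 0..<?n. transition_prob G (Suc i) (f i) (g i) (Suc j)) = 1" if "i < ?n" for i
      using m[OF that] by (simp add: mixed_def)
  qed (use l in auto)
  have X: "mixed (profiles1 G) X" unfolding profiles1_def X_def
    using sad by (intro mixed_PiE finite_actions) (simp add: saddle_def)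
  have Y: "mixed (profiles2 G) Y" unfolding profiles2_def Y_def
    using sad by (intro mixed_PiE finite_actions) (simp add: saddle_def)
  have XA: "0 \<le> (\<Sum>f\<in>profiles1 G. X f * ?A f g)" if g: "g \<in> profiles2 G" for g
  proof -
    have gi: "g i \<in> actions2 G (Suc i)" if "i < ?n" for i using g that by (auto simp: profiles2_def PiE_iff)
    have "0 \<le> (\<Sum>f\<in>PiE {0..<?n} (\<lambda>i. actions1 G (Suc i)). (\<Prod>i = 0..<?n. x i (f i)) *
      (payoff_det ?n k l (\<lambda>i j. transition_prob G (Suc i) (f i) (g i) (Suc j)) (\<lambda>i. reward G (Suc i) (f i) (g i))
        - ?u (Suc k) * ?D f g))"
    proof (rule product_mixture_sign(1)[where u = "\<lambda>i. ?u (Suc i)" and R = "\<lambda>i a. reward G (Suc i) a (g i)"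
          and P = "\<lambda>i a j. transition_prob G (Suc i) a (g i) (Suc j)", rule_format])
      fix i assume i: "i < ?n"
      show "mixed (actions1 G (Suc i)) (x i)" using sad[OF i] by (simp add: saddle_def)
      have "?u (Suc i) \<le> (\<Sum>a\<in>actions1 G (Suc i). x i a * shapley_entry G l ?u (Suc i) a (g i))"
        using sad[OF i] gi[OF i] by (simp add: saddle_def)
      then show "?u (Suc i) \<le> (\<Sum>a\<in>actions1 G (Suc i). x i a * (l * reward G (Suc i) a (g i) +
          (1 - l) * (\<Sum>j = 0..<?n. transition_prob G (Suc i) a (g i) (Suc j) * ?u (Suc j))))"
        by (simp add: shapley_entry_def sum_states)
    qed (use tp gi l k finite_actions in auto)
    then show ?thesis by (simp add: X_def profiles1_def auxiliary_game_def)
  qed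
  have YA: "(\<Sum>g\<in>profiles2 G. Y g * ?A f g) \<le> 0" if f: "f \<in> profiles1 G" for f
  proof -
    have fi: "f i \<in> actions1 G (Suc i)" if "i < ?n" for i using f that by (auto simp: profiles1_def PiE_iff)
    have "(\<Sum>g\<in>PiE {0..<?n} (\<lambda>i. actions2 G (Suc i)). (\<Prod>i = 0..<?n. y i (g i)) *
      (payoff_det ?n k l (\<lambda>i j. transition_prob G (Suc i) (f i) (g i) (Suc j)) (\<lambda>i. reward G (Suc i) (f i) (g i))
        - ?u (Suc k) * ?D f g)) \<le> 0"
    proof (rule product_mixture_sign(2)[where u = "\<lambda>i. ?u (Suc i)" and R = "\<lambda>i b. reward G (Suc i) (f i) b"
          and P = "\<lambda>i b j. transition_prob G (Suc i) (f i) b (Suc j)", rule_format])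
      fix i assume i: "i < ?n"
      show "mixed (actions2 G (Suc i)) (y i)" using sad[OF i] by (simp add: saddle_def)
      have "(\<Sum>b\<in>actions2 G (Suc i). shapley_entry G l ?u (Suc i) (f i) b * y i b) \<le> ?u (Suc i)"
        using sad[OF i] fi[OF i] by (simp add: saddle_def)
      then show "(\<Sum>b\<in>actions2 G (Suc i). y i b * (l * reward G (Suc i) (f i) b +
          (1 - l) * (\<Sum>j = 0..<?n. transition_prob G (Suc i) (f i) b (Suc j) * ?u (Suc j)))) \<le> ?u (Suc i)"
        by (simp add: shapley_entry_def sum_states mult.commute)
    qed (use tp fi l k finite_actions in auto)
    then show ?thesis by (simp add: Y_def profiles2_def auxiliary_game_def)
  qed
  show ?thesis
  proof
    assume w: "w \<le> ?u (Suc k)"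
    have "0 \<le> (\<Sum>f\<in>profiles1 G. X f * auxiliary_game G k f g (l, w))" if g: "g \<in> profiles2 G" for g
    proof -
      have "(\<Sum>f\<in>profiles1 G. X f * ?A f g) \<le> (\<Sum>f\<in>profiles1 G. X f * auxiliary_game G k f g (l, w))"
        unfolding shift using w Dpos g by (intro mixed_sum_mono[OF X]) (simp add: less_imp_le)
      then show ?thesis using XA[OF g] by linarith
    qed
    then show "\<exists>X. mixed (profiles1 G) X \<and>
      (\<forall>g\<in>profiles2 G. 0 \<le> (\<Sum>f\<in>profiles1 G. X f * auxiliary_game G k f g (l, w)))"
      using X by blast
  next
    assume "\<exists>X. mixed (profiles1 G) X \<and>
      (\<forall>g\<in>profiles2 G. 0 \<le> (\<Sum>f\<in>profiles1 G. X f * auxiliary_game G k f g (l, w)))"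
    then obtain Z where Z: "mixed (profiles1 G) Z"
      "\<And>g. g \<in> profiles2 G \<Longrightarrow> 0 \<le> (\<Sum>f\<in>profiles1 G. Z f * auxiliary_game G k f g (l, w))" by blast
    show "w \<le> ?u (Suc k)"
    proof (rule ccontr)
      assume w: "\<not> w \<le> ?u (Suc k)"
      have "0 \<le> (\<Sum>g\<in>profiles2 G. Y g * (\<Sum>f\<in>profiles1 G. Z f * auxiliary_game G k f g (l, w)))"
      proof (rule sum_nonneg)
        fix g assume g: "g \<in> profiles2 G"
        have "0 \<le> Y g" using Y g by (simp add: mixed_def)
        then show "0 \<le> Y g * (\<Sum>f\<in>profiles1 G. Z f * auxiliary_game G k f g (l, w))"
          using Z(2)[OF g] by (rule mult_nonneg_nonneg)
      qed
      also have "\<dots> = (\<Sum>f\<in>profiles1 G. Z f * (\<Sum>g\<in>profiles2 G. Y g * auxiliary_game G k f g (l, w)))"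
        unfolding sum_distrib_left by (subst sum.swap) (simp add: mult_ac)
      finally have ge: "0 \<le> (\<Sum>f\<in>profiles1 G. Z f * (\<Sum>g\<in>profiles2 G. Y g * auxiliary_game G k f g (l, w)))" .
      have neg: "0 < - (\<Sum>g\<in>profiles2 G. Y g * auxiliary_game G k f g (l, w))" if f: "f \<in> profiles1 G" for f
      proof -
        have "0 < (\<Sum>g\<in>profiles2 G. Y g * ?D f g)"
          using Dpos[OF f] finite_profiles by (intro mixed_sum_pos[OF Y]) auto
        then have "(?u (Suc k) - w) * (\<Sum>g\<in>profiles2 G. Y g * ?D f g) < 0"
          using w by (intro mult_neg_pos) auto
        moreover have "(\<Sum>g\<in>profiles2 G. Y g * auxiliary_game G k f g (l, w)) =
            (\<Sum>g\<in>profiles2 G. Y g * ?A f g) + (?u (Suc k) - w) * (\<Sum>g\<in>profiles2 G. Y g * ?D f g)"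
          unfolding shift by (simp add: distrib_left sum.distrib sum_distrib_left mult_ac)
        ultimately show ?thesis using YA[OF f] by linarith
      qed
      have "0 < (\<Sum>f\<in>profiles1 G. Z f * - (\<Sum>g\<in>profiles2 G. Y g * auxiliary_game G k f g (l, w)))"
        using neg finite_profiles by (intro mixed_sum_pos[OF Z(1)]) auto
      then show False using ge by (simp add: sum_negf)
    qed
  qed
qed

theorem disc_value_on_algebraic_curve:
  assumes r: "\<And>s a b. s \<in> states G \<Longrightarrow> a \<in> actions1 G s \<Longrightarrow> b \<in> actions2 G s \<Longrightarrow>
        algebraic (reward G s a b)"
    and p: "\<And>s a b s'. s \<in> states G \<Longrightarrow> a \<in> actions1 G s \<Longrightarrow> b \<in> actions2 G s \<Longrightarrow> s' \<in> states G \<Longrightarrow>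
        algebraic (pmf (transition G s a b) s')"
    and k: "k < nstates G"
  shows "\<exists>q. algebraic_coeffs q \<and> q \<noteq> 0 \<and> (\<forall>l\<in>{0<..<1}. bieval q l (disc_value G l (Suc k)) = 0)"
proof -
  let ?n = "nstates G"
  have aux: "(\<lambda>t. auxiliary_game G k f g t) \<in> alg_functions"
    if f: "f \<in> profiles1 G" and g: "g \<in> profiles2 G" for f g
  proof -
    have fg: "Suc i \<in> states G \<and> f i \<in> actions1 G (Suc i) \<and> g i \<in> actions2 G (Suc i)" if "i < ?n" for i
      using f g that by (auto simp: profiles1_def profiles2_def PiE_iff states_def)
    have sg: "algebraic (signof \<pi> :: real)" for \<pi> :: "nat \<Rightarrow> nat"
      by (rule rat_imp_algebraic) (simp add: sign_def)
    have one: "(\<lambda>t. 1 - fst t) \<in> alg_functions"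
      by (intro alg_functions_diff alg_functions_const alg_functions_fst) auto
    have e: "(\<lambda>t. (if i = j then 1 else 0) - (1 - fst t) * transition_prob G (Suc i) (f i) (g i) (Suc j)) \<in> alg_functions"
      if "i < ?n" "j < ?n" for i j
      using p[of "Suc i" "f i" "g i" "Suc j"] fg[OF that(1)] fg[OF that(2)] unfolding transition_prob_def
      by (intro alg_functions_diff alg_functions_mult alg_functions_const one) auto
    have pe: "\<pi> i < ?n" if "\<pi> permutes {0..<?n}" "i < ?n" for \<pi> i
      using permutes_in_image[OF that(1), of i] that(2) by auto
    have rd: "(\<lambda>t. resolvent_det ?n (fst t) (\<lambda>i j. transition_prob G (Suc i) (f i) (g i) (Suc j))) \<in> alg_functions"
      unfolding resolvent_det_def leibniz_def
      by (intro alg_functions_sum alg_functions_mult alg_functions_const alg_functions_prod sg e)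
        (auto intro: pe)
    have e': "(\<lambda>t. if j = k then fst t * reward G (Suc i) (f i) (g i)
        else (if i = j then 1 else 0) - (1 - fst t) * transition_prob G (Suc i) (f i) (g i) (Suc j)) \<in> alg_functions"
      if "i < ?n" "j < ?n" for i j
    proof (cases "j = k")
      case True
      have "(\<lambda>t. fst t * reward G (Suc i) (f i) (g i)) \<in> alg_functions"
        using r fg[OF that(1)] by (intro alg_functions_mult alg_functions_const alg_functions_fst) auto
      then show ?thesis using True by simp
    next
      case False
      then show ?thesis using e[OF that] by simp
    qed
    have pd: "(\<lambda>t. payoff_det ?n k (fst t) (\<lambda>i j. transition_prob G (Suc i) (f i) (g i) (Suc j))
       (\<lambda>i. reward G (Suc i) (f i) (g i))) \<in> alg_functions"
      unfolding payoff_det_def leibniz_def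
      by (intro alg_functions_sum alg_functions_mult alg_functions_const alg_functions_prod sg e')
        (auto intro: pe)
    show ?thesis unfolding auxiliary_game_def
      by (intro alg_functions_diff alg_functions_mult pd rd alg_functions_snd)
  qed
  \<comment> \<open>Instances of \<open>guarantee_rows\<close> at every \<open>t\<close>. Entries at functions that are no profiles are set to \<open>0\<close> so that every coefficient of every row is an algebraic function.\<close>
  define Rows :: "((nat \<Rightarrow> nat) option \<Rightarrow> real \<times> real \<Rightarrow> real) set" where
    "Rows = insert (\<lambda>k t. if k = None then -1 else 1)
       ((\<lambda>i k t. if k = Some i then 1 else 0) ` profiles1 G \<union>
        (\<lambda>g d t. case d of None \<Rightarrow> 0 | Some f \<Rightarrow> if f \<in> profiles1 G then auxiliary_game G k f g t else 0) ` profiles2 G)"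
  have inst: "(\<lambda>r k. r k t) ` Rows = guarantee_rows (profiles1 G) (profiles2 G)
      (\<lambda>f g. if f \<in> profiles1 G then auxiliary_game G k f g t else 0)" for t
    unfolding Rows_def guarantee_rows_def
    by (simp add: image_Un image_image if_distrib option.case_distrib cong: if_cong option.case_cong)
  have feas: "feasible (profiles1 G) ((\<lambda>r k. r k (l, w)) ` Rows) \<longleftrightarrow> w \<le> disc_value G l (Suc k)"
    if "l \<in> {0<..<1}" for l w
    unfolding inst feasible_guarantee_rows[OF finite_profiles(1)]
    using auxiliary_game_feasible_iff[of l k w] that k by simp
  have "\<exists>S. finite S \<and> S \<subseteq> alg_functions \<and> (\<forall>t t'. (\<forall>f\<in>S. sgn (f t) = sgn (f t')) \<longrightarrow>
     feasible (profiles1 G) ((\<lambda>r k. r k t) ` Rows) = feasible (profiles1 G) ((\<lambda>r k. r k t') ` Rows))"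
  proof (rule feasible_sign_determined)
    show "finite (profiles1 G)" by (rule finite_profiles)
    show "finite Rows" unfolding Rows_def using finite_profiles by simp
    show "ro d \<in> alg_functions" if "ro \<in> Rows" for ro d
    proof -
      have c: "(\<lambda>t. 0) \<in> alg_functions" "(\<lambda>t. 1) \<in> alg_functions" "(\<lambda>t. -1) \<in> alg_functions"
        by (intro alg_functions_const; simp)+
      have "(\<lambda>t. if f \<in> profiles1 G then auxiliary_game G k f g t else 0) \<in> alg_functions"
        if "g \<in> profiles2 G" for f g
        using aux[OF _ that, of f] c(1) by (cases "f \<in> profiles1 G") simp_all
      then show ?thesis using that c unfolding Rows_def by (cases d) auto
    qed
    show "(\<lambda>t. f t * g t - h t * m t) \<in> alg_functions"
      if "f \<in> alg_functions" "g \<in> alg_functions" "h \<in> alg_functions" "m \<in> alg_functions" for f g h m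
      using that by (intro alg_functions_diff alg_functions_mult)
  qed
  then obtain S where S: "finite S" "S \<subseteq> alg_functions"
    "\<And>t t'. (\<forall>f\<in>S. sgn (f t) = sgn (f t')) \<Longrightarrow>
     feasible (profiles1 G) ((\<lambda>r k. r k t) ` Rows) = feasible (profiles1 G) ((\<lambda>r k. r k t') ` Rows)"
    by blast
  show ?thesis
    by (rule boundary_on_algebraic_curve[where F = "\<lambda>t. feasible (profiles1 G) ((\<lambda>r k. r k t) ` Rows)", OF S feas])
qed

end

section \<open>The limiting average value\<close>

text \<open>
  Translates optimal weights of a matrix game into the mixed actions used by strategies.
\<close>

lemma pmf_of_mixed:
  assumes A: "finite A" and x: "mixed A x"
  shows "\<exists>p. set_pmf p \<subseteq> A \<and> (\<forall>a\<in>A. pmf p a = x a)"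
proof -
  define f where "f a = (if a \<in> A then x a else 0)" for a
  have nn: "0 \<le> f a" for a using x by (simp add: f_def mixed_def)
  have "(\<integral>\<^sup>+a. ennreal (f a) \<partial>count_space UNIV) = (\<Sum>a\<in>A. ennreal (f a))"
    using A by (intro nn_integral_count_space') (auto simp: f_def)
  also have "\<dots> = ennreal (\<Sum>a\<in>A. f a)" using nn by (intro sum_ennreal) auto
  also have "(\<Sum>a\<in>A. f a) = 1" using x by (simp add: f_def mixed_def)
  finally have pmf: "pmf (embed_pmf f) a = f a" for a
    using nn by (intro pmf_embed_pmf) auto
  then have "set_pmf (embed_pmf f) \<subseteq> A"
    by (auto simp: set_pmf_iff f_def split: if_splits)
  then show ?thesis using pmf by (intro exI[of _ "embed_pmf f"]) (simp add: f_def)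
qed

lemma mixed_pmf: "finite A \<Longrightarrow> set_pmf p \<subseteq> A \<Longrightarrow> mixed A (pmf p)"
  by (simp add: mixed_def sum_pmf_eq_1)

lemma expectation_finite_sum:
  fixes f :: "'a \<Rightarrow> real"
  assumes "finite A" "set_pmf p \<subseteq> A"
  shows "measure_pmf.expectation p f = (\<Sum>a\<in>A. pmf p a * f a)"
  using assms by (subst integral_measure_pmf_real[of A]) (auto simp: mult.commute)

lemma expectation_pair_finite_sum:
  fixes f :: "'a \<times> 'b \<Rightarrow> real"
  assumes "finite A" "finite B" "set_pmf p \<subseteq> A" "set_pmf q \<subseteq> B"
  shows "measure_pmf.expectation (pair_pmf p q) f = (\<Sum>a\<in>A. pmf p a * (\<Sum>b\<in>B. pmf q b * f (a, b)))"
proof -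
  have "measure_pmf.expectation (pair_pmf p q) f = (\<Sum>z\<in>A \<times> B. pmf (pair_pmf p q) z * f z)"
    using assms by (intro expectation_finite_sum) auto
  also have "\<dots> = (\<Sum>a\<in>A. \<Sum>b\<in>B. pmf (pair_pmf p q) (a, b) * f (a, b))"
    by (simp add: sum.cartesian_product)
  finally show ?thesis by (simp add: pmf_pair sum_distrib_left mult_ac)
qed

lemma expectation_next_position:
  assumes wf: "wf_game G" and \<mu>: "\<mu> \<in> strategies1 G" and \<nu>: "\<nu> \<in> strategies2 G" and s: "s \<in> states G"
  shows "measure_pmf.expectation (next_position G \<mu> \<nu> (h, s))
      (\<lambda>(h', s'). l * last_payoff \<rho> h' + (1 - l) * w s') =
    (\<Sum>a\<in>actions1 G s. pmf (\<mu> h s) a * (\<Sum>b\<in>actions2 G s. pmf (\<nu> h s) b *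
      (l * \<rho> s a b + (1 - l) * (\<Sum>s'\<in>states G. transition_prob G s a b s' * w s'))))"
proof -
  let ?f = "\<lambda>(h', s'). l * last_payoff \<rho> h' + (1 - l) * w s'"
  let ?F = "\<lambda>(a, b). map_pmf (\<lambda>s'. (h @ [(s, a, b)], s')) (transition G s a b)"
  note sup = supports[OF wf \<mu> \<nu> s, of h] and tr = transition_support[OF wf \<mu> \<nu> s]
  have "measure_pmf.expectation (next_position G \<mu> \<nu> (h, s)) ?f =
      measure_pmf.expectation (pair_pmf (\<mu> h s) (\<nu> h s)) (\<lambda>y. measure_pmf.expectation (?F y) ?f)"
    unfolding next_position_def prod.case
    using sup tr(2) by (intro expectation_bind_finite_support) (auto simp: subset_iff)
  also have "\<dots> = (\<Sum>a\<in>actions1 G s. pmf (\<mu> h s) a * (\<Sum>b\<in>actions2 G s. pmf (\<nu> h s) b *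
      measure_pmf.expectation (?F (a, b)) ?f))"
    using sup finite_actions by (intro expectation_pair_finite_sum) auto
  also have "\<dots> = (\<Sum>a\<in>actions1 G s. pmf (\<mu> h s) a * (\<Sum>b\<in>actions2 G s. pmf (\<nu> h s) b *
      (l * \<rho> s a b + (1 - l) * (\<Sum>s'\<in>states G. transition_prob G s a b s' * w s'))))"
  proof (intro sum.cong refl arg_cong2[where f = "(*)"])
    fix a b assume ab: "a \<in> actions1 G s" "b \<in> actions2 G s"
    have "measure_pmf.expectation (?F (a, b)) ?f =
        measure_pmf.expectation (transition G s a b) (\<lambda>s'. l * \<rho> s a b + (1 - l) * w s')"
      by (simp add: last_payoff_def)
    also have "\<dots> = (\<Sum>s'\<in>states G. transition_prob G s a b s' * (l * \<rho> s a b + (1 - l) * w s'))"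
      unfolding transition_prob_def
      using tr(1)[OF ab] finite_actions by (intro expectation_finite_sum) auto
    also have "\<dots> = l * \<rho> s a b + (1 - l) * (\<Sum>s'\<in>states G. transition_prob G s a b s' * w s')"
      using mixed_sum_const[OF transition_prob_mixed[OF wf s ab], of "l * \<rho> s a b"]
      by (simp add: distrib_left sum.distrib sum_distrib_left mult_ac)
    finally show "measure_pmf.expectation (?F (a, b)) ?f =
      l * \<rho> s a b + (1 - l) * (\<Sum>s'\<in>states G. transition_prob G s a b s' * w s')" .
  qed
  finally show ?thesis .
qed

lemma liminf_average_ge:
  fixes e :: "nat \<Rightarrow> real"
  assumes "\<And>\<tau>. real \<tau> * c - K \<le> (\<Sum>t<\<tau>. e t)"
  shows "ereal c \<le> liminf (\<lambda>\<tau>. ereal (1 / real (\<tau> + 1) * (\<Sum>t=0..\<tau>. e t)))"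
proof -
  have "(\<lambda>\<tau>. c - K * inverse (real (Suc \<tau>))) \<longlonglongrightarrow> c - K * 0"
    by (intro tendsto_intros LIMSEQ_inverse_real_of_nat)
  then have "(\<lambda>\<tau>. ereal (c - K * inverse (real (Suc \<tau>)))) \<longlonglongrightarrow> ereal c" by simp
  then have "liminf (\<lambda>\<tau>. ereal (c - K * inverse (real (Suc \<tau>)))) = ereal c"
    by (intro lim_imp_Liminf) auto
  moreover have "c - K * inverse (real (Suc \<tau>)) \<le> 1 / real (\<tau> + 1) * (\<Sum>t=0..\<tau>. e t)" for \<tau>
  proof -
    have "(\<Sum>t=0..\<tau>. e t) = (\<Sum>t<Suc \<tau>. e t)" by (simp add: atLeast0AtMost lessThan_Suc_atMost)
    then have "(real (Suc \<tau>) * c - K) / real (Suc \<tau>) \<le> (\<Sum>t=0..\<tau>. e t) / real (Suc \<tau>)"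
      using assms[of "Suc \<tau>"] by (intro divide_right_mono) auto
    moreover have "(real (Suc \<tau>) * c - K) / real (Suc \<tau>) = c - K * inverse (real (Suc \<tau>))"
      by (simp add: diff_divide_distrib divide_inverse[of K] del: of_nat_Suc)
    ultimately show ?thesis by simp
  qed
  then have "liminf (\<lambda>\<tau>. ereal (c - K * inverse (real (Suc \<tau>)))) \<le>
      liminf (\<lambda>\<tau>. ereal (1 / real (\<tau> + 1) * (\<Sum>t=0..\<tau>. e t)))"
    by (intro Liminf_mono always_eventually) (simp del: of_nat_Suc)
  ultimately show ?thesis by simp
qed

lemma liminf_average_le:
  fixes e :: "nat \<Rightarrow> real"
  assumes "\<And>\<tau>. real \<tau> * (- c) - K \<le> (\<Sum>t<\<tau>. - e t)"
  shows "liminf (\<lambda>\<tau>. ereal (1 / real (\<tau> + 1) * (\<Sum>t=0..\<tau>. e t))) \<le> ereal c"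
proof -
  let ?a = "\<lambda>\<tau>. ereal (1 / real (\<tau> + 1) * (\<Sum>t=0..\<tau>. e t))"
  have "ereal (- c) \<le> liminf (\<lambda>\<tau>. ereal (1 / real (\<tau> + 1) * (\<Sum>t=0..\<tau>. - e t)))"
    by (rule liminf_average_ge[OF assms])
  also have "(\<lambda>\<tau>. ereal (1 / real (\<tau> + 1) * (\<Sum>t=0..\<tau>. - e t))) = (\<lambda>\<tau>. - ?a \<tau>)"
    by (simp add: sum_negf)
  also have "liminf (\<lambda>\<tau>. - ?a \<tau>) = - limsup ?a" by (rule ereal_Liminf_uminus)
  finally have "- ereal c \<le> - limsup ?a" by simp
  then have "limsup ?a \<le> ereal c" by (simp only: ereal_minus_le_minus)
  then show ?thesis using Liminf_le_Limsup[of sequentially ?a] by (meson order_trans sequentially_bot)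
qed

context
  fixes G :: stochastic_game and L K :: "nat \<Rightarrow> real"
  assumes wf: "wf_game G"
    and lim: "\<And>s. s \<in> states G \<Longrightarrow> ((\<lambda>l. disc_value G l s) \<longlongrightarrow> L s) (at_right 0)"
    and var: "\<And>s l n. s \<in> states G \<Longrightarrow> (\<And>i. l i \<in> {0<..<1}) \<Longrightarrow> (\<And>i. l (Suc i) \<le> l i) \<Longrightarrow>
        (\<Sum>i<n. \<bar>disc_value G (l (Suc i)) s - disc_value G (l i) s\<bar>) \<le> K s"
begin

text \<open>
  The strategy plays, in the current state, an optimal action of the discounted game whose weight is
  prescribed by the statistic. Averaging the optimality against each pure reply over the actual mixed reply gives
  the one-stage condition of \<open>adaptive_play\<close>.
\<close>

lemma player1_guarantee:
  assumes s0: "s0 \<in> states G" and \<epsilon>: "0 < \<epsilon>"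
  shows "\<exists>\<mu>\<in>strategies1 G. \<forall>\<nu>\<in>strategies2 G. ereal (L s0 - 6 * \<epsilon>) \<le> limavg_payoff G \<mu> \<nu> s0"
proof -
  let ?C = "reward_bound G" and ?v = "disc_value G" and ?r = "reward G"
  have B: "0 < 2 * ?C + 3 * \<epsilon>" using reward_bound_nonneg \<epsilon> by (simp add: add_nonneg_pos)
  have "\<exists>lam phi. slow_schedule (states G) ?v L (2 * ?C + 3 * \<epsilon>) \<epsilon> lam phi"
  proof (rule slow_schedule_exists[OF finite_actions(3) \<epsilon> B])
    show "continuous_on {0<..<1} (\<lambda>l. ?v l s)" if "s \<in> states G" for s
      by (rule continuous_disc_value[OF wf that])
    show "(\<Sum>i<n. \<bar>?v (l (Suc i)) s - ?v (l i) s\<bar>) \<le> K s"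
      if "s \<in> states G" "\<And>i. l i \<in> {0<..<1}" "\<And>i. l (Suc i) \<le> l i" for s l n
      using that by (rule var)
  qed (rule lim)
  then obtain lam phi where slow: "slow_schedule (states G) ?v L (2 * ?C + 3 * \<epsilon>) \<epsilon> lam phi"
    by (elim exE) (rule that)
  note sch = slow_scheduleD[OF slow]
  define opt where "opt l s p \<longleftrightarrow> set_pmf p \<subseteq> actions1 G s \<and>
    (\<forall>b\<in>actions2 G s. ?v l s \<le> (\<Sum>a\<in>actions1 G s. pmf p a * shapley_entry G l (?v l) s a b))" for l s p
  have "\<exists>p. opt l s p" if l: "0 < l" "l < 1" and s: "s \<in> states G" for l s
  proof -
    obtain x y where xy: "saddle (actions1 G s) (actions2 G s) (shapley_entry G l (?v l) s) (?v l s) x y"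
      using disc_value[OF wf l] s by (auto simp: disc_fixpoint_def)
    then have "mixed (actions1 G s) x" by (simp add: saddle_def)
    from pmf_of_mixed[OF finite_actions(1) this]
    obtain p where "set_pmf p \<subseteq> actions1 G s" "\<forall>a\<in>actions1 G s. pmf p a = x a" by blast
    then have "opt l s p" using xy by (simp add: opt_def saddle_def)
    then show ?thesis by blast
  qed
  then obtain P where P: "\<And>l s. 0 < l \<Longrightarrow> l < 1 \<Longrightarrow> s \<in> states G \<Longrightarrow> opt l s (P l s)" by metis
  define \<mu> where "\<mu> h s = P (lam (statistic lam ?v ?r (3 * \<epsilon>) h s)) s" for h s
  have opt: "opt (lam (statistic lam ?v ?r (3 * \<epsilon>) h s)) s (\<mu> h s)" if "s \<in> states G" for h s
    unfolding \<mu>_def using sch(1)[OF statistic_nonneg] that by (intro P) auto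
  then have \<mu>: "\<mu> \<in> strategies1 G" by (simp add: strategies1_def opt_def)
  have "ereal (L s0 - 6 * \<epsilon>) \<le> limavg_payoff G \<mu> \<nu> s0" if \<nu>: "\<nu> \<in> strategies2 G" for \<nu>
  proof -
    interpret adaptive_play G \<mu> \<nu> s0 ?r ?v "L s0" lam phi ?C \<epsilon>
    proof
      fix h s l assume s: "s \<in> states G" and l: "l = lam (statistic lam ?v ?r (3 * \<epsilon>) h s)"
      have o: "?v l s \<le> (\<Sum>a\<in>actions1 G s. pmf (\<mu> h s) a * shapley_entry G l (?v l) s a b)"
        if "b \<in> actions2 G s" for b
        using opt[OF s, of h] that unfolding l[symmetric] by (simp add: opt_def)
      have m: "mixed (actions2 G s) (pmf (\<nu> h s))"
        using supports[OF wf \<mu> \<nu> s] finite_actions by (intro mixed_pmf) auto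
      have "?v l s = (\<Sum>b\<in>actions2 G s. pmf (\<nu> h s) b * ?v l s)" using mixed_sum_const[OF m] by simp
      also have "\<dots> \<le> (\<Sum>b\<in>actions2 G s. pmf (\<nu> h s) b *
          (\<Sum>a\<in>actions1 G s. pmf (\<mu> h s) a * shapley_entry G l (?v l) s a b))"
        using o by (rule mixed_sum_mono[OF m])
      also have "\<dots> = (\<Sum>a\<in>actions1 G s. pmf (\<mu> h s) a *
          (\<Sum>b\<in>actions2 G s. pmf (\<nu> h s) b * shapley_entry G l (?v l) s a b))"
        unfolding sum_distrib_left by (subst sum.swap) (simp add: mult_ac)
      also have "\<dots> = measure_pmf.expectation (next_position G \<mu> \<nu> (h, s))
          (\<lambda>(h', s'). l * last_payoff ?r h' + (1 - l) * ?v l s')"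
        unfolding expectation_next_position[OF wf \<mu> \<nu> s] shapley_entry_def ..
      finally show "?v l s \<le> measure_pmf.expectation (next_position G \<mu> \<nu> (h, s))
          (\<lambda>(h', s'). l * last_payoff ?r h' + (1 - l) * ?v l s')" .
    next
      show "L s0 - \<epsilon> \<le> ?v (lam 0) s0" using sch(5)[OF s0] by (simp add: abs_le_iff)
    qed (use wf \<mu> \<nu> s0 \<epsilon> sch reward_le_bound disc_value_bound[OF wf] in \<open>simp_all\<close>)
    obtain K where "\<And>\<tau>. real \<tau> * (L s0 - 6 * \<epsilon>) - K \<le> (\<Sum>t<\<tau>. expected_payoff G \<mu> \<nu> s0 t)"
      using total_payoff_lower
      unfolding expected_payoff_eq_position[OF wf \<mu> \<nu> s0] case_prod_unfold by blast
    then show ?thesis unfolding limavg_payoff_def by (rule liminf_average_ge)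
  qed
  then show ?thesis using \<mu> by blast
qed

text \<open>
  The same construction for the negated payoffs and values. It bounds all late averages from above, so
  also their lower limit.
\<close>

lemma player2_guarantee:
  assumes s0: "s0 \<in> states G" and \<epsilon>: "0 < \<epsilon>"
  shows "\<exists>\<nu>\<in>strategies2 G. \<forall>\<mu>\<in>strategies1 G. limavg_payoff G \<mu> \<nu> s0 \<le> ereal (L s0 + 6 * \<epsilon>)"
proof -
  let ?C = "reward_bound G" and ?v = "\<lambda>l s. - disc_value G l s" and ?r = "\<lambda>s a b. - reward G s a b"
  have B: "0 < 2 * ?C + 3 * \<epsilon>" using reward_bound_nonneg \<epsilon> by (simp add: add_nonneg_pos)
  have "\<exists>lam phi. slow_schedule (states G) ?v (\<lambda>s. - L s) (2 * ?C + 3 * \<epsilon>) \<epsilon> lam phi"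
  proof (rule slow_schedule_exists[OF finite_actions(3) \<epsilon> B])
    show "continuous_on {0<..<1} (\<lambda>l. ?v l s)" if "s \<in> states G" for s
      using continuous_disc_value[OF wf that] by (rule continuous_on_minus)
    show "(\<Sum>i<n. \<bar>?v (l (Suc i)) s - ?v (l i) s\<bar>) \<le> K s"
      if "s \<in> states G" "\<And>i. l i \<in> {0<..<1}" "\<And>i. l (Suc i) \<le> l i" for s l n
      using var[of s l n] that by (simp add: abs_minus_commute)
    show "((\<lambda>l. ?v l s) \<longlongrightarrow> - L s) (at_right 0)" if "s \<in> states G" for s
      using lim[OF that] by (rule tendsto_minus)
  qed
  then obtain lam phi where slow: "slow_schedule (states G) ?v (\<lambda>s. - L s) (2 * ?C + 3 * \<epsilon>) \<epsilon> lam phi"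
    by (elim exE) (rule that)
  note sch = slow_scheduleD[OF slow]
  define opt where "opt l s p \<longleftrightarrow> set_pmf p \<subseteq> actions2 G s \<and>
    (\<forall>a\<in>actions1 G s. (\<Sum>b\<in>actions2 G s. pmf p b * shapley_entry G l (disc_value G l) s a b) \<le> disc_value G l s)"
    for l s p
  have "\<exists>p. opt l s p" if l: "0 < l" "l < 1" and s: "s \<in> states G" for l s
  proof -
    obtain x y where xy: "saddle (actions1 G s) (actions2 G s) (shapley_entry G l (disc_value G l) s)
        (disc_value G l s) x y"
      using disc_value[OF wf l] s by (auto simp: disc_fixpoint_def)
    then have "mixed (actions2 G s) y" by (simp add: saddle_def)
    from pmf_of_mixed[OF finite_actions(2) this]
    obtain p where "set_pmf p \<subseteq> actions2 G s" "\<forall>b\<in>actions2 G s. pmf p b = y b" by blast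
    then have "opt l s p" using xy by (simp add: opt_def saddle_def mult.commute)
    then show ?thesis by blast
  qed
  then obtain P where P: "\<And>l s. 0 < l \<Longrightarrow> l < 1 \<Longrightarrow> s \<in> states G \<Longrightarrow> opt l s (P l s)" by metis
  define \<nu> where "\<nu> h s = P (lam (statistic lam ?v ?r (3 * \<epsilon>) h s)) s" for h s
  have opt: "opt (lam (statistic lam ?v ?r (3 * \<epsilon>) h s)) s (\<nu> h s)" if "s \<in> states G" for h s
    unfolding \<nu>_def using sch(1)[OF statistic_nonneg] that by (intro P) auto
  then have \<nu>: "\<nu> \<in> strategies2 G" by (simp add: strategies2_def opt_def)
  have "limavg_payoff G \<mu> \<nu> s0 \<le> ereal (L s0 + 6 * \<epsilon>)" if \<mu>: "\<mu> \<in> strategies1 G" for \<mu>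
  proof -
    interpret adaptive_play G \<mu> \<nu> s0 ?r ?v "- L s0" lam phi ?C \<epsilon>
    proof
      fix h s l assume s: "s \<in> states G" and l: "l = lam (statistic lam ?v ?r (3 * \<epsilon>) h s)"
      let ?u = "disc_value G l"
      have o: "(\<Sum>b\<in>actions2 G s. pmf (\<nu> h s) b * shapley_entry G l ?u s a b) \<le> ?u s"
        if "a \<in> actions1 G s" for a
        using opt[OF s, of h] that unfolding l[symmetric] by (simp add: opt_def)
      have m: "mixed (actions1 G s) (pmf (\<mu> h s))"
        using supports[OF wf \<mu> \<nu> s] finite_actions by (intro mixed_pmf) auto
      have "measure_pmf.expectation (next_position G \<mu> \<nu> (h, s))
          (\<lambda>(h', s'). l * last_payoff ?r h' + (1 - l) * ?v l s') =
        - (\<Sum>a\<in>actions1 G s. pmf (\<mu> h s) a * (\<Sum>b\<in>actions2 G s. pmf (\<nu> h s) b * shapley_entry G l ?u s a b))"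
        unfolding expectation_next_position[OF wf \<mu> \<nu> s, of h l ?r "?v l"] sum_negf[symmetric]
          mult_minus_right[symmetric] shapley_entry_def
        by (simp add: sum_negf)
      moreover have "(\<Sum>a\<in>actions1 G s. pmf (\<mu> h s) a * (\<Sum>b\<in>actions2 G s. pmf (\<nu> h s) b * shapley_entry G l ?u s a b))
        \<le> (\<Sum>a\<in>actions1 G s. pmf (\<mu> h s) a * ?u s)"
        using o by (rule mixed_sum_mono[OF m])
      ultimately show "?v l s \<le> measure_pmf.expectation (next_position G \<mu> \<nu> (h, s))
          (\<lambda>(h', s'). l * last_payoff ?r h' + (1 - l) * ?v l s')"
        using mixed_sum_const[OF m, of "?u s"] by linarith
    next
      show "- L s0 - \<epsilon> \<le> ?v (lam 0) s0" using sch(5)[OF s0] by (simp add: abs_le_iff)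
    qed (use wf \<mu> \<nu> s0 \<epsilon> sch reward_le_bound disc_value_bound[OF wf] in \<open>simp_all\<close>)
    have neg: "measure_pmf.expectation (position G \<mu> \<nu> s0 (Suc t)) (\<lambda>x. last_payoff ?r (fst x)) =
        - expected_payoff G \<mu> \<nu> s0 t" for t
      unfolding expected_payoff_eq_position[OF wf \<mu> \<nu> s0]
      by (simp add: last_payoff_def case_prod_unfold del: position.simps)
    obtain K where "\<And>\<tau>. real \<tau> * (- (L s0 + 6 * \<epsilon>)) - K \<le> (\<Sum>t<\<tau>. - expected_payoff G \<mu> \<nu> s0 t)"
      using total_payoff_lower unfolding neg by (auto simp: algebra_simps)
    then show ?thesis unfolding limavg_payoff_def by (rule liminf_average_le)
  qed
  then show ?thesis using \<nu> by blast
qed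

text \<open>
  Each player can guarantee the limit up to every positive error, so the lower value is at least the limit and
  the upper value at most the limit.
\<close>

theorem limavg_value_eq_limit:
  assumes s0: "s0 \<in> states G"
  shows "limavg_value G s0 = L s0"
proof -
  let ?S = "SUP \<mu>\<in>strategies1 G. INF \<nu>\<in>strategies2 G. limavg_payoff G \<mu> \<nu> s0"
  let ?I = "INF \<nu>\<in>strategies2 G. SUP \<mu>\<in>strategies1 G. limavg_payoff G \<mu> \<nu> s0"
  have SI: "?S \<le> ?I"
    by (intro SUP_least INF_greatest) (meson INF_lower2 SUP_upper order_refl order_trans)
  have low: "ereal (L s0 - e) \<le> ?S" if "0 < e" for e
  proof -
    obtain \<mu> where \<mu>: "\<mu> \<in> strategies1 G"
      "\<forall>\<nu>\<in>strategies2 G. ereal (L s0 - 6 * (e / 6)) \<le> limavg_payoff G \<mu> \<nu> s0"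
      using player1_guarantee[OF s0, of "e / 6"] \<open>0 < e\<close> by auto
    then have "ereal (L s0 - e) \<le> (INF \<nu>\<in>strategies2 G. limavg_payoff G \<mu> \<nu> s0)"
      by (intro INF_greatest) simp
    also have "\<dots> \<le> ?S" using \<mu>(1) by (rule SUP_upper)
    finally show ?thesis .
  qed
  have up: "?I \<le> ereal (L s0) + ereal e" if "0 < e" for e
  proof -
    obtain \<nu> where \<nu>: "\<nu> \<in> strategies2 G"
      "\<forall>\<mu>\<in>strategies1 G. limavg_payoff G \<mu> \<nu> s0 \<le> ereal (L s0 + 6 * (e / 6))"
      using player2_guarantee[OF s0, of "e / 6"] \<open>0 < e\<close> by auto
    have "?I \<le> (SUP \<mu>\<in>strategies1 G. limavg_payoff G \<mu> \<nu> s0)" using \<nu>(1) by (rule INF_lower)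
    also have "\<dots> \<le> ereal (L s0 + e)" using \<nu>(2) by (intro SUP_least) simp
    finally show ?thesis by simp
  qed
  have "?I \<le> ereal (L s0)"
  proof (rule ereal_le_epsilon2)
    show "?I \<le> ereal (L s0) + ereal e" if "0 < e" for e using up[OF that] .
  qed
  moreover have "ereal (L s0) \<le> ?S"
  proof (rule ereal_le_epsilon2)
    show "ereal (L s0) \<le> ?S + ereal e" if "0 < e" for e
      using add_right_mono[OF low[OF that], of "ereal e"] by simp
  qed
  ultimately have "is_limavg_value G s0 (L s0)"
    unfolding is_limavg_value_def using SI by (meson antisym order_trans)
  then show ?thesis
    unfolding limavg_value_def
  proof (rule the_equality)
    fix w assume "is_limavg_value G s0 w"
    then have "ereal w = ereal (L s0)"
      using \<open>is_limavg_value G s0 (L s0)\<close> unfolding is_limavg_value_def by metis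
    then show "w = L s0" by simp
  qed
qed

end

theorem theorem4p1:
  fixes G :: stochastic_game
  assumes "wf_game G"
    and "\<And>s a b. s \<in> states G \<Longrightarrow> a \<in> actions1 G s \<Longrightarrow> b \<in> actions2 G s \<Longrightarrow>
           algebraic (reward G s a b)"
    and "\<And>s a b s'. s \<in> states G \<Longrightarrow> a \<in> actions1 G s \<Longrightarrow> b \<in> actions2 G s \<Longrightarrow> s' \<in> states G \<Longrightarrow>
           algebraic (pmf (transition G s a b) s')"
  shows "\<forall>s\<in>states G. algebraic (limavg_value G s)"
proof -
  let ?C = "reward_bound G"
  have bd: "\<bar>disc_value G l s\<bar> \<le> ?C" if "l \<in> {0<..<1}" "s \<in> states G" for l s
    using disc_value_bound[OF assms(1)] that by simp
  have curve: "\<exists>q. algebraic_coeffs q \<and> q \<noteq> 0 \<and> (\<forall>l\<in>{0<..<1}. bieval q l (disc_value G l s) = 0)"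
    if s: "s \<in> states G" for s
  proof -
    obtain k where k: "s = Suc k" "k < nstates G" using s by (cases s) (auto simp: states_def)
    show ?thesis unfolding k(1) by (rule disc_value_on_algebraic_curve[OF assms k(2)])
  qed
  define good where "good s L K \<longleftrightarrow> ((\<lambda>l. disc_value G l s) \<longlongrightarrow> L) (at_right 0) \<and> algebraic L \<and>
      (\<forall>l n. (\<forall>i. l i \<in> {0<..<1}) \<longrightarrow> (\<forall>i. l (Suc i) \<le> l i) \<longrightarrow>
        (\<Sum>i<n. \<bar>disc_value G (l (Suc i)) s - disc_value G (l i) s\<bar>) \<le> K)" for s L K
  have "\<exists>L K. good s L K" if s: "s \<in> states G" for s
  proof -
    from curve[OF s] obtain q where q: "algebraic_coeffs q" "q \<noteq> 0"
      and q0: "\<forall>l\<in>{0<..<1}. bieval q l (disc_value G l s) = 0"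
      by (elim exE conjE) (rule that)
    note q = q bspec[OF q0]
    note cont = continuous_disc_value[OF assms(1) s]
    obtain L where L: "((\<lambda>l. disc_value G l s) \<longlongrightarrow> L) (at_right 0)"
      using algebraic_curve_limit_exists[OF cont bd[OF _ s] q(2,3)] by blast
    have "algebraic L" by (rule algebraic_curve_limit_algebraic[OF q L])
    have "\<exists>E. finite E \<and> (\<forall>c. c \<notin> E \<longrightarrow> finite {l \<in> {0<..<1}. disc_value G l s = c} \<and>
        card {l \<in> {0<..<1}. disc_value G l s = c} \<le> degree q)"
      by (rule level_sets_bounded[OF q(2,3)])
    then obtain E where E: "finite E" "\<And>c. c \<notin> E \<Longrightarrow> finite {l \<in> {0<..<1}. disc_value G l s = c} \<and>
        card {l \<in> {0<..<1}. disc_value G l s = c} \<le> degree q"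
      by (elim exE conjE) (rule that, assumption, simp)
    have "(\<Sum>i<n. \<bar>disc_value G (l (Suc i)) s - disc_value G (l i) s\<bar>) \<le> 2 * ?C * real (degree q)"
      if "\<forall>i. l i \<in> {0<..<1}" "\<forall>i. l (Suc i) \<le> l i" for l n
      using that by (intro variation_le_level_count[OF cont _ bd[OF _ s] E]) auto
    then have "good s L (2 * ?C * real (degree q))"
      unfolding good_def using L \<open>algebraic L\<close> by simp
    then show ?thesis by blast
  qed
  then obtain L K where LK: "\<And>s. s \<in> states G \<Longrightarrow> good s (L s) (K s)" by metis
  show ?thesis
  proof
    fix s assume s: "s \<in> states G"
    have "limavg_value G s = L s"
    proof (rule limavg_value_eq_limit[OF assms(1) _ _ s])
      show "((\<lambda>l. disc_value G l s) \<longlongrightarrow> L s) (at_right 0)" if "s \<in> states G" for s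
        using LK[OF that] by (simp add: good_def)
      show "(\<Sum>i<n. \<bar>disc_value G (l (Suc i)) s - disc_value G (l i) s\<bar>) \<le> K s"
        if "s \<in> states G" "\<And>i. l i \<in> {0<..<1}" "\<And>i. l (Suc i) \<le> l i" for s l n
        using LK[OF that(1)] that(2,3) by (simp add: good_def)
    qed
    then show "algebraic (limavg_value G s)" using LK[OF s] by (simp add: good_def)
  qed
qed

end
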